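(* Let $q\in(1,\infty]$ and $f\in\mathrm{BMO}(\mathbb R^n_+)$. Then $f\in\mathrm{BMO}^{\log}(\mathbb R^n_+)$ if and only if $a(f-f_B)\in H^1_r(\mathbb R^n_+)$ for all $(H^1_r,q)$-atoms $a$ associated with balls $B$. Moreover, $$\|f\|_{\mathrm{BMO}^{\log}(\mathbb R^n_+)}\simeq\|f\|_{\mathrm{BMO}(\mathbb R^n_+)}+\sup_{(H^1_r,q)\text{-atoms } a \text{ associated with } B}\|a(f-f_B)\|_{H^1_r(\mathbb R^n_+)},$$ where the supremum is taken over all $(H^1_r,q)$-atoms $a$ (with associated balls $B$), and the implicit constants are independent of $f$.
   Context: Half-space and balls: $\mathbb R^n_+=\{x=(x',x^n)\in\mathbb R^{n-1}\times(0,\infty)\}$, where $x^n$ is the last coordinate of $x$ (not a power). Balls are balls of the metric space $\mathbb R^n_+$: $B=B(x_B,r_B)=\{y\in\mathbb R^n_+:|y-x_B|<r_B\}$ with $x_B\in\mathbb R^n_+$, $r_B>0$. $f_B=\frac1{|B|}\int_B f$ and $\mathrm{MO}(f,B)=\frac1{|B|}\int_B|f-f_B|\,dx$. Hardy space: for $1<q\le\infty$, an $(H^1_r,q)$-atom associated with a ball $B\subset\mathbb R^n_+$ is a bounded measurable $a:\mathbb R^n_+\to\mathbb R$ supported in $B$ with $\|a\|_{L^q}\le|B|^{1/q-1}$ and such that either $x_B^n/4<r_B<x_B^n/2$, or $r_B\le x_B^n/4$ and $\int a\,dx=0$. $H^1_r(\mathbb R^n_+)$ is the set of $f\in L^1(\mathbb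 R^n_+)$ of the form $f=\sum_j\lambda_ja_j$ with $(H^1_r,q)$-atoms $a_j$ and scalars $\lambda_j$ with $\sum_j|\lambda_j|<\infty$, with norm the infimum of $\sum_j|\lambda_j|$ over all such representations; different $q\in(1,\infty]$ give the same space with equivalent norms. BMO spaces: for $f\in L^1_{\rm loc}(\mathbb R^n_+)$, $\|f\|_{\mathrm{BMO}(\mathbb R^n_+)}=\sup_B\mathrm{MO}(f,B)$ and $\|f\|_{\mathrm{BMO}^{\log}(\mathbb R^n_+)}=\sup_B\log\big(e+\frac{x_B^n}{r_B}\big)\mathrm{MO}(f,B)$, suprema over all balls $B$; the spaces consist of the $f$ for which these are finite. $A\simeq A'$ means $C^{-1}A'\le A\le CA'$ for a constant $C\geq 1$.
   Formalization: In the "if" direction, a(f−f_B) ∈ H^1_r for all atoms is supplemented by finiteness of the supremum of the norms ‖a(f−f_B)‖_{H^1_r}, since membership alone is automatic for bounded f (e.g. a half-space indicator, which is not in BMO^log). *)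

theory Defs
  imports "HOL-Analysis.Analysis" "HOL-Probability.Essential_Supremum"
begin

text \<open>
  \<open>\<real>\<^sup>n\<close> is the type \<open>real ^ 'n\<close> with \<open>n = CARD('n)\<close>. The index type carries no order, so the
  coordinate that is positive on the half-space (the last one, on paper) is a parameter
  \<open>k :: 'n\<close>. Functions on the half-space are total functions on \<open>real ^ 'n\<close>; their values
  outside the half-space are never used. Quantities that may be infinite live in \<open>ennreal\<close>.
\<close>

definition halfspace :: "'n::finite \<Rightarrow> (real ^ 'n) set" where
  "halfspace k = {x. 0 < x $ k}"

text \<open>
  Centre and radius are kept as explicit data throughout, since different pairs can give the
  same set when the ball is cut off by the boundary.
\<close>

definition is_ball :: "'n::finite \<Rightarrow> real ^ 'n \<Rightarrow> real \<Rightarrow> bool" where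
  "is_ball k x r \<longleftrightarrow> x \<in> halfspace k \<and> 0 < r"

definition hball :: "'n::finite \<Rightarrow> real ^ 'n \<Rightarrow> real \<Rightarrow> (real ^ 'n) set" where
  "hball k x r = {y \<in> halfspace k. dist y x < r}"

definition avg :: "(real ^ 'n::finite \<Rightarrow> real) \<Rightarrow> (real ^ 'n) set \<Rightarrow> real" where
  "avg f B = set_lebesgue_integral lebesgue B f / measure lebesgue B"

text \<open>
  The outer integral is a nonnegative extended one, so that the mean oscillation is infinite
  (and not \<open>0\<close>) when \<open>f\<close> is measurable but not integrable on \<open>B\<close>, which local integrability
  does not exclude for balls touching the boundary.
\<close>

definition MO :: "(real ^ 'n::finite \<Rightarrow> real) \<Rightarrow> (real ^ 'n) set \<Rightarrow> ennreal" where
  "MO f B = (\<integral>\<^sup>+ y \<in> B. ennreal \<bar>f y - avg f B\<bar> \<partial>lebesgue) / emeasure lebesgue B"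

definition L1_loc :: "'n::finite \<Rightarrow> (real ^ 'n \<Rightarrow> real) set" where
  "L1_loc k = {f. \<forall>K. compact K \<and> K \<subseteq> halfspace k \<longrightarrow> set_integrable lebesgue K f}"

definition BMO_norm :: "'n::finite \<Rightarrow> (real ^ 'n \<Rightarrow> real) \<Rightarrow> ennreal" where
  "BMO_norm k f = (SUP (x, r) \<in> {(x, r). is_ball k x r}. MO f (hball k x r))"

definition BMO_log_norm :: "'n::finite \<Rightarrow> (real ^ 'n \<Rightarrow> real) \<Rightarrow> ennreal" where
  "BMO_log_norm k f =
     (SUP (x, r) \<in> {(x, r). is_ball k x r}. ennreal (ln (exp 1 + x $ k / r)) * MO f (hball k x r))"

definition BMO :: "'n::finite \<Rightarrow> (real ^ 'n \<Rightarrow> real) set" where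
  "BMO k = {f \<in> L1_loc k. BMO_norm k f < \<infinity>}"

definition BMO_log :: "'n::finite \<Rightarrow> (real ^ 'n \<Rightarrow> real) set" where
  "BMO_log k = {f \<in> L1_loc k. BMO_log_norm k f < \<infinity>}"

definition Lq_norm :: "ennreal \<Rightarrow> (real ^ 'n::finite \<Rightarrow> real) \<Rightarrow> ennreal" where
  "Lq_norm q g =
     (if q = \<infinity> then esssup lebesgue (\<lambda>x. ennreal \<bar>g x\<bar>)
      else let I = (\<integral>\<^sup>+ x. ennreal (\<bar>g x\<bar> powr enn2real q) \<partial>lebesgue)
           in if I = \<infinity> then \<infinity> else ennreal (enn2real I powr (1 / enn2real q)))"

text \<open>
  \<open>H1r_atom k q a x r\<close>: \<open>a\<close> is an \<open>(H\<^sup>1\<^sub>r, q)\<close>-atom associated with the ball with centre \<open>x\<close> and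
  radius \<open>r\<close>. For \<open>q = \<infinity>\<close> the exponent \<open>1/q - 1\<close> is \<open>-1\<close>, as \<open>1 / \<infinity> = 0\<close> in \<open>ennreal\<close>.
\<close>

definition H1r_atom ::
    "'n::finite \<Rightarrow> ennreal \<Rightarrow> (real ^ 'n \<Rightarrow> real) \<Rightarrow> real ^ 'n \<Rightarrow> real \<Rightarrow> bool" where
  "H1r_atom k q a x r \<longleftrightarrow>
     is_ball k x r \<and>
     a \<in> borel_measurable lebesgue \<and> bounded (range a) \<and>
     (\<forall>y. y \<notin> hball k x r \<longrightarrow> a y = 0) \<and>
     Lq_norm q a \<le> ennreal (measure lebesgue (hball k x r) powr (enn2real (1 / q) - 1)) \<and>
     (x $ k / 4 < r \<and> r < x $ k / 2 \<or>
      r \<le> x $ k / 4 \<and> (\<integral>y. a y \<partial>lebesgue) = 0)"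

text \<open>
  \<open>g = (\<Sum>j. \<lambda>\<^sub>j a\<^sub>j)\<close> with convergence in \<open>L\<^sup>1\<close> of the half-space; the series converges absolutely
  there because atoms have \<open>L\<^sup>1\<close> norm at most \<open>1\<close>. Finite sums are covered by zero coefficients.
\<close>

definition H1r_representation ::
    "'n::finite \<Rightarrow> ennreal \<Rightarrow> (real ^ 'n \<Rightarrow> real) \<Rightarrow>
     (nat \<Rightarrow> real) \<Rightarrow> (nat \<Rightarrow> real ^ 'n \<Rightarrow> real) \<Rightarrow> bool" where
  "H1r_representation k q g c a \<longleftrightarrow>
     set_integrable lebesgue (halfspace k) g \<and>
     (\<forall>j. \<exists>x r. H1r_atom k q (a j) x r) \<and>
     summable (\<lambda>j. \<bar>c j\<bar>) \<and>
     (\<lambda>N. \<integral>\<^sup>+ y \<in> halfspace k. ennreal \<bar>g y - (\<Sum>j<N. c j * a j y)\<bar> \<partial>lebesgue)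
        \<longlonglongrightarrow> 0"

definition H1r :: "'n::finite \<Rightarrow> ennreal \<Rightarrow> (real ^ 'n \<Rightarrow> real) set" where
  "H1r k q = {g. \<exists>c a. H1r_representation k q g c a}"

text \<open>The norm is \<open>\<infinity>\<close> outside \<open>H1r k q\<close>.\<close>

definition H1r_norm :: "'n::finite \<Rightarrow> ennreal \<Rightarrow> (real ^ 'n \<Rightarrow> real) \<Rightarrow> ennreal" where
  "H1r_norm k q g =
     (INF (c, a) \<in> {(c, a). H1r_representation k q g c a}. \<Sum>j. ennreal \<bar>c j\<bar>)"

definition atom_product ::
    "'n::finite \<Rightarrow> (real ^ 'n \<Rightarrow> real) \<Rightarrow> (real ^ 'n \<Rightarrow> real) \<Rightarrow> real ^ 'n \<Rightarrow> real \<Rightarrow> real ^ 'n \<Rightarrow> real" where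
  "atom_product k f a x r = (\<lambda>y. a y * (f y - avg f (hball k x r)))"

text \<open>
  The exponent \<open>p\<close> of the atoms defining the Hardy norm is independent of the exponent \<open>q\<close> of
  the atoms being multiplied. The equivalence with \<open>BMO_log\<close> needs this supremum to be finite:
  for bounded \<open>f\<close> each single product is a multiple of one atom (on a larger concentric ball where
  no cancellation is required), so membership in \<open>H1r\<close> for each atom separately is not enough.
\<close>

definition atom_product_sup ::
    "'n::finite \<Rightarrow> ennreal \<Rightarrow> ennreal \<Rightarrow> (real ^ 'n \<Rightarrow> real) \<Rightarrow> ennreal" where
  "atom_product_sup k p q f =
     (SUP (a, x, r) \<in> {(a, x, r). H1r_atom k q a x r}. H1r_norm k p (atom_product k f a x r))"

end

(*
  If f is in BMO^log and a is an atom on B = B(x, r), then a (f - f_B) is decomposed by one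
  stopping-time argument on dyadic cubes of side at most comparable to r: below a cube Q stop as
  soon as the average of |B|^s |a|^s + 1 (relative to its average W_Q on Q) or of |f - f_Q|
  (relative to the mean oscillation bound) is large. The quantity
  v(Q) = |Q| W_Q^(1/s) (K omega + |f_Q - f_B|) / |B| dominates the integral of |a (f - f_B)| over Q
  and loses a factor 2 at each generation, so the oscillating parts sum to bounded multiples of
  cancelling atoms, with neither the John-Nirenberg inequality nor the equivalence of the atomic
  norms being used. The averages over the starting cubes remain; each is carried to the boundary
  scale by doubling balls, which costs about log (x^n / r) atoms, and this is compensated by the
  logarithm in the norm of f.

  Conversely, take a = (sgn (f - f_B) - c) / (2 |B|) on a small ball B and test a (f - f_B) against
  the sum of the indicators of the balls 2^j B away from the boundary. This sum has about
  log (x^n / r) terms on B, while its integral against an atom is bounded uniformly.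
*)
theory Submission
  imports Defs
begin

section \<open>Atoms\<close>

text \<open>The exponents p and q are unrelated and f - f_B is unbounded, so a product need not have
  the integrability of an atom. Every atom produced is therefore bounded by the inverse volume of
  its ball, which makes it an atom for all exponents at once. Stopping on one factor alone would
  leave the other one unbounded; the sum of both relative sizes is a single function that stops on
  either. The halving rests on s > 1. The stopped cubes have small total volume but may carry the
  full integral of |a|^s; the s-th root turns small volume into a small total of v, and the
  constants 16 and 8 in \<Lambda> are what makes this total 1/2. The bound of the integrals by v
  starts from a crude one whose constant depends on a; repeated halving removes that dependence. The
  balls around the cubes have a ratio of height to radius at least that of B, so the oscillation on
  all of them is at most the norm divided by the logarithm for B. Only the starting averages pay the
  logarithm back. In the converse, p > 1 makes the mass of an atom in a small set decay like a power
  of the volume, so the test sums are geometric.\<close>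

abbreviation vol :: "'a::euclidean_space set \<Rightarrow> real" where
  "vol \<equiv> measure lebesgue"

lemma hball_eq_ball:
  fixes x :: "real ^ 'n::finite"
  assumes "r \<le> x $ k"
  shows "hball k x r = ball x r"
proof -
  have "0 < y $ k" if "dist y x < r" for y
  proof -
    have "\<bar>(y - x) $ k\<bar> \<le> norm (y - x)" by (rule component_le_norm_cart)
    then show ?thesis using that assms by (simp add: dist_norm)
  qed
  then show ?thesis
    by (auto simp: hball_def halfspace_def ball_def dist_commute)
qed

lemma measure_lebesgue_ball:
  fixes x :: "real ^ 'n::finite"
  assumes "0 \<le> r"
  shows "vol (ball x r) = r ^ CARD('n) * vol (ball (0 :: real ^ 'n) 1)"
  using content_ball_conv_unit_ball[OF assms, of x] by simp

lemma measure_lebesgue_ball_pos: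
  fixes x :: "real ^ 'n::finite"
  assumes "0 < r"
  shows "0 < vol (ball x r)"
  using content_ball_pos[OF assms, of x] by simp

lemma integrable_indicator_mult:
  fixes c :: real
  shows "S \<in> lmeasurable \<Longrightarrow> integrable lebesgue (\<lambda>z. indicator S z * c)"
  by (intro integrable_mult_left integrable_real_indicator) (auto simp: fmeasurable_def)

lemma abs_set_integral_le:
  fixes f :: "'a \<Rightarrow> real"
  shows "\<bar>LINT z:E|M. f z\<bar> \<le> (LINT z:E|M. \<bar>f z\<bar>)"
  unfolding set_lebesgue_integral_def by (rule integral_abs_bound[THEN order_trans]) (simp add: abs_mult)

lemma integrable_bounded_support:
  fixes f :: "real ^ 'n::finite \<Rightarrow> real"
  assumes "f \<in> borel_measurable lebesgue" "S \<in> lmeasurable"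
    and "\<And>z. z \<in> S \<Longrightarrow> \<bar>f z\<bar> \<le> A" and "\<And>z. z \<notin> S \<Longrightarrow> f z = 0"
  shows "integrable lebesgue f"
proof (rule Bochner_Integration.integrable_bound[where f = "\<lambda>z. indicator S z * A"])
  show "integrable lebesgue (\<lambda>z. indicator S z * A)"
    by (rule integrable_indicator_mult[OF assms(2)])
  show "AE z in lebesgue. norm (f z) \<le> norm (indicator S z * A)"
    using assms(3,4) by (intro AE_I2) (auto simp: indicator_def intro: order_trans[OF _ abs_ge_self])
qed (use assms in auto)

text \<open>For p = \<infinity> the bound by the inverse volume implies the L^s normalisation for
  every finite s. The value 2 is one choice, so that a single finite exponent above 1 serves all
  cases.\<close>

definition fin_exponent :: "ennreal \<Rightarrow> real" where
  "fin_exponent p = (if p = \<infinity> then 2 else enn2real p)"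

lemma fin_exponent_gt_1: "1 < p \<Longrightarrow> 1 < fin_exponent p"
  unfolding fin_exponent_def
  by (cases p) (auto simp flip: ennreal_1 simp: ennreal_less_iff top_ennreal.rep_eq)

lemma enn2real_inverse_exponent:
  assumes "1 < p" "p \<noteq> \<infinity>"
  shows "enn2real (1 / p) = 1 / enn2real p"
proof (cases p)
  case (real r)
  with assms(1) have "1 < r" by (simp flip: ennreal_1 add: ennreal_less_iff)
  then have "1 / p = ennreal (1 / r)" by (simp add: real flip: ennreal_1 add: divide_ennreal)
  then show ?thesis using \<open>1 < r\<close> by (simp add: real)
qed (use assms in auto)

text \<open>Either alternative in the definition of an atom puts the radius below half the height,
  so truncation by the boundary never affects its ball.\<close>

lemma H1r_atom_radius:
  assumes "H1r_atom k p a x r"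
  shows "0 < r" "r < x $ k / 2" "hball k x r = ball x r"
proof -
  from assms show "0 < r" "r < x $ k / 2"
    by (auto simp: H1r_atom_def is_ball_def halfspace_def)
  then show "hball k x r = ball x r" by (intro hball_eq_ball) auto
qed

lemma H1r_atom_basic:
  fixes a :: "real ^ 'n::finite \<Rightarrow> real"
  assumes "H1r_atom k p a x r"
  shows "a \<in> borel_measurable lebesgue" "\<exists>A>0. \<forall>z. \<bar>a z\<bar> \<le> A" "\<And>z. z \<notin> ball x r \<Longrightarrow> a z = 0"
    "integrable lebesgue a"
proof -
  show m: "a \<in> borel_measurable lebesgue" using assms by (simp add: H1r_atom_def)
  have "bounded (range a)" using assms by (simp add: H1r_atom_def)
  then obtain A where A: "A > 0" "\<And>z. \<bar>a z\<bar> \<le> A" by (auto simp: bounded_pos)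
  then show "\<exists>A>0. \<forall>z. \<bar>a z\<bar> \<le> A" by blast
  show s: "\<And>z. z \<notin> ball x r \<Longrightarrow> a z = 0"
    using assms H1r_atom_radius[OF assms] by (simp add: H1r_atom_def)
  show "integrable lebesgue a"
    by (rule integrable_bounded_support[OF m lmeasurable_ball]) (use A s in auto)
qed

text \<open>The norm condition raised to the power s, which removes the root; for p = \<infinity> it
  comes from integrating the essential bound over the ball.\<close>

lemma H1r_atom_powr_integral:
  fixes a :: "real ^ 'n::finite \<Rightarrow> real"
  assumes "1 < p" and a: "H1r_atom k p a x r"
  defines "s \<equiv> fin_exponent p"
  shows "integrable lebesgue (\<lambda>z. \<bar>a z\<bar> powr s)"
    and "(\<integral>z. \<bar>a z\<bar> powr s \<partial>lebesgue) \<le> vol (ball x r) powr (1 - s)"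
proof -
  let ?B = "vol (ball x r)"
  note rad = H1r_atom_radius[OF a] and bas = H1r_atom_basic[OF a]
  have B: "0 < ?B" by (rule measure_lebesgue_ball_pos) (rule rad)
  have s: "1 < s" using fin_exponent_gt_1[OF assms(1)] by (simp add: s_def)
  obtain A where A: "A > 0" "\<And>z. \<bar>a z\<bar> \<le> A" using bas(2) by blast
  show int: "integrable lebesgue (\<lambda>z. \<bar>a z\<bar> powr s)"
  proof (rule integrable_bounded_support[where A = "A powr s", OF _ lmeasurable_ball[of x r]])
    show "(\<lambda>z. \<bar>a z\<bar> powr s) \<in> borel_measurable lebesgue" using bas(1) by measurable
    show "\<bar>\<bar>a z\<bar> powr s\<bar> \<le> A powr s" for z using powr_mono2[of s "\<bar>a z\<bar>" A] A s by simp
  qed (simp add: bas(3))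
  have Lq: "Lq_norm p a \<le> ennreal (?B powr (enn2real (1 / p) - 1))"
    using a rad(3) by (simp add: H1r_atom_def)
  show "(\<integral>z. \<bar>a z\<bar> powr s \<partial>lebesgue) \<le> ?B powr (1 - s)"
  proof (cases "p = \<infinity>")
    case True
    have "esssup lebesgue (\<lambda>x. ennreal \<bar>a x\<bar>) \<le> ennreal (1 / ?B)"
      using Lq True B by (simp add: Lq_norm_def powr_minus divide_inverse)
    then have ae: "AE z in lebesgue. \<bar>a z\<bar> \<le> 1 / ?B"
      using esssup_AE[of "\<lambda>x. ennreal \<bar>a x\<bar>" lebesgue]
    proof (elim eventually_mono)
      fix z assume le: "ennreal \<bar>a z\<bar> \<le> esssup lebesgue (\<lambda>x. ennreal \<bar>a x\<bar>)"
        "esssup lebesgue (\<lambda>x. ennreal \<bar>a x\<bar>) \<le> ennreal (1 / ?B)"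
      from order_trans[OF le] show "\<bar>a z\<bar> \<le> 1 / ?B" using B by (subst (asm) ennreal_le_iff) auto
    qed
    have "(\<integral>z. \<bar>a z\<bar> powr s \<partial>lebesgue) \<le> (\<integral>z. indicator (ball x r) z * (1 / ?B) powr s \<partial>lebesgue)"
    proof (rule integral_mono_AE[OF int])
      show "integrable lebesgue (\<lambda>z. indicator (ball x r) z * (1 / ?B) powr s)"
        by (rule integrable_indicator_mult[OF lmeasurable_ball])
      show "AE z in lebesgue. \<bar>a z\<bar> powr s \<le> indicator (ball x r) z * (1 / ?B) powr s"
        using ae
      proof eventually_elim
        case (elim z)
        then show ?case using bas(3)[of z] powr_mono2[of s "\<bar>a z\<bar>" "1/?B"] s
          by (cases "z \<in> ball x r") simp_all
      qed
    qed
    also have "\<dots> = ?B * (1 / ?B) powr s" by simp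
    also have "\<dots> = ?B powr (1 - s)" using B by (simp add: powr_diff powr_divide)
    finally show ?thesis .
  next
    case False
    then have sp: "s = enn2real p" by (simp add: s_def fin_exponent_def)
    define I where "I = (\<integral>z. \<bar>a z\<bar> powr s \<partial>lebesgue)"
    have I0: "0 \<le> I" unfolding I_def by simp
    have nn: "(\<integral>\<^sup>+ z. ennreal (\<bar>a z\<bar> powr s) \<partial>lebesgue) = ennreal I"
      unfolding I_def by (rule nn_integral_eq_integral[OF int]) simp
    have "ennreal (I powr (1 / s)) \<le> ennreal (?B powr (1 / s - 1))"
      using Lq False nn I0 unfolding Lq_norm_def
      by (simp add: sp enn2real_inverse_exponent[OF assms(1) False] Let_def)
    then have "I powr (1 / s) \<le> ?B powr (1 / s - 1)" by simp
    then have "(I powr (1 / s)) powr s \<le> (?B powr (1 / s - 1)) powr s"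
      using s by (intro powr_mono2) auto
    moreover have "1 / s * s = 1" "(1 / s - 1) * s = 1 - s" using s by (simp_all add: algebra_simps)
    ultimately show ?thesis using I0 unfolding powr_powr I_def[symmetric] by simp
  qed
qed

text \<open>Hoelder's inequality on E up to the factor 2, obtained from Young's inequality
  pointwise. The positive exponent later makes the dyadic sums in \<open>H1r_atom_test\<close>
  geometric.\<close>

lemma H1r_atom_local_integral:
  fixes a :: "real ^ 'n::finite \<Rightarrow> real"
  assumes "1 < p" and a: "H1r_atom k p a x r" and E: "E \<in> lmeasurable"
  shows "(LINT z:E|lebesgue. \<bar>a z\<bar>)
    \<le> 2 * (vol E / vol (ball x r)) powr (1 - 1 / fin_exponent p)"
proof (cases "vol E = 0")
  case True
  then have "emeasure lebesgue E = 0" using E by (simp only: emeasure_eq_measure2 ennreal_0)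
  then have "E \<in> null_sets lebesgue" using E by (auto simp: fmeasurable_def)
  then have "(LINT z:E|lebesgue. \<bar>a z\<bar>) = 0"
    unfolding set_lebesgue_integral_def
    by (intro integral_eq_zero_AE) (auto dest!: AE_not_in simp: indicator_def elim: eventually_mono)
  then show ?thesis by simp
next
  case False
  let ?B = "vol (ball x r)" and ?E = "vol E"
  define s where "s = fin_exponent p"
  have s: "1 < s" using fin_exponent_gt_1[OF assms(1)] by (simp add: s_def)
  have E0: "0 < ?E" using False by (simp add: less_le)
  have B: "0 < ?B" by (rule measure_lebesgue_ball_pos) (rule H1r_atom_radius[OF a])
  note pw = H1r_atom_powr_integral[OF assms(1) a, folded s_def] and bas = H1r_atom_basic[OF a]
  \<comment> \<open>Young's inequality \<open>t \<le> h + h powr (1 - s) * t powr s\<close>, with \<open>h\<close> balancing the two terms.\<close>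
  define h where "h = (1 / ?B) * (?B / ?E) powr (1 / s)"
  have h: "0 < h" unfolding h_def using B E0 by simp
  have young: "t \<le> h + h powr (1 - s) * t powr s" if "0 \<le> t" for t :: real
  proof (cases "t \<le> h")
    case True
    then show ?thesis by (simp add: add_increasing2)
  next
    case False
    then have "t = t powr (1 - s) * t powr s" using h s by (simp flip: powr_add)
    also have "\<dots> \<le> h powr (1 - s) * t powr s"
      using False h s by (intro mult_right_mono powr_mono2') auto
    finally show ?thesis using h by linarith
  qed
  have intE: "integrable lebesgue (\<lambda>z. indicator E z * h)"
    by (rule integrable_indicator_mult[OF E])
  have "(LINT z:E|lebesgue. \<bar>a z\<bar>) \<le> (\<integral>z. indicator E z * h + h powr (1 - s) * \<bar>a z\<bar> powr s \<partial>lebesgue)"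
    unfolding set_lebesgue_integral_def
  proof (rule integral_mono)
    show "integrable lebesgue (\<lambda>z. indicator E z *\<^sub>R \<bar>a z\<bar>)"
      using integrable_mult_indicator[of E lebesgue "\<lambda>z. \<bar>a z\<bar>"] bas(4) E
      by (auto simp: fmeasurable_def)
    show "integrable lebesgue (\<lambda>z. indicator E z * h + h powr (1 - s) * \<bar>a z\<bar> powr s)"
      by (intro Bochner_Integration.integrable_add intE integrable_mult_right pw(1))
    show "indicator E z *\<^sub>R \<bar>a z\<bar> \<le> indicator E z * h + h powr (1 - s) * \<bar>a z\<bar> powr s" for z
      using young[of "\<bar>a z\<bar>"] by (auto simp: indicator_def)
  qed
  also have "\<dots> = ?E * h + h powr (1 - s) * (\<integral>z. \<bar>a z\<bar> powr s \<partial>lebesgue)"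
    using E by (subst Bochner_Integration.integral_add[OF intE integrable_mult_right[OF pw(1)]])
      (auto simp: fmeasurable_def)
  also have "\<dots> \<le> ?E * h + h powr (1 - s) * ?B powr (1 - s)"
    by (intro add_left_mono mult_left_mono pw(2)) auto
  also have "h powr (1 - s) * ?B powr (1 - s) = (?E / ?B) powr (1 - 1 / s)"
  proof -
    have "h powr (1 - s) * ?B powr (1 - s) = ((?B / ?E) powr (1 / s)) powr (1 - s)"
      using B E0 h by (simp flip: powr_mult add: h_def)
    also have "\<dots> = (?B / ?E) powr (1 / s * (1 - s))" by (rule powr_powr)
    also have "1 / s * (1 - s) = - (1 - 1 / s)"
      using s by (simp add: field_simps)
    also have "(?B / ?E) powr (- (1 - 1 / s)) = (?E / ?B) powr (1 - 1 / s)"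
      by (simp only: powr_minus flip: inverse_powr) simp
    finally show ?thesis .
  qed
  also have "?E * h = (?E / ?B) powr (1 - 1 / s)"
  proof -
    have "e * ((1 / b) * (b / e) powr u) = (e / b) powr (1 - u)" if "0 < e" "0 < b" for e b u :: real
    proof -
      have "(e / b) powr (1 - u) = (e / b) powr 1 * (e / b) powr (- u)"
        unfolding powr_add[symmetric] by simp
      moreover have "(e / b) powr (- u) = (b / e) powr u" by (simp only: powr_minus flip: inverse_powr) simp
      moreover have "(e / b) powr 1 = e / b" using that by simp
      ultimately show ?thesis by (simp only: times_divide_eq_right times_divide_eq_left mult_1_left mult_1_right)
    qed
    from this[OF E0 B] show ?thesis unfolding h_def .
  qed
  finally show ?thesis by (simp add: s_def)
qed

lemma H1r_atom_L1:
  fixes a :: "real ^ 'n::finite \<Rightarrow> real"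
  assumes "1 < p" and a: "H1r_atom k p a x r"
  shows "(\<integral>z. \<bar>a z\<bar> \<partial>lebesgue) \<le> 2"
proof -
  have "(LINT z:ball x r|lebesgue. \<bar>a z\<bar>) = (\<integral>z. \<bar>a z\<bar> \<partial>lebesgue)"
    unfolding set_lebesgue_integral_def
    by (rule Bochner_Integration.integral_cong) (use H1r_atom_basic(3)[OF a] in \<open>auto simp: indicator_def\<close>)
  with H1r_atom_local_integral[OF assms lmeasurable_ball[of x r]]
    measure_lebesgue_ball_pos[OF H1r_atom_radius(1)[OF a], of x]
  show ?thesis by simp
qed

text \<open>A uniform bound by the inverse volume implies the norm condition for every exponent, so
  atoms can be constructed without reference to p.\<close>

lemma H1r_atomI_bounded:
  fixes a :: "real ^ 'n::finite \<Rightarrow> real"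
  assumes "1 < p" "0 < r" "a \<in> borel_measurable lebesgue"
    and bd: "\<And>z. z \<in> ball x r \<Longrightarrow> \<bar>a z\<bar> \<le> 1 / vol (ball x r)"
    and supp: "\<And>z. z \<notin> ball x r \<Longrightarrow> a z = 0"
    and "x $ k / 4 < r \<and> r < x $ k / 2 \<or> r \<le> x $ k / 4 \<and> (\<integral>y. a y \<partial>lebesgue) = 0"
  shows "H1r_atom k p a x r"
proof -
  let ?B = "vol (ball x r)"
  have B: "0 < ?B" by (rule measure_lebesgue_ball_pos) (rule assms)
  have r: "r \<le> x $ k / 2" "0 < x $ k" using assms(2,6) by auto
  have hb: "hball k x r = ball x r" using r by (intro hball_eq_ball) auto
  have ab: "\<bar>a z\<bar> \<le> 1 / ?B" for z using bd supp by (cases "z \<in> ball x r") auto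
  have "Lq_norm p a \<le> ennreal (?B powr (enn2real (1 / p) - 1))"
  proof (cases "p = \<infinity>")
    case True
    have "esssup lebesgue (\<lambda>x. ennreal \<bar>a x\<bar>) \<le> ennreal (1 / ?B)"
      using assms(3) ab by (intro esssup_I) (auto intro!: ennreal_leI)
    then show ?thesis using B True by (simp add: Lq_norm_def powr_minus divide_inverse)
  next
    case False
    define s where "s = enn2real p"
    have s: "1 < s" using fin_exponent_gt_1[OF assms(1)] False by (simp add: s_def fin_exponent_def)
    have int: "integrable lebesgue (\<lambda>z. \<bar>a z\<bar> powr s)"
    proof (rule integrable_bounded_support[where A = "(1/?B) powr s", OF _ lmeasurable_ball[of x r]])
      show "(\<lambda>z. \<bar>a z\<bar> powr s) \<in> borel_measurable lebesgue" using assms(3) by measurable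
      show "\<bar>\<bar>a z\<bar> powr s\<bar> \<le> (1/?B) powr s" for z
        using powr_mono2[of s "\<bar>a z\<bar>" "1/?B"] ab s by simp
    qed (simp add: supp)
    define I where "I = (\<integral>z. \<bar>a z\<bar> powr s \<partial>lebesgue)"
    have I0: "0 \<le> I" unfolding I_def by simp
    have nn: "(\<integral>\<^sup>+ z. ennreal (\<bar>a z\<bar> powr s) \<partial>lebesgue) = ennreal I"
      unfolding I_def by (rule nn_integral_eq_integral[OF int]) simp
    have "I \<le> (\<integral>z. indicator (ball x r) z * (1 / ?B) powr s \<partial>lebesgue)"
      unfolding I_def
    proof (rule integral_mono[OF int])
      show "integrable lebesgue (\<lambda>z. indicator (ball x r) z * (1 / ?B) powr s)"
        by (rule integrable_indicator_mult[OF lmeasurable_ball])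
      show "\<bar>a z\<bar> powr s \<le> indicator (ball x r) z * (1 / ?B) powr s" for z
        using supp[of z] powr_mono2[of s "\<bar>a z\<bar>" "1/?B"] ab s by (cases "z \<in> ball x r") simp_all
    qed
    also have "\<dots> = ?B powr (1 - s)" using B by (simp add: powr_diff powr_divide)
    finally have "I powr (1 / s) \<le> (?B powr (1 - s)) powr (1 / s)"
      using s I0 by (intro powr_mono2) auto
    also have "\<dots> = ?B powr (1 / s - 1)" using s by (simp add: powr_powr diff_divide_distrib)
    finally have "ennreal (I powr (1 / s)) \<le> ennreal (?B powr (1 / s - 1))" by simp
    then show ?thesis
      using False nn I0 unfolding Lq_norm_def s_def
      by (simp add: enn2real_inverse_exponent[OF assms(1) False] Let_def)
  qed
  moreover have "bounded (range a)" using ab by (auto simp: bounded_iff)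
  ultimately show ?thesis
    using assms hb r by (simp add: H1r_atom_def is_ball_def halfspace_def)
qed

section \<open>Atomic decompositions\<close>

text \<open>Completeness of Lebesgue measure; needed for sums that are identified only almost
  everywhere.\<close>

lemma lebesgue_measurable_AE_cong:
  fixes f g :: "'a::euclidean_space \<Rightarrow> real"
  assumes "f \<in> borel_measurable lebesgue" "AE z in lebesgue. f z = g z"
  shows "g \<in> borel_measurable lebesgue"
proof (rule measurableI)
  fix A :: "real set" assume "A \<in> sets borel"
  then have "f -` A \<inter> space lebesgue \<in> sets lebesgue" using assms(1) by measurable
  moreover have "AE z in lebesgue. z \<in> f -` A \<inter> space lebesgue \<longleftrightarrow> z \<in> g -` A \<inter> space lebesgue"
    using assms(2) by eventually_elim auto
  ultimately show "g -` A \<inter> space lebesgue \<in> sets lebesgue"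
    using complete_measure.in_sets_AE[OF completion.complete_measure_axioms] by blast
qed simp

text \<open>Monotone convergence: the integral of the series of absolute values is finite, hence so
  is the series almost everywhere.\<close>

lemma AE_summable_of_summable_L1:
  fixes f :: "nat \<Rightarrow> 'a \<Rightarrow> real"
  assumes int: "\<And>j. integrable M (f j)" and sm: "summable (\<lambda>j. \<integral>z. \<bar>f j z\<bar> \<partial>M)"
  shows "AE z in M. summable (\<lambda>j. \<bar>f j z\<bar>)"
proof -
  have nn: "(\<integral>\<^sup>+ z. ennreal \<bar>f j z\<bar> \<partial>M) = ennreal (\<integral>z. \<bar>f j z\<bar> \<partial>M)" for j
    by (rule nn_integral_eq_integral) (use int in auto)
  have "(\<integral>\<^sup>+ z. (\<Sum>j. ennreal \<bar>f j z\<bar>) \<partial>M) = (\<Sum>j. ennreal (\<integral>z. \<bar>f j z\<bar> \<partial>M))"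
    using int by (subst nn_integral_suminf) (auto simp: nn)
  also have "\<dots> = ennreal (\<Sum>j. \<integral>z. \<bar>f j z\<bar> \<partial>M)"
    by (rule suminf_ennreal2) (use sm in auto)
  finally have "(\<integral>\<^sup>+ z. (\<Sum>j. ennreal \<bar>f j z\<bar>) \<partial>M) \<noteq> \<infinity>" by simp
  then have "AE z in M. (\<Sum>j. ennreal \<bar>f j z\<bar>) \<noteq> \<infinity>"
    by (intro nn_integral_noteq_infinite) (use int in auto)
  then show ?thesis
    by eventually_elim (auto intro: summable_suminf_not_top)
qed

section \<open>Functions with a bounded atomic sum\<close>

text \<open>A working form of a bound on the Hardy norm. Convergence is almost everywhere instead of
  in L^1, so that regrouping, disjoint supports and telescoping become pointwise matters;
  \<open>H1r_norm_le_atomic_bound\<close> recovers the convergence in L^1.\<close>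

definition atomic_bound ::
    "'n::finite \<Rightarrow> ennreal \<Rightarrow> real \<Rightarrow> (real ^ 'n \<Rightarrow> real) \<Rightarrow> bool" where
  "atomic_bound k p W g \<longleftrightarrow> (\<exists>c a. (\<forall>j::nat. \<exists>x r. H1r_atom k p (a j) x r) \<and>
     (\<Sum>j. ennreal \<bar>c j\<bar>) \<le> ennreal W \<and> (AE z in lebesgue. (\<lambda>j. c j * a j z) sums g z))"

lemma H1r_atom_zero:
  fixes k :: "'n::finite"
  assumes "1 < p"
  shows "\<exists>x r. H1r_atom k p (\<lambda>_. 0) x r"
proof -
  have "H1r_atom k p (\<lambda>_. 0) (\<chi> i. 1) (1/4)"
    by (rule H1r_atomI_bounded) (use assms in auto)
  then show ?thesis by blast
qed

lemma atomic_bound_mono: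
  assumes "atomic_bound k p W g" "W \<le> W'"
  shows "atomic_bound k p W' g"
proof -
  from assms(1) obtain c a where "\<forall>j::nat. \<exists>x r. H1r_atom k p (a j) x r"
    and c: "(\<Sum>j. ennreal \<bar>c j\<bar>) \<le> ennreal W"
    and "AE z in lebesgue. (\<lambda>j. c j * a j z) sums g z"
    unfolding atomic_bound_def by blast
  moreover have "(\<Sum>j. ennreal \<bar>c j\<bar>) \<le> ennreal W'"
    using c ennreal_leI[OF assms(2)] by (rule order_trans)
  ultimately show ?thesis unfolding atomic_bound_def by blast
qed

lemma atomic_bound_atom:
  assumes "1 < p" "H1r_atom k p a x r" "0 \<le> W" "AE z in lebesgue. g z = W * a z"
  shows "atomic_bound k p W g"
proof -
  define c where "c j = (if j = 0 then W else 0)" for j :: nat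
  have 1: "(\<lambda>j. ennreal \<bar>c j\<bar>) = (\<lambda>j. if j = 0 then ennreal W else 0)"
    using assms(3) by (auto simp: c_def)
  have "(\<Sum>j. ennreal \<bar>c j\<bar>) = ennreal W"
    unfolding 1 by (rule sums_unique[symmetric]) (rule sums_single)
  moreover have "AE z in lebesgue. (\<lambda>j. c j * a z) sums g z"
    using assms(4)
  proof eventually_elim
    case (elim z)
    have "(\<lambda>j. c j * a z) = (\<lambda>j::nat. if j = 0 then W * a z else 0)" by (auto simp: c_def)
    then show ?case using sums_single[of 0 "\<lambda>_. W * a z"] by (simp add: elim)
  qed
  ultimately show ?thesis unfolding atomic_bound_def using assms(2) by (intro exI[of _ c] exI[of _ "\<lambda>_. a"]) auto
qed

lemma atomic_bound_summable:
  fixes a :: "nat \<Rightarrow> real ^ 'n::finite \<Rightarrow> real"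
  assumes "1 < p" and at: "\<forall>j. \<exists>x r. H1r_atom k p (a j) x r"
    and c: "(\<Sum>j. ennreal \<bar>c j\<bar>) \<le> ennreal W"
  shows "summable (\<lambda>j. \<bar>c j\<bar>)" "\<And>j. integrable lebesgue (\<lambda>z. c j * a j z)"
    "\<And>j. (\<integral>z. \<bar>c j * a j z\<bar> \<partial>lebesgue) \<le> 2 * \<bar>c j\<bar>"
    "summable (\<lambda>j. \<integral>z. \<bar>c j * a j z\<bar> \<partial>lebesgue)"
    "AE z in lebesgue. summable (\<lambda>j. \<bar>c j * a j z\<bar>)"
proof -
  have "(\<Sum>j. ennreal \<bar>c j\<bar>) \<noteq> top" using c by (auto simp: top_unique)
  then show sc: "summable (\<lambda>j. \<bar>c j\<bar>)" by (intro summable_suminf_not_top) auto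
  show int: "integrable lebesgue (\<lambda>z. c j * a j z)" for j
    using at H1r_atom_basic(4) by (metis integrable_mult_right)
  show le: "(\<integral>z. \<bar>c j * a j z\<bar> \<partial>lebesgue) \<le> 2 * \<bar>c j\<bar>" for j
  proof -
    obtain x r where "H1r_atom k p (a j) x r" using at by blast
    from mult_left_mono[OF H1r_atom_L1[OF assms(1) this], of "\<bar>c j\<bar>"] show ?thesis
      by (simp add: abs_mult mult.commute)
  qed
  show sm: "summable (\<lambda>j. \<integral>z. \<bar>c j * a j z\<bar> \<partial>lebesgue)"
    by (rule summable_comparison_test'[OF summable_mult[OF sc, of 2], of 0]) (use le in auto)
  show "AE z in lebesgue. summable (\<lambda>j. \<bar>c j * a j z\<bar>)"
    by (rule AE_summable_of_summable_L1[OF int sm])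
qed

lemma halfspace_lebesgue: "halfspace k \<in> sets lebesgue"
proof -
  have "open (halfspace k)" unfolding halfspace_def by (intro open_Collect_less continuous_intros)
  then show ?thesis by auto
qed

text \<open>The remainder after N terms has L^1 norm at most twice the tail of the coefficient
  series, so convergence almost everywhere improves to convergence in L^1.\<close>

lemma H1r_norm_le_atomic_bound:
  fixes g :: "real ^ 'n::finite \<Rightarrow> real"
  assumes "1 < p" "atomic_bound k p W g"
  shows "H1r_norm k p g \<le> ennreal W"
proof -
  from assms(2) obtain c a where at: "\<forall>j::nat. \<exists>x r. H1r_atom k p (a j) x r"
    and c: "(\<Sum>j. ennreal \<bar>c j\<bar>) \<le> ennreal W" and s: "AE z in lebesgue. (\<lambda>j. c j * a j z) sums g z"
    unfolding atomic_bound_def by blast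
  note sm = atomic_bound_summable[OF assms(1) at c]
  have "integrable lebesgue (\<lambda>z. \<Sum>j. c j * a j z)"
    by (rule integrable_suminf) (use sm in auto)
  moreover have eq: "AE z in lebesgue. (\<Sum>j. c j * a j z) = g z"
    using s by eventually_elim (auto dest: sums_unique)
  ultimately have "integrable lebesgue g"
    by (subst integrable_cong_AE[symmetric]) (auto intro: lebesgue_measurable_AE_cong[OF _ eq])
  then have gint: "set_integrable lebesgue (halfspace k) g"
    unfolding set_integrable_def by (intro integrable_mult_indicator halfspace_lebesgue)
  have bound: "(\<integral>\<^sup>+ y \<in> halfspace k. ennreal \<bar>g y - (\<Sum>j<N. c j * a j y)\<bar> \<partial>lebesgue)
      \<le> ennreal (2 * (\<Sum>j. \<bar>c (j + N)\<bar>))" for N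
  proof -
    have "(\<integral>\<^sup>+ y \<in> halfspace k. ennreal \<bar>g y - (\<Sum>j<N. c j * a j y)\<bar> \<partial>lebesgue)
      \<le> (\<integral>\<^sup>+ y. (\<Sum>j. ennreal \<bar>c (j + N) * a (j + N) y\<bar>) \<partial>lebesgue)"
    proof (rule nn_integral_mono_AE)
      show "AE y in lebesgue. ennreal \<bar>g y - (\<Sum>j<N. c j * a j y)\<bar> * indicator (halfspace k) y
        \<le> (\<Sum>j. ennreal \<bar>c (j + N) * a (j + N) y\<bar>)"
        using s sm(5)
      proof eventually_elim
        case (elim y)
        have su: "summable (\<lambda>j. \<bar>c (j + N) * a (j + N) y\<bar>)"
          using summable_iff_shift[of "\<lambda>j. \<bar>c j * a j y\<bar>" N] elim(2) by simp
        have "g y - (\<Sum>j<N. c j * a j y) = (\<Sum>j. c (j + N) * a (j + N) y)"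
          using suminf_minus_initial_segment[of "\<lambda>j. c j * a j y" N] elim(1)
          by (simp add: sums_iff)
        then have "ennreal \<bar>g y - (\<Sum>j<N. c j * a j y)\<bar> \<le> ennreal (\<Sum>j. \<bar>c (j + N) * a (j + N) y\<bar>)"
          using summable_rabs[OF su] by (simp add: ennreal_leI)
        also have "\<dots> = (\<Sum>j. ennreal \<bar>c (j + N) * a (j + N) y\<bar>)"
          by (rule suminf_ennreal2[symmetric]) (use su in auto)
        finally show ?case by (auto simp: indicator_def)
      qed
    qed
    also have "\<dots> = (\<Sum>j. \<integral>\<^sup>+ y. ennreal \<bar>c (j + N) * a (j + N) y\<bar> \<partial>lebesgue)"
      using sm(2) by (intro nn_integral_suminf) (simp add: borel_measurable_integrable)
    also have "\<dots> \<le> (\<Sum>j. ennreal (2 * \<bar>c (j + N)\<bar>))"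
    proof (rule suminf_le)
      fix j
      have "(\<integral>\<^sup>+ y. ennreal \<bar>c (j + N) * a (j + N) y\<bar> \<partial>lebesgue)
          = ennreal (\<integral>y. \<bar>c (j + N) * a (j + N) y\<bar> \<partial>lebesgue)"
        by (rule nn_integral_eq_integral) (use sm(2) in auto)
      then show "(\<integral>\<^sup>+ y. ennreal \<bar>c (j + N) * a (j + N) y\<bar> \<partial>lebesgue) \<le> ennreal (2 * \<bar>c (j + N)\<bar>)"
        using sm(3)[of "j + N"] by (simp add: ennreal_leI)
    qed auto
    also have "\<dots> = ennreal (\<Sum>j. 2 * \<bar>c (j + N)\<bar>)"
      using sm(1) summable_iff_shift[of "\<lambda>j. \<bar>c j\<bar>" N]
      by (intro suminf_ennreal2) (auto intro!: summable_mult)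
    also have "(\<Sum>j. 2 * \<bar>c (j + N)\<bar>) = 2 * (\<Sum>j. \<bar>c (j + N)\<bar>)"
      using sm(1) summable_iff_shift[of "\<lambda>j. \<bar>c j\<bar>" N] by (intro suminf_mult) auto
    finally show ?thesis .
  qed
  have "(\<lambda>N. ennreal (2 * (\<Sum>j. \<bar>c (j + N)\<bar>))) \<longlonglongrightarrow> ennreal (2 * 0)"
    by (intro tendsto_ennrealI tendsto_mult tendsto_const suminf_exist_split2 sm(1))
  then have "(\<lambda>N. ennreal (2 * (\<Sum>j. \<bar>c (j + N)\<bar>))) \<longlonglongrightarrow> 0" by simp
  then have lim: "(\<lambda>N. \<integral>\<^sup>+ y \<in> halfspace k. ennreal \<bar>g y - (\<Sum>j<N. c j * a j y)\<bar> \<partial>lebesgue) \<longlonglongrightarrow> 0"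
    by (rule tendsto_sandwich[OF _ _ tendsto_const, rotated 2]) (simp_all add: bound)
  have "H1r_representation k p g c a"
    unfolding H1r_representation_def using gint at sm(1) lim by blast
  then have "H1r_norm k p g \<le> (\<Sum>j. ennreal \<bar>c j\<bar>)"
    unfolding H1r_norm_def by (intro INF_lower2[of "(c, a)"]) auto
  with c show ?thesis by (rule order_trans[rotated])
qed

text \<open>The double series of atoms is enumerated by \<open>prod_decode\<close>. Its coefficients
  are summable, so it converges absolutely almost everywhere and may be summed row by row.\<close>

lemma atomic_bound_sums:
  fixes g :: "nat \<Rightarrow> real ^ 'n::finite \<Rightarrow> real"
  assumes "1 < p" and b: "\<And>i. atomic_bound k p (W i) (g i)"
    and W: "(\<Sum>i. ennreal (W i)) \<le> ennreal t"
    and G: "AE z in lebesgue. (\<lambda>i. g i z) sums G z"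
  shows "atomic_bound k p t G"
proof -
  have "\<forall>i. \<exists>c a. (\<forall>j::nat. \<exists>x r. H1r_atom k p (a j) x r) \<and>
     (\<Sum>j. ennreal \<bar>c j\<bar>) \<le> ennreal (W i) \<and> (AE z in lebesgue. (\<lambda>j. c j * a j z) sums g i z)"
    using b unfolding atomic_bound_def by blast
  from choice[OF this] obtain c where "\<forall>i. \<exists>a. (\<forall>j::nat. \<exists>x r. H1r_atom k p (a j) x r) \<and>
     (\<Sum>j. ennreal \<bar>c i j\<bar>) \<le> ennreal (W i) \<and> (AE z in lebesgue. (\<lambda>j. c i j * a j z) sums g i z)"
    by (rule exE)
  from choice[OF this] obtain a where ca: "\<forall>i. (\<forall>j::nat. \<exists>x r. H1r_atom k p (a i j) x r) \<and>
     (\<Sum>j. ennreal \<bar>c i j\<bar>) \<le> ennreal (W i) \<and> (AE z in lebesgue. (\<lambda>j. c i j * a i j z) sums g i z)"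
    by (rule exE)
  then have at: "\<And>i j::nat. \<exists>x r. H1r_atom k p (a i j) x r"
    and c: "\<And>i. (\<Sum>j. ennreal \<bar>c i j\<bar>) \<le> ennreal (W i)"
    and s: "\<And>i. AE z in lebesgue. (\<lambda>j. c i j * a i j z) sums g i z"
    by simp_all
  define c' where "c' n = (case prod_decode n of (i, j) \<Rightarrow> c i j)" for n
  define a' where "a' n = (case prod_decode n of (i, j) \<Rightarrow> a i j)" for n
  have at': "\<forall>n. \<exists>x r. H1r_atom k p (a' n) x r"
    using at by (auto simp: a'_def split: prod.split)
  have "(\<lambda>(i, j). ennreal \<bar>c i j\<bar>) (prod_decode n) = ennreal \<bar>c' n\<bar>" for n
    by (cases "prod_decode n") (simp add: c'_def)
  moreover have "(\<Sum>n. (\<lambda>(i, j). ennreal \<bar>c i j\<bar>) (prod_decode n)) = (\<Sum>i. \<Sum>j. ennreal \<bar>c i j\<bar>)"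
    by (rule suminf_ennreal_2dimen) simp
  ultimately have "(\<Sum>n. ennreal \<bar>c' n\<bar>) = (\<Sum>i. \<Sum>j. ennreal \<bar>c i j\<bar>)" by simp
  also have "\<dots> \<le> (\<Sum>i. ennreal (W i))" by (intro suminf_le c) auto
  finally have c': "(\<Sum>n. ennreal \<bar>c' n\<bar>) \<le> ennreal t" using W by (rule order_trans)
  have s': "AE z in lebesgue. \<forall>i. (\<lambda>j. c i j * a i j z) sums g i z"
    using s by (simp add: AE_all_countable)
  have "AE z in lebesgue. (\<lambda>n. c' n * a' n z) sums G z"
    using atomic_bound_summable(5)[OF assms(1) at' c'] G s'
  proof eventually_elim
    case (elim z)
    let ?F = "\<lambda>n. c' n * a' n z"
    \<comment> \<open>Unconditional sums are the bridge: \<open>has_sum\<close> is invariant under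
      the bijection with pairs and obeys a Fubini rule, while each row and the outer series have
      sums already known from \<open>sums\<close>.\<close>
    have "(?F has_sum suminf ?F) UNIV"
      using elim(1) by (intro norm_summable_imp_has_sum summable_sums[OF summable_rabs_cancel]) auto
    then have "((\<lambda>(i, j). c i j * a i j z) \<circ> prod_decode has_sum suminf ?F) UNIV"
      unfolding o_def c'_def a'_def case_prod_beta .
    then have hs: "((\<lambda>(i, j). c i j * a i j z) has_sum suminf ?F) (Sigma UNIV (\<lambda>_. UNIV))"
      using has_sum_reindex[OF inj_prod_decode[of UNIV], of "\<lambda>(i, j). c i j * a i j z" "suminf ?F"]
      by (simp add: surj_prod_decode)
    have row: "((\<lambda>j. (\<lambda>(i, j). c i j * a i j z) (i, j)) has_sum g i z) UNIV" for i
    proof -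
      have "(\<lambda>(i, j). c i j * a i j z) summable_on (Sigma UNIV (\<lambda>_. UNIV))"
        using hs by (rule has_sum_imp_summable)
      then have "(\<lambda>j. c i j * a i j z) summable_on UNIV"
        using summable_on_SigmaD1[of "\<lambda>i j. c i j * a i j z" UNIV "\<lambda>_. UNIV" i] by simp
      then obtain S where S: "((\<lambda>j. c i j * a i j z) has_sum S) UNIV" by (auto simp: summable_on_def)
      from has_sum_imp_sums[OF this] elim(3) have "S = g i z" by (metis sums_unique2)
      with S show ?thesis by simp
    qed
    have "((\<lambda>i. g i z) has_sum suminf ?F) UNIV"
      by (rule has_sum_SigmaD[OF hs row])
    from has_sum_imp_sums[OF this] elim(2) have "suminf ?F = G z" by (metis sums_unique2)
    then show ?case using elim(1) by (simp add: sums_iff summable_rabs_cancel)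
  qed
  with at' c' show ?thesis unfolding atomic_bound_def by blast
qed

lemma atomic_bound_add:
  fixes g h :: "real ^ 'n::finite \<Rightarrow> real"
  assumes "1 < p" "atomic_bound k p V g" "atomic_bound k p W h" "0 \<le> V" "0 \<le> W"
  shows "atomic_bound k p (V + W) (\<lambda>z. g z + h z)"
proof (rule atomic_bound_sums[OF assms(1)])
  obtain x r where z: "H1r_atom k p (\<lambda>_. 0) x r" using H1r_atom_zero[OF assms(1)] by blast
  have 0: "atomic_bound k p 0 (\<lambda>_. 0)" by (rule atomic_bound_atom[OF assms(1) z]) auto
  define f where "f i = (if i = 0 then g else if i = 1 then h else (\<lambda>_. 0))" for i :: nat
  define U where "U i = (if i = 0 then V else if i = 1 then W else 0)" for i :: nat
  show "atomic_bound k p (U i) (f i)" for i using assms 0 by (simp add: U_def f_def)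
  have "(\<lambda>i. ennreal (U i)) sums (\<Sum>i\<in>{0,1}. ennreal (U i))"
    by (rule sums_finite) (auto simp: U_def)
  then show "(\<Sum>i. ennreal (U i)) \<le> ennreal (V + W)"
    using assms(4,5) by (simp add: sums_iff U_def)
  have "(\<lambda>i. f i z) sums (\<Sum>i\<in>{0,1}. f i z)" for z
    by (rule sums_finite) (auto simp: f_def)
  then show "AE z in lebesgue. (\<lambda>i. f i z) sums (g z + h z)"
    by (simp add: f_def)
qed

section \<open>Gluing over countable disjoint families\<close>

text \<open>The glued function that equals \<open>f P\<close> on each P. For a disjoint family the
  index set has at most one element, so no convergence question arises when F is infinite.\<close>

definition piece_sum :: "'a set set \<Rightarrow> ('a set \<Rightarrow> 'a \<Rightarrow> real) \<Rightarrow> 'a \<Rightarrow> real" where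
  "piece_sum F f z = (\<Sum>P | P \<in> F \<and> z \<in> P. f P z)"

lemma piece_sum_in:
  assumes "disjoint F" "P \<in> F" "z \<in> P"
  shows "piece_sum F f z = f P z"
proof -
  have "{P. P \<in> F \<and> z \<in> P} = {P}" using assms by (auto simp: disjoint_def)
  then show ?thesis by (simp add: piece_sum_def)
qed

lemma piece_sum_notin: "z \<notin> \<Union>F \<Longrightarrow> piece_sum F f z = 0"
proof -
  assume "z \<notin> \<Union>F"
  then have "{P. P \<in> F \<and> z \<in> P} = {}" by blast
  then show ?thesis by (simp only: piece_sum_def sum.empty)
qed

text \<open>Enumerates a finite or infinite countable family as a sequence, with \<open>d\<close> at
  the indices that code no member, so that results on series apply to both.\<close>

definition nth_piece :: "'a set set \<Rightarrow> 'b \<Rightarrow> ('a set \<Rightarrow> 'b) \<Rightarrow> nat \<Rightarrow> 'b" where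
  "nth_piece F d f i = (if i \<in> to_nat_on F ` F then f (from_nat_into F i) else d)"

lemma nth_piece_cases:
  assumes "countable F"
  obtains "nth_piece F d f i = d" "nth_piece F d' f' i = d'"
  | P where "P \<in> F" "nth_piece F d f i = f P" "nth_piece F d' f' i = f' P"
  using assms by (cases "i \<in> to_nat_on F ` F") (auto simp: nth_piece_def)

lemma sum_nth_piece_le:
  fixes W :: "'a set \<Rightarrow> real"
  assumes F: "countable F" and le: "\<And>E. finite E \<Longrightarrow> E \<subseteq> F \<Longrightarrow> sum W E \<le> t"
  shows "(\<Sum>i<N. nth_piece F 0 W i) \<le> t"
proof -
  let ?e = "to_nat_on F" and ?d = "from_nat_into F"
  let ?I = "{i. i < N \<and> i \<in> ?e ` F}"
  have "(\<Sum>i<N. nth_piece F 0 W i) = (\<Sum>i\<in>?I. W (?d i))"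
    by (rule sum.mono_neutral_cong_right) (auto simp: nth_piece_def)
  also have "\<dots> = sum W (?d ` ?I)"
    by (rule sum.reindex_cong[symmetric, where l = ?d]) (use F in \<open>auto simp: inj_on_def\<close>)
  also have "\<dots> \<le> t" using F by (intro le) auto
  finally show ?thesis .
qed

lemma nth_piece_single:
  assumes F: "countable F" "disjoint F" and supp: "\<And>P z. P \<in> F \<Longrightarrow> z \<notin> P \<Longrightarrow> f P z = 0"
  shows "\<exists>i. (\<forall>j. j \<noteq> i \<longrightarrow> nth_piece F (\<lambda>_. 0) f j z = 0) \<and> nth_piece F (\<lambda>_. 0) f i z = piece_sum F f z"
proof -
  let ?e = "to_nat_on F" and ?h = "nth_piece F (\<lambda>_. 0) f"
  have e: "?h (?e P) = f P" if "P \<in> F" for P using F(1) that by (simp add: nth_piece_def)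
  show ?thesis
  proof (cases "z \<in> \<Union>F")
    case True
    then obtain Q where Q: "Q \<in> F" "z \<in> Q" by blast
    have "?h j z = 0" if "j \<noteq> ?e Q" for j
    proof (cases "j \<in> ?e ` F")
      case True
      then obtain P where P: "P \<in> F" "j = ?e P" by blast
      with that have "P \<noteq> Q" by blast
      with P Q have "z \<notin> P" using F(2) by (auto simp: disjoint_def)
      then show ?thesis using P e supp by simp
    qed (simp add: nth_piece_def)
    then show ?thesis using e[OF Q(1)] piece_sum_in[OF F(2) Q, of f] by (intro exI[of _ "?e Q"]) simp
  next
    case False
    then have "?h j z = 0" for j
      using F(1) supp by (auto simp: nth_piece_def)
    then show ?thesis by (simp add: piece_sum_notin[OF False])
  qed
qed

text \<open>The enumerated series has at most one nonzero term at each point. The budget is assumed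
  over finite subfamilies, the form in which disjointness estimates arrive, and this bounds all
  partial sums.\<close>

lemma atomic_bound_disjoint_family:
  fixes g :: "(real ^ 'n::finite) set \<Rightarrow> real ^ 'n \<Rightarrow> real"
  assumes "1 < p" and F: "countable F" "disjoint F"
    and b: "\<And>Q. Q \<in> F \<Longrightarrow> atomic_bound k p (W Q) (g Q)" "\<And>Q. Q \<in> F \<Longrightarrow> 0 \<le> W Q"
    and W: "\<And>E. finite E \<Longrightarrow> E \<subseteq> F \<Longrightarrow> sum W E \<le> t"
    and supp: "\<And>Q z. Q \<in> F \<Longrightarrow> z \<notin> Q \<Longrightarrow> g Q z = 0"
    and G: "\<And>Q z. Q \<in> F \<Longrightarrow> z \<in> Q \<Longrightarrow> G z = g Q z" "\<And>z. z \<notin> \<Union>F \<Longrightarrow> G z = 0"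
  shows "atomic_bound k p t G"
proof (rule atomic_bound_sums[OF assms(1)])
  obtain x r where z: "H1r_atom k p (\<lambda>_. 0) x r" using H1r_atom_zero[OF assms(1)] by blast
  have 0: "atomic_bound k p 0 (\<lambda>_. 0)" by (rule atomic_bound_atom[OF assms(1) z]) auto
  let ?f = "nth_piece F (\<lambda>_. 0) g" and ?U = "nth_piece F 0 W"
  show "atomic_bound k p (?U i) (?f i)" for i
    by (rule nth_piece_cases[OF F(1), of 0 W i "\<lambda>_. 0" g]) (use b 0 in auto)
  have U0: "0 \<le> ?U i" for i
    by (rule nth_piece_cases[OF F(1), of 0 W i 0 W]) (use b in auto)
  show "(\<Sum>i. ennreal (?U i)) \<le> ennreal t"
    by (rule suminf_le_const) (use sum_nth_piece_le[OF F(1) W] U0 in \<open>auto intro!: ennreal_leI\<close>)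
  have "(\<lambda>i. ?f i z) sums G z" for z
  proof -
    obtain i where i: "\<forall>j. j \<noteq> i \<longrightarrow> ?f j z = 0" "?f i z = piece_sum F g z"
      using nth_piece_single[OF F, of g z] supp by blast
    then have "(\<lambda>i. ?f i z) sums (\<Sum>i\<in>{i}. ?f i z)" by (intro sums_finite) auto
    moreover have "piece_sum F g z = G z"
      using G piece_sum_in[OF F(2), of _ z g] piece_sum_notin[of z F g] by (cases "z \<in> \<Union>F") auto
    ultimately show ?thesis using i(2) by simp
  qed
  then show "AE z in lebesgue. (\<lambda>i. ?f i z) sums G z" by simp
qed

text \<open>Each step of the decomposition halves the budget \<open>t\<close> of the remainder \<open>R\<close>.\<close>

lemma atomic_bound_iterate:
  fixes X :: "(real ^ 'n::finite \<Rightarrow> real) \<Rightarrow> real \<Rightarrow> bool"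
  assumes "1 < p" "0 \<le> C"
    and X: "\<And>R t. X R t \<Longrightarrow> 0 \<le> t \<and> integrable lebesgue R \<and> (\<integral>z. \<bar>R z\<bar> \<partial>lebesgue) \<le> A * t"
    and step: "\<And>R t. X R t \<Longrightarrow>
      \<exists>R' t'. X R' t' \<and> t' \<le> t / 2 \<and> atomic_bound k p (C * t) (\<lambda>z. R z - R' z)"
    and R: "X R t"
  shows "atomic_bound k p (2 * C * t) R"
proof -
  \<comment> \<open>The state of the iteration is a pair of remainder and budget; dependent choice
    is used because each step is given by mere existence.\<close>
  define Q where "Q = (\<lambda>(n::nat) (u :: (real ^ 'n \<Rightarrow> real) \<times> real) v.
    snd v \<le> snd u / 2 \<and> atomic_bound k p (C * snd u) (\<lambda>z. fst u z - fst v z))"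
  define P where "P = (\<lambda>n u. X (fst u) (snd u) \<and> (n = (0::nat) \<longrightarrow> u = (R, t)))"
  have "\<exists>f. \<forall>n. P n (f n) \<and> Q n (f n) (f (Suc n))"
  proof (rule dependent_nat_choice)
    show "\<exists>x. P 0 x" using R by (auto simp: P_def)
    show "\<exists>y. P (Suc n) y \<and> Q n x y" if "P n x" for x n
      using step[of "fst x" "snd x"] that by (auto simp: P_def Q_def)
  qed
  then obtain f where f: "\<And>n. P n (f n)" "\<And>n. Q n (f n) (f (Suc n))" by blast
  define S where "S n = fst (f n)" for n
  define T where "T n = snd (f n)" for n
  have S0: "S 0 = R" "T 0 = t" using f(1)[of 0] by (auto simp: P_def S_def T_def)
  have XS: "X (S n) (T n)" for n using f(1)[of n] by (simp add: P_def S_def T_def)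
  have T2: "T (Suc n) \<le> T n / 2" and ab: "atomic_bound k p (C * T n) (\<lambda>z. S n z - S (Suc n) z)" for n
    using f(2)[of n] by (auto simp: Q_def S_def T_def)
  have T: "T n \<le> t * (1 / 2) ^ n" for n
  proof (induction n)
    case (Suc n)
    then show ?case using T2[of n] by simp
  qed (simp add: S0)
  have T0: "0 \<le> T n" for n using X[OF XS[of n]] by simp
  have t0: "0 \<le> t" using T0[of 0] S0 by simp
  have geo: "(\<lambda>n. A' * (t * (1 / 2) ^ n)) sums (2 * A' * t)" for A' :: real
    using sums_mult[OF geometric_sums[of "1/2 :: real"], of "A' * t"] by (simp add: mult_ac)
  have geo_le: "(\<Sum>n. ennreal (C * T n)) \<le> ennreal (2 * C * t)"
  proof -
    have "(\<Sum>n. ennreal (C * T n)) \<le> (\<Sum>n. ennreal (C * (t * (1 / 2) ^ n)))"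
      using T assms(2) by (intro suminf_le ennreal_leI mult_left_mono) auto
    also have "\<dots> = ennreal (2 * C * t)"
      by (rule suminf_ennreal_eq[OF _ geo]) (use assms(2) t0 in auto)
    finally show ?thesis .
  qed
  \<comment> \<open>The L^1 norms are dominated by a geometric series, so the remainders tend to 0
    almost everywhere and the telescoping series sums to \<open>R\<close>.\<close>
  have "summable (\<lambda>n. \<integral>z. \<bar>S n z\<bar> \<partial>lebesgue)"
  proof (rule summable_comparison_test'[where N = 0])
    show "summable (\<lambda>n. \<bar>A\<bar> * (t * (1 / 2) ^ n))" using geo by (rule sums_summable)
    show "norm (\<integral>z. \<bar>S n z\<bar> \<partial>lebesgue) \<le> \<bar>A\<bar> * (t * (1 / 2) ^ n)" for n
    proof -
      have "(\<integral>z. \<bar>S n z\<bar> \<partial>lebesgue) \<le> A * T n" using X[OF XS[of n]] by simp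
      also have "\<dots> \<le> \<bar>A\<bar> * T n" using T0[of n] by (intro mult_right_mono) auto
      also have "\<dots> \<le> \<bar>A\<bar> * (t * (1 / 2) ^ n)" by (intro mult_left_mono T) auto
      finally show ?thesis by simp
    qed
  qed
  then have "AE z in lebesgue. summable (\<lambda>n. \<bar>S n z\<bar>)"
    by (intro AE_summable_of_summable_L1) (use X[OF XS] in auto)
  then have "AE z in lebesgue. (\<lambda>n. S n z - S (Suc n) z) sums R z"
  proof eventually_elim
    case (elim z)
    then have "(\<lambda>n. S n z) \<longlonglongrightarrow> 0" by (rule summable_LIMSEQ_zero[OF summable_rabs_cancel])
    from telescope_sums'[OF this] show ?case by (simp add: S0)
  qed
  then show ?thesis by (intro atomic_bound_sums[OF assms(1) ab geo_le])
qed

section \<open>Testing against a truncated logarithm\<close>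

text \<open>A geometric sum with ratio above 1 is comparable to its last term u. With q = 2 powr (-
  \<tau>) the induction closes through q * u / (1 - q) + u = u / (1 - q).\<close>

lemma sum_powr_dyadic_le:
  fixes a \<tau> :: real
  assumes "0 < a" "0 < \<tau>"
  shows "(\<Sum>j\<le>J. (2 ^ j * a) powr \<tau>) \<le> (2 ^ J * a) powr \<tau> / (1 - 2 powr (- \<tau>))"
proof (induction J)
  case 0
  have "2 powr (- \<tau>) < (1::real)" using powr_less_mono[of "- \<tau>" 0 2] assms by simp
  then have "1 \<le> 1 / (1 - 2 powr (- \<tau>))" by (simp add: divide_simps)
  from mult_left_mono[OF this, of "a powr \<tau>"] show ?case by simp
next
  case (Suc J)
  define q :: real where "q = 2 powr (- \<tau>)"
  have q: "0 < q" "q < 1" using powr_less_mono[of "- \<tau>" 0 2] assms by (simp_all add: q_def)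
  define u where "u = (2 ^ Suc J * a) powr \<tau>"
  have "u = 2 powr \<tau> * (2 ^ J * a) powr \<tau>"
    using assms by (simp add: u_def powr_mult mult.assoc)
  then have eq: "(2 ^ J * a) powr \<tau> = q * u"
    by (simp add: q_def powr_minus)
  have "(\<Sum>j\<le>Suc J. (2 ^ j * a) powr \<tau>) \<le> q * u / (1 - q) + u"
    using Suc.IH unfolding eq q_def[symmetric] by (simp add: u_def del: power_Suc)
  also have "\<dots> = u / (1 - q)" using q by (simp add: field_simps)
  finally show ?case by (simp add: q_def u_def)
qed

text \<open>Consecutive values double, so two places after the first value above \<alpha> the values
  already exceed 4 * \<alpha>.\<close>

lemma dyadic_values_card:
  fixes \<alpha> r :: real
  assumes "0 < \<alpha>" "0 < r"
  shows "finite {j::nat. \<alpha> < 2 ^ j * r \<and> 2 ^ j * r < 3 * \<alpha>} \<and>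
    card {j::nat. \<alpha> < 2 ^ j * r \<and> 2 ^ j * r < 3 * \<alpha>} \<le> 2"
proof (cases "\<exists>j::nat. \<alpha> < 2 ^ j * r")
  case True
  define m where "m = (LEAST j::nat. \<alpha> < 2 ^ j * r)"
  have m: "\<alpha> < 2 ^ m * r" using LeastI_ex[OF True] by (simp add: m_def)
  have "{j::nat. \<alpha> < 2 ^ j * r \<and> 2 ^ j * r < 3 * \<alpha>} \<subseteq> {m, Suc m}"
  proof
    fix j assume j: "j \<in> {j::nat. \<alpha> < 2 ^ j * r \<and> 2 ^ j * r < 3 * \<alpha>}"
    then have "m \<le> j" unfolding m_def by (intro Least_le) simp
    moreover have "j < m + 2"
    proof (rule ccontr)
      assume "\<not> j < m + 2"
      then have "(2::real) ^ (m + 2) \<le> 2 ^ j" by (intro power_increasing) auto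
      then have "2 ^ (m + 2) * r \<le> 2 ^ j * r" using assms by simp
      moreover have "2 ^ (m + 2) * r = 4 * (2 ^ m * r)" by simp
      ultimately have "4 * (2 ^ m * r) \<le> 2 ^ j * r" by linarith
      then have "4 * \<alpha> < 3 * \<alpha>" using j m by (simp only: mem_Collect_eq) linarith
      then show False using assms by simp
    qed
    ultimately show "j \<in> {m, Suc m}" by auto
  qed
  then show ?thesis using finite_subset[of _ "{m, Suc m}"] card_mono[of "{m, Suc m}"]
    by (auto simp: numeral_2_eq_2)
next
  case False
  then have "{j::nat. \<alpha> < 2 ^ j * r \<and> 2 ^ j * r < 3 * \<alpha>} = {}" by blast
  then show ?thesis by (simp only: finite.emptyI card.empty) simp
qed

text \<open>
  The sum of the indicators of the balls \<open>B(x, 2\<^sup>j r)\<close> that stay away from the boundary is a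
  truncated logarithm, and its integral against an atom is bounded independently of \<open>J\<close>.
\<close>

lemma H1r_atom_test:
  fixes A :: "real ^ 'n::finite \<Rightarrow> real"
  assumes "1 < p" and A: "H1r_atom k p A y \<rho>" and r: "0 < r" "2 ^ J * r \<le> x $ k / 2"
  defines "\<tau> \<equiv> real CARD('n) * (1 - 1 / fin_exponent p)"
  shows "\<bar>\<Sum>j\<le>J. LINT z:ball x (2 ^ j * r)|lebesgue. A z\<bar> \<le> 4 + 2 * 5 powr \<tau> / (1 - 2 powr (- \<tau>))"
proof -
  note rad = H1r_atom_radius[OF A] and bas = H1r_atom_basic[OF A]
  have \<tau>: "0 < \<tau>" using fin_exponent_gt_1[OF assms(1)] by (simp add: \<tau>_def)
  then have q: "0 < 1 - 2 powr (- \<tau>)" using powr_less_mono[of "- \<tau>" 0 "2::real"] by simp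
  define t where "t j = (LINT z:ball x (2 ^ j * r)|lebesgue. A z)" for j
  have intA: "integrable lebesgue (\<lambda>z. indicator (ball x R) z * A z)" for R
    using integrable_mult_indicator[of "ball x R" lebesgue A] bas(4) by simp
  have t_abs: "\<bar>t j\<bar> \<le> (LINT z:ball x (2 ^ j * r)|lebesgue. \<bar>A z\<bar>)" for j
    unfolding t_def by (rule abs_set_integral_le)
  have t1: "\<bar>t j\<bar> \<le> 2 * (2 ^ j * (r / \<rho>)) powr \<tau>" for j
  proof -
    have "vol (ball x (2 ^ j * r)) / vol (ball y \<rho>) = (2 ^ j * (r / \<rho>)) ^ CARD('n)"
      using measure_lebesgue_ball_pos[of 1 "0 :: real ^ 'n"] r rad
      unfolding measure_lebesgue_ball[of "2 ^ j * r" x, OF less_imp_le[OF mult_pos_pos[OF zero_less_power[OF zero_less_numeral] r(1)]]]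
        measure_lebesgue_ball[of \<rho> y, OF less_imp_le[OF rad(1)]]
      by (simp add: power_divide power_mult_distrib del: measure_completion)
    also have "\<dots> powr (1 - 1 / fin_exponent p) = (2 ^ j * (r / \<rho>)) powr \<tau>"
      using r rad unfolding \<tau>_def by (subst powr_realpow[symmetric]) (simp_all add: powr_powr)
    finally show ?thesis
      using t_abs[of j] H1r_atom_local_integral[OF assms(1) A lmeasurable_ball[of x "2 ^ j * r"]]
      by linarith
  qed
  have t2: "\<bar>t j\<bar> \<le> 2" for j
  proof -
    have "(LINT z:ball x (2 ^ j * r)|lebesgue. \<bar>A z\<bar>) \<le> (\<integral>z. \<bar>A z\<bar> \<partial>lebesgue)"
      unfolding set_lebesgue_integral_def
      by (rule integral_mono) (use integrable_mult_indicator[of "ball x (2 ^ j * r)" lebesgue "\<lambda>z. \<bar>A z\<bar>"] bas(4)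
        in \<open>auto simp: indicator_def\<close>)
    then show ?thesis using t_abs[of j] H1r_atom_L1[OF assms(1) A] by linarith
  qed
  \<comment> \<open>A ball that misses the support of the atom contributes nothing.\<close>
  have near: "dist x y - \<rho> < 2 ^ j * r" if "t j \<noteq> 0" for j
  proof (rule ccontr)
    assume "\<not> dist x y - \<rho> < 2 ^ j * r"
    then have "indicator (ball x (2 ^ j * r)) z *\<^sub>R A z = 0" for z
      using bas(3)[of z] dist_triangle[of x y z] by (auto simp: indicator_def dist_commute)
    then have "t j = 0" by (simp only: t_def set_lebesgue_integral_def) simp
    with that show False by simp
  qed
  define T where "T = {j. j \<le> J \<and> t j \<noteq> 0}"
  have finT: "finite T" by (simp add: T_def)
  have sumT: "\<bar>\<Sum>j\<le>J. t j\<bar> \<le> (\<Sum>j\<in>T. \<bar>t j\<bar>)"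
  proof -
    have "(\<Sum>j\<le>J. t j) = (\<Sum>j\<in>T. t j)"
      by (rule sum.mono_neutral_right) (auto simp: T_def)
    then show ?thesis by simp
  qed
  \<comment> \<open>Two situations suffice. Radii up to 5 * \<rho> give a geometric sum, dominated
    by its last term; otherwise at most two balls contribute, each at most 2, which is the 4 in the
    bound.\<close>
  have goal: "\<bar>\<Sum>j\<le>J. t j\<bar> \<le> 4 + 2 * 5 powr \<tau> / (1 - 2 powr (- \<tau>))"
    if *: "(\<forall>j\<in>T. 2 ^ j * r \<le> 5 * \<rho>) \<or> card T \<le> 2"
    using *
  proof
    assume "card T \<le> 2"
    have "(\<Sum>j\<in>T. \<bar>t j\<bar>) \<le> of_nat (card T) * 2" by (rule sum_bounded_above) (rule t2)
    also have "\<dots> \<le> 4" using \<open>card T \<le> 2\<close> by simp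
    also have "\<dots> \<le> 4 + 2 * 5 powr \<tau> / (1 - 2 powr (- \<tau>))" using q by simp
    finally show ?thesis using sumT by linarith
  next
    assume le: "\<forall>j\<in>T. 2 ^ j * r \<le> 5 * \<rho>"
    show ?thesis
    proof (cases "T = {}")
      case True
      then show ?thesis using sumT q by (simp add: add_nonneg_nonneg)
    next
      case False
      define m where "m = Max T"
      have m: "m \<in> T" "T \<subseteq> {..m}" using finT False by (auto simp: m_def)
      have "(\<Sum>j\<in>T. \<bar>t j\<bar>) \<le> (\<Sum>j\<in>T. 2 * (2 ^ j * (r / \<rho>)) powr \<tau>)" by (intro sum_mono t1)
      also have "\<dots> \<le> (\<Sum>j\<le>m. 2 * (2 ^ j * (r / \<rho>)) powr \<tau>)"
        by (rule sum_mono2) (use m in auto)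
      also have "\<dots> = 2 * (\<Sum>j\<le>m. (2 ^ j * (r / \<rho>)) powr \<tau>)" by (simp add: sum_distrib_left)
      also have "\<dots> \<le> 2 * ((2 ^ m * (r / \<rho>)) powr \<tau> / (1 - 2 powr (- \<tau>)))"
        using r rad \<tau> by (intro mult_left_mono sum_powr_dyadic_le) auto
      also have "\<dots> \<le> 2 * (5 powr \<tau> / (1 - 2 powr (- \<tau>)))"
        using le m(1) r rad q \<tau>
        by (intro mult_left_mono divide_right_mono powr_mono2) (auto simp: field_simps)
      finally show ?thesis using sumT by simp
    qed
  qed
  have "(\<forall>j\<in>T. 2 ^ j * r \<le> 5 * \<rho>) \<or> card T \<le> 2"
  \<comment> \<open>Without cancellation the height of y is below 4 * \<rho>. A contributing ball
    has its centre at height at least twice its radius R and at distance less than R + \<rho> from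
    y, so 2 * R < 4 * \<rho> + R + \<rho>; this is the 5.\<close>
  proof (cases "y $ k / 4 < \<rho>")
    case True
    have "2 ^ j * r \<le> 5 * \<rho>" if "j \<in> T" for j
    proof -
      have "(2::real) ^ j \<le> 2 ^ J" using that by (intro power_increasing) (auto simp: T_def)
      then have 1: "2 ^ j * r \<le> x $ k / 2" using r mult_right_mono[of "(2::real) ^ j" "2 ^ J" r] by linarith
      have "\<bar>(x - y) $ k\<bar> \<le> dist x y" unfolding dist_norm by (rule component_le_norm_cart)
      moreover have "dist x y - \<rho> < 2 ^ j * r" using that by (intro near) (simp add: T_def)
      ultimately show ?thesis using 1 True by (simp add: abs_le_iff)
    qed
    then show ?thesis by blast
  next
    case False
    then have int0: "(\<integral>z. A z \<partial>lebesgue) = 0" using A by (auto simp: H1r_atom_def)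
    \<comment> \<open>With cancellation, a ball containing the whole support contributes nothing
      either, so a contributing ball has to cut the support.\<close>
    have far: "2 ^ j * r < dist x y + \<rho>" if "t j \<noteq> 0" for j
    proof (rule ccontr)
      assume "\<not> 2 ^ j * r < dist x y + \<rho>"
      then have "indicator (ball x (2 ^ j * r)) z *\<^sub>R A z = A z" for z
        using bas(3)[of z] dist_triangle[of x z y] by (auto simp: indicator_def)
      then have "t j = 0" by (simp only: t_def set_lebesgue_integral_def int0)
      with that show False by simp
    qed
    show ?thesis
    proof (cases "dist x y < 2 * \<rho>")
      case True
      have "2 ^ j * r \<le> 5 * \<rho>" if "j \<in> T" for j
        using far[of j] that True rad by (simp add: T_def)
      then show ?thesis by blast
    next
      case False
      \<comment> \<open>Here dist x y \<ge> 2 * \<rho>, which is the same as dist x y + \<rho> \<le>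
        3 * \<alpha>; so the contributing radii lie within a factor 3 of each other.\<close>
      define \<alpha> where "\<alpha> = dist x y - \<rho>"
      have \<alpha>: "0 < \<alpha>" using False rad by (simp add: \<alpha>_def)
      have "T \<subseteq> {j::nat. \<alpha> < 2 ^ j * r \<and> 2 ^ j * r < 3 * \<alpha>}"
      proof
        fix j assume "j \<in> T"
        then have "t j \<noteq> 0" by (simp add: T_def)
        from near[OF this] far[OF this] False
        show "j \<in> {j::nat. \<alpha> < 2 ^ j * r \<and> 2 ^ j * r < 3 * \<alpha>}" by (simp add: \<alpha>_def)
      qed
      then show ?thesis using dyadic_values_card[OF \<alpha> r(1)] card_mono order_trans by blast
    qed
  qed
  from goal[OF this] show ?thesis by (simp add: t_def)
qed

text \<open>Since g is supported in the smallest ball, each of the J + 1 test integrals equals its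
  whole integral. On finite atomic sums the same functional is bounded by C times the coefficients,
  and convergence in L^1 carries this over to g.\<close>

lemma H1r_norm_test:
  fixes g :: "real ^ 'n::finite \<Rightarrow> real"
  assumes "1 < p" and r: "0 < r" "2 ^ J * r \<le> x $ k / 2"
    and supp: "\<And>z. z \<notin> ball x r \<Longrightarrow> g z = 0"
  defines "\<tau> \<equiv> real CARD('n) * (1 - 1 / fin_exponent p)"
  defines "C \<equiv> 4 + 2 * 5 powr \<tau> / (1 - 2 powr (- \<tau>))"
  shows "ennreal (real (Suc J) * \<bar>\<integral>z. g z \<partial>lebesgue\<bar>) \<le> ennreal C * H1r_norm k p g"
proof -
  have \<tau>: "0 < \<tau>" using fin_exponent_gt_1[OF assms(1)] by (simp add: \<tau>_def)
  then have C0: "0 < C" using powr_less_mono[of "- \<tau>" 0 "2::real"] by (simp add: C_def add_pos_nonneg)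
  let ?B = "\<lambda>j. ball x (2 ^ j * r)"
  have Bsub: "?B j \<subseteq> halfspace k" if "j \<le> J" for j
  proof
    fix z assume z: "z \<in> ?B j"
    have "(2::real) ^ j \<le> 2 ^ J" using that by (intro power_increasing) auto
    then have 1: "2 ^ j * r \<le> x $ k / 2" using r mult_right_mono[of "(2::real) ^ j" "2 ^ J" r] by linarith
    have "0 < 2 ^ j * r" using r by simp
    moreover have "\<bar>(x - z) $ k\<bar> \<le> dist x z" unfolding dist_norm by (rule component_le_norm_cart)
    ultimately show "z \<in> halfspace k" using z 1 by (simp add: halfspace_def)
  qed
  have key: "ennreal (real (Suc J) * \<bar>\<integral>z. g z \<partial>lebesgue\<bar>) \<le> ennreal C * (\<Sum>j. ennreal \<bar>c j\<bar>)"
    if rep: "H1r_representation k p g c a" for c a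
  proof -
    from rep have gi: "set_integrable lebesgue (halfspace k) g"
      and at: "\<And>j. \<exists>x r. H1r_atom k p (a j) x r" and sc: "summable (\<lambda>j. \<bar>c j\<bar>)"
      and lim: "(\<lambda>N. \<integral>\<^sup>+ y \<in> halfspace k. ennreal \<bar>g y - (\<Sum>j<N. c j * a j y)\<bar> \<partial>lebesgue) \<longlonglongrightarrow> 0"
      unfolding H1r_representation_def by blast+
    have gz: "indicator (halfspace k) z * g z = g z" for z
      using supp[of z] Bsub[of 0] by (cases "z \<in> ball x r") (auto simp: indicator_def)
    have intg: "integrable lebesgue g" using gi gz by (simp add: set_integrable_def)
    have inta: "integrable lebesgue (a j)" for j using at H1r_atom_basic(4) by metis
    define S where "S N y = (\<Sum>j<N. c j * a j y)" for N y
    have intS: "integrable lebesgue (S N)" for N unfolding S_def using inta by auto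
    define \<Phi> where "\<Phi> h = (\<Sum>j\<le>J. LINT z:?B j|lebesgue. h z)" for h :: "real ^ 'n \<Rightarrow> real"
    have phig: "(LINT z:?B j|lebesgue. g z) = (\<integral>z. g z \<partial>lebesgue)" for j
    proof -
      have "r \<le> 2 ^ j * r" using r by simp
      then have "indicator (?B j) z *\<^sub>R g z = g z" for z
        using supp[of z] by (cases "z \<in> ball x r") (auto simp: indicator_def)
      then show ?thesis by (simp only: set_lebesgue_integral_def)
    qed
    have indint: "integrable lebesgue (\<lambda>z. indicator (?B j) z * h z)" if "integrable lebesgue h" for h :: "real ^ 'n \<Rightarrow> real" and j
      using integrable_mult_indicator[of "?B j" lebesgue h] that by simp
    have phiS: "\<bar>\<Phi> (S N)\<bar> \<le> C * (\<Sum>i. \<bar>c i\<bar>)" for N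
    proof -
      have "\<Phi> (S N) = (\<Sum>j\<le>J. \<Sum>i<N. c i * (LINT z:?B j|lebesgue. a i z))"
        unfolding \<Phi>_def
      proof (rule sum.cong[OF refl])
        fix j
        have "(LINT z:?B j|lebesgue. S N z) = (\<integral>z. (\<Sum>i<N. c i * (indicator (?B j) z * a i z)) \<partial>lebesgue)"
          unfolding set_lebesgue_integral_def S_def by (simp only: sum_distrib_left real_scaleR_def mult.left_commute)
        also have "\<dots> = (\<Sum>i<N. c i * (LINT z:?B j|lebesgue. a i z))"
          unfolding set_lebesgue_integral_def
          by (subst Bochner_Integration.integral_sum) (use indint inta in auto)
        finally show "(LINT z:?B j|lebesgue. S N z) = (\<Sum>i<N. c i * (LINT z:?B j|lebesgue. a i z))" .
      qed
      also have "\<dots> = (\<Sum>i<N. c i * (\<Sum>j\<le>J. LINT z:?B j|lebesgue. a i z))"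
        by (subst sum.swap) (simp add: sum_distrib_left)
      finally have "\<bar>\<Phi> (S N)\<bar>
          \<le> (\<Sum>i<N. \<bar>c i * (\<Sum>j\<le>J. LINT z:?B j|lebesgue. a i z)\<bar>)" by simp
      also have "\<dots> \<le> (\<Sum>i<N. \<bar>c i\<bar> * C)"
      proof (rule sum_mono)
        fix i
        obtain y \<rho> where "H1r_atom k p (a i) y \<rho>" using at by blast
        from H1r_atom_test[OF assms(1) this r] show "\<bar>c i * (\<Sum>j\<le>J. LINT z:?B j|lebesgue. a i z)\<bar> \<le> \<bar>c i\<bar> * C"
          unfolding C_def \<tau>_def abs_mult by (intro mult_left_mono) auto
      qed
      also have "\<dots> = C * (\<Sum>i<N. \<bar>c i\<bar>)" by (simp add: sum_distrib_left mult.commute)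
      also have "\<dots> \<le> C * (\<Sum>i. \<bar>c i\<bar>)" using C0 sc by (intro mult_left_mono sum_le_suminf) auto
      finally show ?thesis .
    qed
    \<comment> \<open>The factor J + 1 in this error is harmless, because J is fixed while N tends
      to infinity.\<close>
    have phid: "ennreal \<bar>\<Phi> g - \<Phi> (S N)\<bar>
      \<le> ennreal (real (Suc J)) * (\<integral>\<^sup>+ y \<in> halfspace k. ennreal \<bar>g y - S N y\<bar> \<partial>lebesgue)" for N
    proof -
      let ?D = "LINT z:halfspace k|lebesgue. \<bar>g z - S N z\<bar>"
      have intd: "integrable lebesgue (\<lambda>z. \<bar>g z - S N z\<bar>)" using intg intS by auto
      have intdh: "integrable lebesgue (\<lambda>z. indicator (halfspace k) z * \<bar>g z - S N z\<bar>)"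
        using integrable_mult_indicator[OF halfspace_lebesgue intd] by simp
      have one: "\<bar>(LINT z:?B j|lebesgue. g z) - (LINT z:?B j|lebesgue. S N z)\<bar> \<le> ?D" if "j \<le> J" for j
      proof -
        have "(LINT z:?B j|lebesgue. g z) - (LINT z:?B j|lebesgue. S N z)
          = (\<integral>z. indicator (?B j) z * g z - indicator (?B j) z * S N z \<partial>lebesgue)"
          unfolding set_lebesgue_integral_def
          using Bochner_Integration.integral_diff[OF indint[OF intg, of j] indint[OF intS, of j N]] by simp
        also have "\<bar>\<dots>\<bar> \<le> (\<integral>z. \<bar>indicator (?B j) z * g z - indicator (?B j) z * S N z\<bar> \<partial>lebesgue)"
          by (rule integral_abs_bound)
        also have "\<dots> \<le> (\<integral>z. indicator (halfspace k) z * \<bar>g z - S N z\<bar> \<partial>lebesgue)"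
          by (rule integral_mono) (use indint[OF intg, of j] indint[OF intS, of j N] intdh Bsub[OF that] in \<open>auto simp: indicator_def\<close>)
        finally show ?thesis by (simp add: set_lebesgue_integral_def)
      qed
      have "\<bar>\<Phi> g - \<Phi> (S N)\<bar>
        \<le> (\<Sum>j\<le>J. \<bar>(LINT z:?B j|lebesgue. g z) - (LINT z:?B j|lebesgue. S N z)\<bar>)"
        by (simp add: \<Phi>_def flip: sum_subtractf)
      also have "\<dots> \<le> of_nat (card {..J}) * ?D" by (rule sum_bounded_above) (use one in auto)
      finally have "ennreal \<bar>\<Phi> g - \<Phi> (S N)\<bar>
        \<le> ennreal (real (Suc J)) * ennreal ?D"
        by (subst ennreal_mult'[symmetric]) (auto intro!: ennreal_leI)
      also have "ennreal ?D = (\<integral>\<^sup>+ y. ennreal (indicator (halfspace k) y * \<bar>g y - S N y\<bar>) \<partial>lebesgue)"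
        unfolding set_lebesgue_integral_def
        by (subst nn_integral_eq_integral) (use intdh in auto)
      also have "\<dots> = (\<integral>\<^sup>+ y \<in> halfspace k. ennreal \<bar>g y - S N y\<bar> \<partial>lebesgue)"
        by (rule nn_integral_cong) (auto simp: indicator_def)
      finally show ?thesis .
    qed
    let ?e = "\<lambda>N. \<integral>\<^sup>+ y \<in> halfspace k. ennreal \<bar>g y - S N y\<bar> \<partial>lebesgue"
    have le: "ennreal (real (Suc J) * \<bar>\<integral>z. g z \<partial>lebesgue\<bar>)
      \<le> ennreal (C * (\<Sum>i. \<bar>c i\<bar>)) + ennreal (real (Suc J)) * ?e N" for N
    proof -
      have "real (Suc J) * \<bar>\<integral>z. g z \<partial>lebesgue\<bar> = \<bar>\<Phi> g\<bar>"
        by (simp add: \<Phi>_def phig abs_mult)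
      also have "\<dots> \<le> C * (\<Sum>i. \<bar>c i\<bar>) + \<bar>\<Phi> g - \<Phi> (S N)\<bar>"
        using phiS[of N] by linarith
      finally have "ennreal (real (Suc J) * \<bar>\<integral>z. g z \<partial>lebesgue\<bar>) \<le> ennreal (C * (\<Sum>i. \<bar>c i\<bar>)) +
          ennreal \<bar>\<Phi> g - \<Phi> (S N)\<bar>"
        using C0 sc by (subst ennreal_plus[symmetric]) (auto intro!: ennreal_leI mult_nonneg_nonneg suminf_nonneg)
      also have "\<dots> \<le> ennreal (C * (\<Sum>i. \<bar>c i\<bar>)) + ennreal (real (Suc J)) * ?e N"
        by (intro add_left_mono phid)
      finally show ?thesis .
    qed
    have "(\<lambda>N. ennreal (C * (\<Sum>i. \<bar>c i\<bar>)) + ennreal (real (Suc J)) * ?e N)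
      \<longlonglongrightarrow> ennreal (C * (\<Sum>i. \<bar>c i\<bar>)) + ennreal (real (Suc J)) * 0"
      using lim unfolding S_def by (intro tendsto_add tendsto_const ennreal_tendsto_cmult) auto
    then have "ennreal (real (Suc J) * \<bar>\<integral>z. g z \<partial>lebesgue\<bar>) \<le> ennreal (C * (\<Sum>i. \<bar>c i\<bar>)) + ennreal (real (Suc J)) * 0"
      by (rule LIMSEQ_le_const) (use le in blast)
    also have "\<dots> = ennreal C * (\<Sum>j. ennreal \<bar>c j\<bar>)"
      using C0 sc suminf_nonneg[OF sc] by (simp add: suminf_ennreal2 ennreal_mult)
    finally show ?thesis .
  qed
  show ?thesis
  proof (cases "H1r_norm k p g = top")
    case True
    then show ?thesis using C0 by (simp add: ennreal_mult_top)
  next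
    case False
    have "ennreal (real (Suc J) * \<bar>\<integral>z. g z \<partial>lebesgue\<bar>) / ennreal C \<le> H1r_norm k p g"
      unfolding H1r_norm_def
    proof (rule INF_greatest)
      fix ca assume "ca \<in> {(c, a). H1r_representation k p g c a}"
      then obtain c a where ca: "ca = (c, a)" "H1r_representation k p g c a" by auto
      show "ennreal (real (Suc J) * \<bar>\<integral>z. g z \<partial>lebesgue\<bar>) / ennreal C \<le> (case ca of (c, a) \<Rightarrow> \<Sum>j. ennreal \<bar>c j\<bar>)"
        using key[OF ca(2)] C0 by (simp add: ca(1) divide_le_posI_ennreal mult.commute)
    qed
    moreover obtain h where h: "0 \<le> h" "H1r_norm k p g = ennreal h" using False by (cases "H1r_norm k p g") auto
    ultimately have "real (Suc J) * \<bar>\<integral>z. g z \<partial>lebesgue\<bar> / C \<le> h"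
      using C0 by (subst (asm) divide_ennreal) (auto simp: ennreal_le_iff)
    then show ?thesis using C0 h by (simp add: ennreal_mult[symmetric] pos_divide_le_eq mult.commute)
  qed
qed

section \<open>Mean oscillation recovered from products with atoms\<close>

lemma MO_eq_ennreal:
  fixes f :: "real ^ 'n::finite \<Rightarrow> real"
  assumes "set_integrable lebesgue B f" "B \<in> lmeasurable" "0 < vol B"
  shows "MO f B = ennreal ((LINT z:B|lebesgue. \<bar>f z - avg f B\<bar>) / vol B)"
    and "set_integrable lebesgue B (\<lambda>z. f z - c)"
proof -
  have fin: "set_integrable lebesgue B (\<lambda>z. f z - c)" for c
    using assms(1,2) by (intro set_integral_diff(1)) (auto simp: set_integrable_def fmeasurable_def)
  then show "set_integrable lebesgue B (\<lambda>z. f z - c)" .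
  have int: "integrable lebesgue (\<lambda>z. indicator B z * \<bar>f z - avg f B\<bar>)"
    using set_integrable_abs[OF fin[of "avg f B"]] by (simp add: set_integrable_def)
  have "(\<integral>\<^sup>+ y \<in> B. ennreal \<bar>f y - avg f B\<bar> \<partial>lebesgue)
      = (\<integral>\<^sup>+ y. ennreal (indicator B y * \<bar>f y - avg f B\<bar>) \<partial>lebesgue)"
    by (rule nn_integral_cong) (auto simp: indicator_def)
  also have "\<dots> = ennreal (LINT z:B|lebesgue. \<bar>f z - avg f B\<bar>)"
    unfolding set_lebesgue_integral_def by (subst nn_integral_eq_integral[OF int]) auto
  finally show "MO f B = ennreal ((LINT z:B|lebesgue. \<bar>f z - avg f B\<bar>) / vol B)"
    using assms(2,3) unfolding MO_def emeasure_eq_measure2[OF assms(2)]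
    by (subst divide_ennreal[symmetric]) (auto simp: set_lebesgue_integral_def)
qed

lemma L1_loc_ball_integrable:
  fixes f :: "real ^ 'n::finite \<Rightarrow> real"
  assumes "f \<in> L1_loc k" "r < x $ k"
  shows "set_integrable lebesgue (ball x r) f"
proof -
  have "cball x r \<subseteq> halfspace k"
  proof
    fix z assume "z \<in> cball x r"
    moreover have "\<bar>(x - z) $ k\<bar> \<le> dist x z" unfolding dist_norm by (rule component_le_norm_cart)
    ultimately show "z \<in> halfspace k" using assms(2) by (simp add: halfspace_def)
  qed
  then have "set_integrable lebesgue (cball x r) f" using assms(1) by (auto simp: L1_loc_def)
  then show ?thesis by (rule set_integrable_subset) auto
qed

text \<open>Subtracting the mean m of the sign function gives it cancellation and costs nothing in
  the product, because f - f_B has integral 0: the product integrates to half the mean oscillation.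
  Dividing by 2 * b compensates for |S - m| \<le> 2 on the ball.\<close>

lemma MO_le_atom_product:
  fixes f :: "real ^ 'n::finite \<Rightarrow> real"
  assumes "1 < p" "1 < q" and f: "f \<in> L1_loc k" and r: "0 < r" "r \<le> x $ k / 4" "2 ^ J * r \<le> x $ k / 2"
  defines "\<tau> \<equiv> real CARD('n) * (1 - 1 / fin_exponent p)"
  defines "C \<equiv> 4 + 2 * 5 powr \<tau> / (1 - 2 powr (- \<tau>))"
  shows "ennreal (real (Suc J) / 2) * MO f (hball k x r) \<le> ennreal C * atom_product_sup k p q f"
proof -
  have hb: "hball k x r = ball x r" using r by (intro hball_eq_ball) auto
  let ?B = "ball x r"
  define b where "b = vol ?B"
  have b: "0 < b" unfolding b_def by (rule measure_lebesgue_ball_pos) (rule r)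
  have fi: "set_integrable lebesgue ?B f" using f r by (intro L1_loc_ball_integrable) auto
  define \<kappa> where "\<kappa> = avg f ?B"
  have MO: "MO f ?B = ennreal ((LINT z:?B|lebesgue. \<bar>f z - \<kappa>\<bar>) / b)"
    and fk: "set_integrable lebesgue ?B (\<lambda>z. f z - \<kappa>)"
    using MO_eq_ennreal[OF fi lmeasurable_ball] b unfolding b_def \<kappa>_def by auto
  define h where "h z = indicator ?B z * (f z - \<kappa>)" for z
  have hint: "integrable lebesgue h" using fk by (simp add: set_integrable_def h_def[abs_def])
  have h0: "(\<integral>z. h z \<partial>lebesgue) = 0"
  proof -
    have "(LINT z:?B|lebesgue. f z - \<kappa>) = (LINT z:?B|lebesgue. f z) - (LINT z:?B|lebesgue. \<kappa>)"
      using fi emeasure_lborel_ball_finite[of x r]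
      by (intro set_integral_diff(2)) (auto simp: set_integrable_def intro!: integrable_real_indicator)
    also have "(LINT z:?B|lebesgue. \<kappa>) = b * \<kappa>" by (simp add: set_lebesgue_integral_def b_def)
    also have "(LINT z:?B|lebesgue. f z) = b * \<kappa>" using b by (simp add: \<kappa>_def avg_def b_def)
    finally show ?thesis by (simp add: h_def set_lebesgue_integral_def)
  qed
  define S where "S z = indicator ?B z * sgn (h z)" for z
  have [measurable]: "h \<in> borel_measurable lebesgue" "?B \<in> sets lebesgue"
    using borel_measurable_integrable[OF hint] by simp_all
  have Smeas: "S \<in> borel_measurable lebesgue"
    unfolding S_def sgn_real_def by measurable
  have Sint: "integrable lebesgue S"
    by (rule integrable_bounded_support[OF Smeas lmeasurable_ball[of x r], of 1]) (auto simp: S_def sgn_real_def)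
  define m where "m = (\<integral>z. S z \<partial>lebesgue) / b"
  have indint: "integrable lebesgue (\<lambda>z. indicator ?B z * c)" for c :: real
    by (rule integrable_indicator_mult[OF lmeasurable_ball])
  have "\<bar>\<integral>z. S z \<partial>lebesgue\<bar> \<le> b"
  proof -
    have "\<bar>\<integral>z. S z \<partial>lebesgue\<bar> \<le> (\<integral>z. \<bar>S z\<bar> \<partial>lebesgue)" by (rule integral_abs_bound)
    also have "\<dots> \<le> (\<integral>z. indicator ?B z * 1 \<partial>lebesgue)"
    proof (rule integral_mono)
      show "\<bar>S z\<bar> \<le> indicator ?B z * 1" for z by (auto simp: S_def sgn_real_def)
    qed (use Sint indint[of 1] in auto)
    finally show ?thesis by (simp add: b_def)
  qed
  then have m1: "\<bar>m\<bar> \<le> 1" using b by (simp add: m_def)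
  define a where "a z = (S z - indicator ?B z * m) / (2 * b)" for z
  have ameas: "a \<in> borel_measurable lebesgue" unfolding a_def using Smeas by measurable
  have "(\<integral>z. S z - indicator ?B z * m \<partial>lebesgue) = (\<integral>z. S z \<partial>lebesgue) - b * m"
    by (subst Bochner_Integration.integral_diff[OF Sint indint]) (simp add: b_def)
  then have a0: "(\<integral>z. a z \<partial>lebesgue) = 0" using b by (simp add: a_def m_def)
  have atom: "H1r_atom k q a x r"
  proof (rule H1r_atomI_bounded[OF assms(2) r(1) ameas])
    fix z assume "z \<in> ?B"
    have "\<bar>S z - indicator ?B z * m\<bar> \<le> 2"
      using m1 \<open>z \<in> ?B\<close> by (auto simp: S_def sgn_real_def)
    then show "\<bar>a z\<bar> \<le> 1 / vol ?B" using b unfolding a_def b_def[symmetric]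
      by (simp add: divide_simps)
  qed (use a0 r in \<open>auto simp: a_def S_def\<close>)
  let ?g = "atom_product k f a x r"
  have gsupp: "z \<notin> ?B \<Longrightarrow> ?g z = 0" for z by (simp add: atom_product_def a_def S_def)
  have g_eq: "?g z = (\<bar>h z\<bar> - m * h z) / (2 * b)" for z
    using mult_sgn_abs[of "f z - \<kappa>"] by (cases "z \<in> ?B")
      (auto simp: atom_product_def hb a_def S_def h_def \<kappa>_def[symmetric] algebra_simps abs_sgn)
  have "(\<integral>z. ?g z \<partial>lebesgue) = ((\<integral>z. \<bar>h z\<bar> \<partial>lebesgue) - m * (\<integral>z. h z \<partial>lebesgue)) / (2 * b)"
    unfolding g_eq using hint by simp
  also have "(\<integral>z. \<bar>h z\<bar> \<partial>lebesgue) = (LINT z:?B|lebesgue. \<bar>f z - \<kappa>\<bar>)"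
    unfolding set_lebesgue_integral_def by (rule Bochner_Integration.integral_cong) (auto simp: h_def abs_mult)
  finally have gI: "(\<integral>z. ?g z \<partial>lebesgue) = (LINT z:?B|lebesgue. \<bar>f z - \<kappa>\<bar>) / b / 2" by (simp add: h0)
  have I0: "0 \<le> (LINT z:?B|lebesgue. \<bar>f z - \<kappa>\<bar>) / b" using b by (auto simp: set_lebesgue_integral_def)
  have "ennreal (real (Suc J) / 2) * MO f (hball k x r) = ennreal (real (Suc J) / 2 * ((LINT z:?B|lebesgue. \<bar>f z - \<kappa>\<bar>) / b))"
    unfolding hb MO by (rule ennreal_mult'[symmetric]) simp
  also have "\<dots> = ennreal (real (Suc J) * \<bar>\<integral>z. ?g z \<partial>lebesgue\<bar>)"
    using abs_of_nonneg[OF I0] unfolding gI by (simp only: abs_divide abs_numeral) (simp add: mult.commute)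
  also have "\<dots> \<le> ennreal C * H1r_norm k p ?g"
    unfolding C_def \<tau>_def by (rule H1r_norm_test[OF assms(1) r(1,3) gsupp])
  also have "H1r_norm k p ?g \<le> atom_product_sup k p q f"
    unfolding atom_product_sup_def using atom by (intro SUP_upper2[of "(a, x, r)"]) auto
  finally show ?thesis by (simp add: mult_left_mono)
qed

text \<open>The number J of doublings that keep the ball away from the boundary is comparable to the
  logarithm. Balls with radius above a quarter of the height have a bounded logarithm and are
  covered by the BMO norm.\<close>

lemma BMO_log_norm_le_atom_product_sup:
  fixes k :: "'n::finite"
  assumes "1 < p" "1 < q"
  shows "\<exists>C\<ge>1. \<forall>f\<in>BMO k. BMO_log_norm k f \<le> ennreal C * (BMO_norm k f + atom_product_sup k p q f)"
proof -
  define \<tau> where "\<tau> = real CARD('n) * (1 - 1 / fin_exponent p)"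
  define C where "C = 4 + 2 * 5 powr \<tau> / (1 - 2 powr (- \<tau>))"
  have \<tau>: "0 < \<tau>" using fin_exponent_gt_1[OF assms(1)] by (simp add: \<tau>_def)
  then have C0: "4 \<le> C" using powr_less_mono[of "- \<tau>" 0 "2::real"] by (simp add: C_def)
  have "BMO_log_norm k f \<le> ennreal (8 * C) * (BMO_norm k f + atom_product_sup k p q f)" if f: "f \<in> BMO k" for f
    unfolding BMO_log_norm_def
  proof (rule SUP_least)
    fix xr assume "xr \<in> {(x, r). is_ball k x r}"
    then obtain x r where xr: "xr = (x, r)" "is_ball k x r" by auto
    then have r: "0 < r" "0 < x $ k" by (auto simp: is_ball_def halfspace_def)
    have e: "2 \<le> exp (1::real)" "exp (1::real) \<le> 3" using exp_ge_add_one_self[of 1] exp_le by auto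
    have MO: "MO f (hball k x r) \<le> BMO_norm k f"
      unfolding BMO_norm_def using xr(2) by (intro SUP_upper2[of "(x, r)"]) auto
    show "(case xr of (x, r) \<Rightarrow> ennreal (ln (exp 1 + x $ k / r)) * MO f (hball k x r))
      \<le> ennreal (8 * C) * (BMO_norm k f + atom_product_sup k p q f)"
    proof (cases "r \<le> x $ k / 4")
      case False
      then have "x $ k / r \<le> 4" using r by (simp add: field_simps)
      then have "exp 1 + x $ k / r \<le> 8" using e by simp
      also have "8 \<le> exp (3::real)" using power_mono[OF e(1), of 3] by (simp flip: exp_of_nat_mult)
      finally have "exp 1 + x $ k / r \<le> exp 3" .
      moreover have "0 < exp 1 + x $ k / r" using r by (simp add: add_pos_pos)
      ultimately have "ln (exp 1 + x $ k / r) \<le> 3"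
        using ln_le_cancel_iff[of "exp 1 + x $ k / r" "exp 3"] by simp
      then have "ln (exp 1 + x $ k / r) \<le> 8 * C" using C0 by simp
      then have "ennreal (ln (exp 1 + x $ k / r)) * MO f (hball k x r) \<le> ennreal (8 * C) * BMO_norm k f"
        by (intro mult_mono ennreal_leI MO) auto
      also have "\<dots> \<le> ennreal (8 * C) * (BMO_norm k f + atom_product_sup k p q f)"
        by (intro mult_left_mono) auto
      finally show ?thesis by (simp add: xr)
    next
      case True
      define P where "P = (\<lambda>j::nat. 2 ^ j * r \<le> x $ k / 2)"
      have P0: "P 0" using True r by (simp add: P_def)
      obtain N :: nat where N: "x $ k / r < 2 ^ N" using real_arch_pow[of 2 "x $ k / r"] by auto
      have bnd: "j \<le> N" if "P j" for j
      proof (rule ccontr)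
        assume "\<not> j \<le> N"
        then have "(2::real) ^ N \<le> 2 ^ j" by (intro power_increasing) auto
        with N have "x $ k / r < 2 ^ j" by linarith
        then have "x $ k < 2 ^ j * r" using r by (simp add: field_simps)
        then show False using that r by (simp add: P_def)
      qed
      define J where "J = (GREATEST j. P j)"
      have J: "P J" unfolding J_def by (rule GreatestI_nat[of P 0 N]) (use P0 bnd in auto)
      have "\<not> P (Suc J)" using Greatest_le_nat[of P "Suc J" N] bnd unfolding J_def[symmetric] by auto
      \<comment> \<open>Maximality of J. It follows that exp 1 + x $ k / r is at most 2 ^ (J + 3),
        so its logarithm is at most J + 3 \<le> 4 * (J + 1), whence the 8 in front of (J + 1) /
        2.\<close>
      then have "x $ k / r \<le> 4 * 2 ^ J" using r by (simp add: P_def field_simps)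
      moreover have "(1::real) \<le> 2 ^ J" by simp
      ultimately have "exp 1 + x $ k / r \<le> 8 * 2 ^ J" using e by linarith
      also have "\<dots> = 2 ^ (J + 3)" by (simp add: power_add)
      also have "\<dots> \<le> exp 1 ^ (J + 3)" by (rule power_mono) (use e in auto)
      also have "\<dots> = exp (real (J + 3))" by (simp flip: exp_of_nat_mult)
      finally have "exp 1 + x $ k / r \<le> exp (real (J + 3))" .
      moreover have "0 < exp 1 + x $ k / r" using r by (simp add: add_pos_pos)
      ultimately have "ln (exp 1 + x $ k / r) \<le> real (J + 3)"
        using ln_le_cancel_iff[of "exp 1 + x $ k / r" "exp (real (J + 3))"] by simp
      also have "\<dots> \<le> 8 * (real (Suc J) / 2)" by simp
      finally have "ennreal (ln (exp 1 + x $ k / r)) * MO f (hball k x r)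
        \<le> ennreal (8 * (real (Suc J) / 2)) * MO f (hball k x r)" by (intro mult_right_mono ennreal_leI) auto
      also have "\<dots> = ennreal 8 * (ennreal (real (Suc J) / 2) * MO f (hball k x r))"
        by (subst ennreal_mult) (auto simp: mult.assoc)
      also have "\<dots> \<le> ennreal 8 * (ennreal C * atom_product_sup k p q f)"
        using MO_le_atom_product[OF assms _ r(1) True, of f J] J f unfolding C_def \<tau>_def
        by (intro mult_left_mono) (auto simp: P_def BMO_def)
      also have "\<dots> = ennreal (8 * C) * atom_product_sup k p q f"
        using C0 by (subst ennreal_mult) (auto simp: mult.assoc)
      also have "\<dots> \<le> ennreal (8 * C) * (BMO_norm k f + atom_product_sup k p q f)"
        by (intro mult_left_mono) auto
      finally show ?thesis by (simp add: xr)
    qed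
  qed
  then show ?thesis using C0 by (intro exI[of _ "8 * C"]) auto
qed

section \<open>Dyadic cubes and the Calderon--Zygmund lemma\<close>

text \<open>For positive l this is the grid cube of side l / 2 ^ m containing z, as a fibre of
  integer parts. Such cubes are half-open, so each generation partitions the space exactly, without
  exceptional boundaries.\<close>

definition dyadic_cube :: "real \<Rightarrow> nat \<Rightarrow> real ^ 'n::finite \<Rightarrow> (real ^ 'n) set" where
  "dyadic_cube l m z = {y. \<forall>j. \<lfloor>y $ j * 2 ^ m / l\<rfloor> = \<lfloor>z $ j * 2 ^ m / l\<rfloor>}"

definition dyadic_cubes :: "real \<Rightarrow> (real ^ 'n::finite) set set" where
  "dyadic_cubes l = (\<Union>m. range (dyadic_cube l m))"

lemma dyadic_cube_self: "z \<in> dyadic_cube l m z"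
  by (simp add: dyadic_cube_def)

lemma dyadic_cube_eq: "y \<in> dyadic_cube l m z \<Longrightarrow> dyadic_cube l m y = dyadic_cube l m z"
  by (auto simp: dyadic_cube_def)

lemma dyadic_cube_in_cubes: "dyadic_cube l m z \<in> dyadic_cubes l"
  by (auto simp: dyadic_cubes_def)

lemma dyadic_cubesE:
  assumes "P \<in> dyadic_cubes l"
  obtains m z where "P = dyadic_cube l m z"
  using assms by (auto simp: dyadic_cubes_def)

lemma dyadic_cubesE_point:
  assumes "P \<in> dyadic_cubes l" "z \<in> P"
  obtains m where "P = dyadic_cube l m z"
  using assms by (metis dyadic_cubesE dyadic_cube_eq)

text \<open>Passing to the coarser generation acts on grid indices by integer division by 2, so the
  finer index determines the coarser one.\<close>

lemma dyadic_cube_antimono: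
  assumes "m \<le> m'"
  shows "dyadic_cube l m' z \<subseteq> dyadic_cube l m z"
  using assms
proof (induction m' rule: dec_induct)
  case (step i)
  have half: "\<lfloor>t * 2 ^ i / l\<rfloor> = \<lfloor>t * 2 ^ Suc i / l\<rfloor> div 2" for t
    using floor_divide_real_eq_div[of 2 "t * 2 ^ Suc i / l"] by simp
  have "dyadic_cube l (Suc i) z \<subseteq> dyadic_cube l i z"
    unfolding dyadic_cube_def half by auto
  with step.IH show ?case by blast
qed simp

lemma dyadic_cubes_nested:
  assumes "P \<in> dyadic_cubes l" "Q \<in> dyadic_cubes l" "P \<inter> Q \<noteq> {}"
  shows "P \<subseteq> Q \<or> Q \<subseteq> P"
proof -
  obtain z where z: "z \<in> P" "z \<in> Q" using assms(3) by blast
  obtain m m' where "P = dyadic_cube l m z" "Q = dyadic_cube l m' z"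
    using assms(1,2) z by (metis dyadic_cubesE_point)
  then show ?thesis using dyadic_cube_antimono[of m m' l z] dyadic_cube_antimono[of m' m l z]
    by (metis nat_le_linear)
qed

text \<open>Generation 0 is the coarsest, so only finitely many generations can contain P. This is
  what makes maximal cubes exist.\<close>

lemma finite_dyadic_superset:
  assumes "P \<in> dyadic_cubes l"
  shows "finite {Q \<in> dyadic_cubes l. P \<subseteq> Q}"
proof -
  obtain m z where P: "P = dyadic_cube l m z" using assms by (rule dyadic_cubesE)
  have "{Q \<in> dyadic_cubes l. P \<subseteq> Q} \<subseteq> (\<lambda>i. dyadic_cube l i z) ` {..m}"
  proof
    fix Q assume Q: "Q \<in> {Q \<in> dyadic_cubes l. P \<subseteq> Q}"
    then have "z \<in> Q" using dyadic_cube_self[of z l m] P by blast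
    then obtain i where i: "Q = dyadic_cube l i z" using Q by (auto elim: dyadic_cubesE_point)
    show "Q \<in> (\<lambda>i. dyadic_cube l i z) ` {..m}"
    proof (cases "i \<le> m")
      case False
      then have "Q \<subseteq> P" using dyadic_cube_antimono[of m i l z] i P by auto
      then have "Q = P" using Q by blast
      then show ?thesis using P by blast
    qed (use i in auto)
  qed
  then show ?thesis by (rule finite_subset) simp
qed

text \<open>Finiteness upwards puts a maximal cube above every member, and nestedness makes distinct
  maximal cubes disjoint.\<close>

lemma dyadic_cubes_maximal:
  fixes S :: "(real ^ 'n::finite) set set"
  assumes "S \<subseteq> dyadic_cubes l"
  shows "\<exists>M\<subseteq>S. disjoint M \<and> (\<forall>P\<in>S. \<exists>P'\<in>M. P \<subseteq> P') \<and> (\<forall>P\<in>M. \<forall>P'\<in>S. P \<subseteq> P' \<longrightarrow> P' = P)"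
proof -
  define M where "M = {P \<in> S. \<forall>P'\<in>S. P \<subseteq> P' \<longrightarrow> P' = P}"
  have "disjoint M"
    unfolding disjoint_def
  proof (intro ballI impI, rule ccontr)
    fix P Q assume PQ: "P \<in> M" "Q \<in> M" "P \<noteq> Q" "P \<inter> Q \<noteq> {}"
    then have "P \<subseteq> Q \<or> Q \<subseteq> P" using assms by (intro dyadic_cubes_nested[of P l Q]) (auto simp: M_def)
    then show False using PQ by (auto simp: M_def)
  qed
  moreover have "\<exists>P'\<in>M. P \<subseteq> P'" if P: "P \<in> S" for P
  proof -
    have "finite {Q \<in> S. P \<subseteq> Q}"
      using P assms by (intro finite_subset[OF _ finite_dyadic_superset[of P l]]) auto
    from finite_has_maximal2[OF this, of P] P obtain P' where P': "P' \<in> S" "P \<subseteq> P'"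
      "\<forall>b\<in>{Q \<in> S. P \<subseteq> Q}. P' \<subseteq> b \<longrightarrow> P' = b" by auto
    then have "P' \<in> M" unfolding M_def by blast
    with P' show ?thesis by blast
  qed
  ultimately show ?thesis by (intro exI[of _ M]) (auto simp: M_def)
qed

lemma dyadic_cube_bounds:
  fixes z y :: "real ^ 'n::finite" and m :: nat
  assumes "0 < l"
  defines "d \<equiv> l / 2 ^ m"
  defines "a \<equiv> (\<chi> j. of_int \<lfloor>z $ j * 2 ^ m / l\<rfloor> * d) :: real ^ 'n"
  shows "y \<in> dyadic_cube l m z \<longleftrightarrow> (\<forall>j. a $ j \<le> y $ j \<and> y $ j < a $ j + d)"
proof -
  have d: "0 < d" using assms by simp
  have t: "t * 2 ^ m / l = t / d" for t by (simp add: d_def)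
  have "\<lfloor>t\<rfloor> = i \<longleftrightarrow> of_int i \<le> t \<and> t < of_int i + 1" for t :: real and i by (auto simp: floor_eq_iff)
  then have "\<lfloor>y $ j / d\<rfloor> = i \<longleftrightarrow> of_int i * d \<le> y $ j \<and> y $ j < of_int i * d + d" for j i
    using d by (simp add: pos_le_divide_eq pos_divide_less_eq algebra_simps)
  then show ?thesis by (simp add: dyadic_cube_def a_def t)
qed

text \<open>The half-open cube is squeezed between an open and a closed box of equal volume.\<close>

lemma dyadic_cube_measure:
  fixes z :: "real ^ 'n::finite"
  assumes "0 < l"
  shows "dyadic_cube l m z \<in> lmeasurable" "vol (dyadic_cube l m z) = (l / 2 ^ m) ^ CARD('n)"
proof -
  define d where "d = l / 2 ^ m"
  have d: "0 < d" using assms by (simp add: d_def)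
  define a where "a = ((\<chi> j. of_int \<lfloor>z $ j * 2 ^ m / l\<rfloor> * d) :: real ^ 'n)"
  define b where "b = a + (\<chi> j. d)"
  let ?Q = "dyadic_cube l m z"
  note bd = dyadic_cube_bounds[OF assms, of _ m z, folded d_def, folded a_def]
  have "?Q = (\<Inter>j. {y. a $ j \<le> y $ j} \<inter> {y. y $ j < a $ j + d})" using bd by auto
  also have "\<dots> \<in> sets borel"
    by (intro sets.countable_INT'' sets.Int borel_closed borel_open closed_Collect_le open_Collect_less continuous_intros) auto
  finally have Qs: "?Q \<in> sets lebesgue" by auto
  have sub: "box a b \<subseteq> ?Q" "?Q \<subseteq> cbox a b"
    using bd by (auto simp: b_def mem_box_cart less_imp_le)
  show Q: "?Q \<in> lmeasurable" by (rule fmeasurableI2[OF lmeasurable_cbox sub(2) Qs])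
  have "a \<in> cbox a b" using d by (simp add: mem_box_cart b_def)
  then have c: "vol (cbox a b) = d ^ CARD('n)"
    using content_cbox_cart[of a b] by (auto simp: b_def)
  have "vol (box a b) = vol (cbox a b)"
    by (simp add: measure_lborel_box_eq measure_lborel_cbox_eq)
  then have "vol ?Q = d ^ CARD('n)"
    using measure_mono_fmeasurable[OF sub(1) _ Q] measure_mono_fmeasurable[OF sub(2) Qs lmeasurable_cbox] c
    by simp
  then show "vol ?Q = (l / 2 ^ m) ^ CARD('n)" by (simp add: d_def)
qed

lemma dyadic_cubes_measure:
  fixes P :: "(real ^ 'n::finite) set"
  assumes "0 < l" "P \<in> dyadic_cubes l"
  shows "P \<in> lmeasurable" "0 < vol P"
  using assms by (auto elim!: dyadic_cubesE simp: dyadic_cube_measure)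

text \<open>Bounding the norm by the sum of the coordinates gives the factor n instead of its square
  root; the later choices of \<open>l\<close> and \<open>C0\<close> are fitted to this.\<close>

lemma dyadic_cube_dist:
  fixes z y :: "real ^ 'n::finite"
  assumes "0 < l" "y \<in> dyadic_cube l m z"
  shows "dist z y < CARD('n) * (l / 2 ^ m)"
proof -
  define d where "d = l / 2 ^ m"
  define a where "a = ((\<chi> j. of_int \<lfloor>z $ j * 2 ^ m / l\<rfloor> * d) :: real ^ 'n)"
  note bd = dyadic_cube_bounds[OF assms(1), of _ m z, folded d_def, folded a_def]
  have c: "\<bar>(z - y) $ j\<bar> < d" for j
    using bd[of y] bd[of z] assms(2) dyadic_cube_self[of z l m]
    by (smt (verit) vector_minus_component)
  have "dist z y \<le> (\<Sum>j\<in>UNIV. \<bar>(z - y) $ j\<bar>)" unfolding dist_norm by (rule norm_le_l1_cart)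
  also have "\<dots> < (\<Sum>j\<in>(UNIV::'n set). d)" by (rule sum_strict_mono) (use c in auto)
  finally show ?thesis by (simp add: d_def)
qed

lemma dyadic_cube_subset_open:
  fixes z :: "real ^ 'n::finite"
  assumes "0 < l" "open U" "z \<in> U"
  shows "\<exists>m\<ge>m0. dyadic_cube l m z \<subseteq> U"
proof -
  obtain e where e: "0 < e" "ball z e \<subseteq> U" using assms openE by blast
  have "(\<lambda>m. CARD('n) * l * (1 / 2) ^ m) \<longlonglongrightarrow> CARD('n) * l * 0"
    by (intro tendsto_mult tendsto_const LIMSEQ_power_zero) auto
  then have "\<forall>\<^sub>F m in sequentially. CARD('n) * l * (1 / 2) ^ m < e"
    using e(1) by (simp add: order_tendstoD(2))
  then have "\<forall>\<^sub>F m in sequentially. CARD('n) * l * (1 / 2) ^ m < e \<and> m0 \<le> m"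
    by (intro eventually_conj eventually_ge_at_top)
  then obtain m where m: "CARD('n) * l * (1 / 2) ^ m < e" "m0 \<le> m"
    by (auto simp: eventually_sequentially)
  have "dyadic_cube l m z \<subseteq> ball z e"
    using dyadic_cube_dist[OF assms(1), of _ m z] m(1) by (fastforce simp: power_divide)
  with e m show ?thesis by blast
qed

lemma countable_dyadic_cubes:
  fixes M :: "(real ^ 'n::finite) set set"
  assumes "0 < l" "M \<subseteq> dyadic_cubes l"
  shows "countable M"
proof -
  have "countable (range (dyadic_cube l m :: real ^ 'n \<Rightarrow> _))" for m
  proof -
    define g where "g = (\<lambda>i :: 'n \<Rightarrow> int. {y :: real ^ 'n. \<forall>j. \<lfloor>y $ j * 2 ^ m / l\<rfloor> = i j})"
    have "range (dyadic_cube l m :: real ^ 'n \<Rightarrow> _) \<subseteq> range g"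
      by (auto simp: dyadic_cube_def g_def)
    then show ?thesis by (rule countable_subset) simp
  qed
  then have "countable (dyadic_cubes l :: (real ^ 'n) set set)" unfolding dyadic_cubes_def by auto
  with assms(2) show ?thesis by (rule countable_subset)
qed

text \<open>A cube strictly inside Q belongs to a later generation than Q, so going up one
  generation does not leave Q.\<close>

lemma dyadic_parent:
  fixes P Q :: "(real ^ 'n::finite) set"
  assumes "0 < l" "P \<in> dyadic_cubes l" "Q \<in> dyadic_cubes l" "P \<subset> Q"
  shows "\<exists>P'\<in>dyadic_cubes l. P \<subset> P' \<and> P' \<subseteq> Q \<and> vol P' = 2 ^ CARD('n) * vol P"
proof -
  obtain m z where P: "P = dyadic_cube l m z" using assms(2) by (rule dyadic_cubesE)
  then have "z \<in> Q" using dyadic_cube_self[of z l m] assms(4) by blast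
  then obtain i where Q: "Q = dyadic_cube l i z" using assms(3) by (auto elim: dyadic_cubesE_point)
  have "i < m"
  proof (rule ccontr)
    assume "\<not> i < m"
    then have "Q \<subseteq> P" using dyadic_cube_antimono[of m i l z] P Q by auto
    with assms(4) show False by blast
  qed
  then obtain j where j: "m = Suc j" "i \<le> j" by (cases m) auto
  let ?P = "dyadic_cube l j z"
  have me: "vol ?P = 2 ^ CARD('n) * vol P"
  proof -
    have "l / 2 ^ j = 2 * (l / 2 ^ m)" by (simp add: j(1))
    then show ?thesis unfolding P dyadic_cube_measure(2)[OF assms(1)] by (simp only: power_mult_distrib)
  qed
  have "P \<subseteq> ?P" unfolding P j(1) by (rule dyadic_cube_antimono) simp
  moreover have "P \<noteq> ?P"
  proof
    assume "P = ?P"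
    then have "2 ^ CARD('n) * vol P = 1 * vol P" using me by simp
    then have "2 ^ CARD('n) = (1::real)" using dyadic_cubes_measure(2)[OF assms(1,2)] by (simp only: mult_cancel_right) simp
    moreover have "(1::real) < 2 ^ CARD('n)" by (rule one_less_power) auto
    ultimately show False by linarith
  qed
  moreover have "?P \<subseteq> Q" unfolding Q by (rule dyadic_cube_antimono) (rule j)
  ultimately show ?thesis using me dyadic_cube_in_cubes[of l j z] by blast
qed

section \<open>Differentiation and selection along dyadic cubes\<close>

lemma emeasure_disjoint_union_le:
  assumes "countable M" "disjoint M" and sets: "M \<subseteq> sets \<mu>" "sets \<nu> = sets \<mu>"
    and le: "\<And>P. P \<in> M \<Longrightarrow> emeasure \<nu> P \<le> c * emeasure \<mu> P"
  shows "emeasure \<nu> (\<Union>M) \<le> c * emeasure \<mu> (\<Union>M)"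
proof -
  have dis: "disjoint_family_on (\<lambda>P. P) M" using assms(2) by (auto simp: disjoint_family_on_def disjoint_def)
  have "emeasure \<nu> (\<Union>P\<in>M. P) = (\<integral>\<^sup>+P. emeasure \<nu> P \<partial>count_space M)"
    by (rule emeasure_UN_countable[OF _ assms(1) dis]) (use sets in auto)
  also have "\<dots> \<le> (\<integral>\<^sup>+P. c * emeasure \<mu> P \<partial>count_space M)"
    by (rule nn_integral_mono) (use le in auto)
  also have "\<dots> = c * (\<integral>\<^sup>+P. emeasure \<mu> P \<partial>count_space M)"
    by (rule nn_integral_cmult) auto
  also have "(\<integral>\<^sup>+P. emeasure \<mu> P \<partial>count_space M) = emeasure \<mu> (\<Union>P\<in>M. P)"
    by (rule emeasure_UN_countable[OF _ assms(1) dis, symmetric]) (use sets in auto)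
  finally show ?thesis by simp
qed

text \<open>Reading the integral of u as a measure lets countable additivity take the place of
  limits of integrals over unions of cubes.\<close>

lemma set_integral_eq_emeasure_density:
  fixes u :: "real ^ 'n::finite \<Rightarrow> real"
  assumes u: "set_integrable lebesgue Q u" "\<And>z. z \<in> Q \<Longrightarrow> 0 \<le> u z"
    and P: "P \<in> sets lebesgue" "P \<subseteq> Q"
  shows "emeasure (density lebesgue (\<lambda>z. ennreal (indicator Q z * u z))) P = ennreal (LINT z:P|lebesgue. u z)"
proof -
  have iQ: "integrable lebesgue (\<lambda>z. indicator Q z * u z)" using u(1) by (simp add: set_integrable_def)
  have iP: "integrable lebesgue (\<lambda>z. indicator P z * u z)"
    using set_integrable_subset[OF u(1) P] by (simp add: set_integrable_def)
  have "emeasure (density lebesgue (\<lambda>z. ennreal (indicator Q z * u z))) P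
    = (\<integral>\<^sup>+ z. ennreal (indicator Q z * u z) * indicator P z \<partial>lebesgue)"
    by (rule emeasure_density) (use iQ P in auto)
  also have "\<dots> = (\<integral>\<^sup>+ z. ennreal (indicator P z * u z) \<partial>lebesgue)"
    by (rule nn_integral_cong) (use P in \<open>auto simp: indicator_def\<close>)
  also have "\<dots> = ennreal (LINT z:P|lebesgue. u z)"
    unfolding set_lebesgue_integral_def
    by (subst nn_integral_eq_integral[OF iP]) (use u(2) P(2) in \<open>auto simp: indicator_def\<close>)
  finally show ?thesis .
qed

text \<open>
  One half of the Lebesgue differentiation theorem for dyadic cubes: an open set of slightly
  larger measure around the exceptional set is a disjoint union of cubes, on each of which the
  average is controlled.
\<close>

lemma dyadic_AE_le:
  fixes u :: "real ^ 'n::finite \<Rightarrow> real"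
  assumes l: "0 < l" and Q: "Q \<in> dyadic_cubes l"
    and u: "set_integrable lebesgue Q u" "\<And>z. z \<in> Q \<Longrightarrow> 0 \<le> u z"
    and G: "G \<in> sets lebesgue" "G \<subseteq> Q" and \<Lambda>: "0 \<le> \<Lambda>"
    and le: "\<And>P. P \<in> dyadic_cubes l \<Longrightarrow> P \<subseteq> Q \<Longrightarrow> P \<inter> G \<noteq> {} \<Longrightarrow>
      (LINT z:P|lebesgue. u z) \<le> \<Lambda> * vol P"
  shows "AE z in lebesgue. z \<in> G \<longrightarrow> u z \<le> \<Lambda>"
proof -
  define v where "v z = indicator Q z * u z" for z
  have iv: "integrable lebesgue v" using u(1) by (simp add: set_integrable_def v_def[abs_def])
  then have vm: "v \<in> borel_measurable lebesgue" by (rule borel_measurable_integrable)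
  define E where "E = {z \<in> space lebesgue. \<Lambda> < v z} \<inter> G"
  have E: "E \<in> sets lebesgue" unfolding E_def
    by (intro sets.Int G(1) borel_measurable_less vm borel_measurable_const)
  have EQ: "E \<subseteq> Q" using G by (auto simp: E_def)
  have Qm: "Q \<in> lmeasurable" by (rule dyadic_cubes_measure[OF l Q])
  have Em: "E \<in> lmeasurable" by (rule fmeasurableI2[OF Qm EQ E])
  define \<nu> where "\<nu> = density lebesgue (\<lambda>z. ennreal (indicator Q z * u z))"
  have \<nu>sets: "sets \<nu> = sets lebesgue" by (simp add: \<nu>_def)
  have \<nu>P: "emeasure \<nu> P = ennreal (LINT z:P|lebesgue. u z)" if "P \<in> sets lebesgue" "P \<subseteq> Q" for P
    unfolding \<nu>_def using set_integral_eq_emeasure_density[OF u that] .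
  have eps: "(LINT z:E|lebesgue. u z) \<le> \<Lambda> * (vol E + e)" if e: "0 < e" for e
  proof -
    obtain T where T: "open T" "E \<subseteq> T" "T - E \<in> lmeasurable" "emeasure lebesgue (T - E) < ennreal e"
      using sets_lebesgue_outer_open[OF E e] by blast
    \<comment> \<open>Only cubes meeting \<open>G\<close> enter, since the averages are controlled
      just for these. Every small cube around a point of \<open>E\<close> is of this kind, and one
      of them lies in the open set \<open>T\<close>.\<close>
    define S where "S = {P \<in> dyadic_cubes l. P \<subseteq> T \<inter> Q \<and> P \<inter> G \<noteq> {}}"
    obtain M where M: "M \<subseteq> S" "disjoint M" "\<And>P. P \<in> S \<Longrightarrow> \<exists>P'\<in>M. P \<subseteq> P'"
      using dyadic_cubes_maximal[of S l] by (auto simp: S_def)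
    have cM: "countable M" by (rule countable_dyadic_cubes[OF l]) (use M(1) in \<open>auto simp: S_def\<close>)
    have Ms: "M \<subseteq> sets lebesgue" using M(1) dyadic_cubes_measure(1)[OF l] by (auto simp: S_def fmeasurable_def)
    have UM: "\<Union>M \<in> sets lebesgue" using Ms cM by auto
    have UMT: "\<Union>M \<subseteq> T \<inter> Q" using M(1) by (auto simp: S_def)
    have EM: "E \<subseteq> \<Union>M"
    proof
      fix z assume z: "z \<in> E"
      then have "z \<in> Q" "z \<in> T" using EQ T by auto
      obtain m0 where m0: "Q = dyadic_cube l m0 z" using dyadic_cubesE_point[OF Q \<open>z \<in> Q\<close>] by blast
      obtain m where m: "m \<ge> m0" "dyadic_cube l m z \<subseteq> T"
        using dyadic_cube_subset_open[OF l T(1) \<open>z \<in> T\<close>] by blast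
      have "z \<in> G" using z by (simp add: E_def)
      then have "dyadic_cube l m z \<in> S"
        using m dyadic_cube_antimono[OF m(1), of l z] m0 dyadic_cube_self[of z l m] dyadic_cube_in_cubes
        unfolding S_def by blast
      from M(3)[OF this] show "z \<in> \<Union>M" using dyadic_cube_self[of z l m] by blast
    qed
    have "ennreal (LINT z:E|lebesgue. u z) = emeasure \<nu> E" by (rule \<nu>P[symmetric]) (use E EQ in auto)
    also have "\<dots> \<le> emeasure \<nu> (\<Union>M)" using EM UM by (intro emeasure_mono) (auto simp: \<nu>sets)
    also have "\<dots> \<le> ennreal \<Lambda> * emeasure lebesgue (\<Union>M)"
    proof (rule emeasure_disjoint_union_le[OF cM M(2) Ms \<nu>sets])
      fix P assume "P \<in> M"
      then have P: "P \<in> dyadic_cubes l" "P \<subseteq> Q" "P \<inter> G \<noteq> {}" using M(1) by (auto simp: S_def)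
      have Pm: "P \<in> lmeasurable" by (rule dyadic_cubes_measure[OF l P(1)])
      have "emeasure \<nu> P = ennreal (LINT z:P|lebesgue. u z)"
        by (rule \<nu>P) (use Pm P in \<open>auto simp: fmeasurable_def\<close>)
      also have "\<dots> \<le> ennreal (\<Lambda> * vol P)" by (intro ennreal_leI le P)
      also have "\<dots> = ennreal \<Lambda> * emeasure lebesgue P"
        using \<Lambda> by (simp add: emeasure_eq_measure2[OF Pm] ennreal_mult)
      finally show "emeasure \<nu> P \<le> ennreal \<Lambda> * emeasure lebesgue P" .
    qed
    also have "emeasure lebesgue (\<Union>M) \<le> emeasure lebesgue (E \<union> (T - E))"
      using UMT E T by (intro emeasure_mono) (auto simp: fmeasurable_def)
    also have "\<dots> \<le> emeasure lebesgue E + emeasure lebesgue (T - E)"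
      using E T by (intro emeasure_subadditive) (auto simp: fmeasurable_def)
    also have "\<dots> \<le> ennreal (vol E) + ennreal e"
      using T(4) by (intro add_mono) (auto simp: emeasure_eq_measure2[OF Em])
    also have "\<dots> = ennreal (vol E + e)" using e by simp
    finally have "ennreal (LINT z:E|lebesgue. u z) \<le> ennreal (\<Lambda> * (vol E + e))"
      using \<Lambda> e by (simp add: mult_left_mono ennreal_mult)
    then show ?thesis using \<Lambda> e by (subst (asm) ennreal_le_iff) auto
  qed
  have iE: "integrable lebesgue (\<lambda>z. indicator E z * u z)"
    using set_integrable_subset[OF u(1) E EQ] by (simp add: set_integrable_def)
  have i\<Lambda>: "integrable lebesgue (\<lambda>z. indicator E z * \<Lambda>)"
    by (rule integrable_indicator_mult[OF Em])
  have "(LINT z:E|lebesgue. u z) \<le> \<Lambda> * vol E"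
  proof (rule field_le_epsilon)
    fix e :: real assume "0 < e"
    then have "(LINT z:E|lebesgue. u z) \<le> \<Lambda> * (vol E + e / (\<Lambda> + 1))"
      using \<Lambda> by (intro eps) auto
    also have "\<dots> \<le> \<Lambda> * vol E + e"
      using \<Lambda> \<open>0 < e\<close> by (simp add: field_simps)
    finally show "(LINT z:E|lebesgue. u z) \<le> \<Lambda> * vol E + e" .
  qed
  \<comment> \<open>The integrand is strictly positive on \<open>E\<close>, so that an integral of
    at most 0 forces \<open>E\<close> to be a null set.\<close>
  then have "(\<integral>z. indicator E z * u z - indicator E z * \<Lambda> \<partial>lebesgue) \<le> 0"
    using E by (subst Bochner_Integration.integral_diff[OF iE i\<Lambda>]) (simp add: set_lebesgue_integral_def mult.commute)
  moreover have nn: "0 \<le> indicator E z * u z - indicator E z * \<Lambda>" for z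
    using G by (auto simp: indicator_def E_def v_def split: if_splits)
  then have "0 \<le> (\<integral>z. indicator E z * u z - indicator E z * \<Lambda> \<partial>lebesgue)"
    by (intro integral_nonneg_AE) auto
  ultimately have "(\<integral>z. indicator E z * u z - indicator E z * \<Lambda> \<partial>lebesgue) = 0" by simp
  then have "AE z in lebesgue. indicator E z * u z - indicator E z * \<Lambda> = 0"
    using integral_nonneg_eq_0_iff_AE[of lebesgue "\<lambda>z. indicator E z * u z - indicator E z * \<Lambda>"] nn iE i\<Lambda> by auto
  then show ?thesis
    by eventually_elim (use G in \<open>auto simp: E_def v_def indicator_def split: if_splits\<close>)
qed

text \<open>The selected cubes are the maximal ones with average above \<Lambda>. \<open>Q\<close>
  is not among them, so each has a parent inside \<open>Q\<close>, which is not selected and has 2^n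
  times the volume; this gives the upper bound. A point outside all of them lies in no cube of large
  average inside \<open>Q\<close>.\<close>

theorem Calderon_Zygmund:
  fixes u :: "real ^ 'n::finite \<Rightarrow> real"
  assumes l: "0 < l" and Q: "Q \<in> dyadic_cubes l"
    and u: "set_integrable lebesgue Q u" "\<And>z. z \<in> Q \<Longrightarrow> 0 \<le> u z" and \<Lambda>: "0 \<le> \<Lambda>"
    and avg: "(LINT z:Q|lebesgue. u z) \<le> \<Lambda> * vol Q"
  shows "\<exists>B\<subseteq>dyadic_cubes l. disjoint B \<and>
    (\<forall>P\<in>B. P \<subseteq> Q \<and> \<Lambda> * vol P \<le> (LINT z:P|lebesgue. u z) \<and>
       (LINT z:P|lebesgue. u z) \<le> 2 ^ CARD('n) * \<Lambda> * vol P) \<and>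
    (AE z in lebesgue. z \<in> Q - \<Union>B \<longrightarrow> u z \<le> \<Lambda>)"
proof -
  define S where "S = {P \<in> dyadic_cubes l. P \<subseteq> Q \<and> \<Lambda> * vol P < (LINT z:P|lebesgue. u z)}"
  obtain B where B: "B \<subseteq> S" "disjoint B" "\<And>P. P \<in> S \<Longrightarrow> \<exists>P'\<in>B. P \<subseteq> P'"
    "\<And>P P'. P \<in> B \<Longrightarrow> P' \<in> S \<Longrightarrow> P \<subseteq> P' \<Longrightarrow> P' = P"
    using dyadic_cubes_maximal[of S l] by (auto simp: S_def)
  have cB: "countable B" by (rule countable_dyadic_cubes[OF l]) (use B(1) in \<open>auto simp: S_def\<close>)
  have Bs: "B \<subseteq> sets lebesgue" using B(1) dyadic_cubes_measure(1)[OF l] by (auto simp: S_def fmeasurable_def)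
  have UB: "\<Union>B \<in> sets lebesgue" using Bs cB by auto
  have upper: "(LINT z:P|lebesgue. u z) \<le> 2 ^ CARD('n) * \<Lambda> * vol P" if P: "P \<in> B" for P
  proof -
    have PS: "P \<in> S" using P B by blast
    then have "P \<noteq> Q" using avg by (auto simp: S_def)
    with PS obtain P' where P': "P' \<in> dyadic_cubes l" "P \<subset> P'" "P' \<subseteq> Q"
      "vol P' = 2 ^ CARD('n) * vol P"
      using dyadic_parent[OF l _ Q, of P] by (auto simp: S_def)
    have "P' \<notin> S" using B(4)[OF P, of P'] P' by blast
    then have le: "(LINT z:P'|lebesgue. u z) \<le> \<Lambda> * vol P'" using P' by (simp add: S_def)
    have sP: "P \<in> sets lebesgue" "P' \<in> sets lebesgue"
      using dyadic_cubes_measure(1)[OF l] P' PS by (auto simp: S_def fmeasurable_def)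
    have "(LINT z:P|lebesgue. u z) \<le> (LINT z:P'|lebesgue. u z)"
      unfolding set_lebesgue_integral_def
    proof (rule integral_mono)
      show "integrable lebesgue (\<lambda>z. indicator P z *\<^sub>R u z)" "integrable lebesgue (\<lambda>z. indicator P' z *\<^sub>R u z)"
        using set_integrable_subset[OF u(1) sP(1)] set_integrable_subset[OF u(1) sP(2)] P'
        by (auto simp: set_integrable_def)
      show "indicator P z *\<^sub>R u z \<le> indicator P' z *\<^sub>R u z" for z
        using u(2)[of z] P' by (auto simp: indicator_def)
    qed
    with le P'(4) show ?thesis by (simp add: mult_ac)
  qed
  have "AE z in lebesgue. z \<in> Q - \<Union>B \<longrightarrow> u z \<le> \<Lambda>"
  proof (rule dyadic_AE_le[OF l Q u _ _ \<Lambda>])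
    show "Q - \<Union>B \<in> sets lebesgue" using UB dyadic_cubes_measure(1)[OF l Q] by (auto simp: fmeasurable_def)
    fix P assume P: "P \<in> dyadic_cubes l" "P \<subseteq> Q" "P \<inter> (Q - \<Union>B) \<noteq> {}"
    then have "P \<notin> S" using B(3)[of P] by blast
    with P show "(LINT z:P|lebesgue. u z) \<le> \<Lambda> * vol P" by (simp add: S_def)
  qed auto
  with B upper show ?thesis by (intro exI[of _ B]) (auto simp: S_def)
qed

section \<open>Stopping-time trees\<close>

text \<open>The enumerated pieces have at most one nonzero term at each point and summable L^1
  norms, so the series may be integrated term by term.\<close>

lemma piece_sum_integral:
  fixes f :: "'a set \<Rightarrow> 'a \<Rightarrow> real"
  assumes F: "countable F" "disjoint F"
    and int: "\<And>P. P \<in> F \<Longrightarrow> integrable M (f P)"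
    and supp: "\<And>P z. P \<in> F \<Longrightarrow> z \<notin> P \<Longrightarrow> f P z = 0"
    and le: "\<And>E. finite E \<Longrightarrow> E \<subseteq> F \<Longrightarrow> (\<Sum>P\<in>E. \<integral>z. \<bar>f P z\<bar> \<partial>M) \<le> t"
  shows "integrable M (piece_sum F f)" "(\<integral>z. \<bar>piece_sum F f z\<bar> \<partial>M) \<le> t"
    "(\<And>P. P \<in> F \<Longrightarrow> (\<integral>z. f P z \<partial>M) = 0) \<Longrightarrow> (\<integral>z. piece_sum F f z \<partial>M) = 0"
proof -
  define h where "h = nth_piece F (\<lambda>_. 0) f"
  let ?N = "\<lambda>P. \<integral>z. \<bar>f P z\<bar> \<partial>M"
  have hint: "integrable M (h i)" for i
    unfolding h_def by (rule nth_piece_cases[OF F(1), of "\<lambda>_. 0" f i 0 ?N]) (use int in auto)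
  have norm: "(\<integral>z. \<bar>h i z\<bar> \<partial>M) = nth_piece F 0 ?N i" for i
    unfolding h_def by (rule nth_piece_cases[OF F(1), of "\<lambda>_. 0" f i 0 ?N]) auto
  have single: "\<exists>i. (\<forall>j. j \<noteq> i \<longrightarrow> h j z = 0) \<and> h i z = piece_sum F f z" for z
    unfolding h_def by (rule nth_piece_single[OF F supp])
  have sums: "(\<lambda>i. h i z) sums piece_sum F f z" "(\<lambda>i. \<bar>h i z\<bar>) sums \<bar>piece_sum F f z\<bar>" for z
  proof -
    obtain i where i: "\<forall>j. j \<noteq> i \<longrightarrow> h j z = 0" "h i z = piece_sum F f z" using single by blast
    show "(\<lambda>i. h i z) sums piece_sum F f z" "(\<lambda>i. \<bar>h i z\<bar>) sums \<bar>piece_sum F f z\<bar>"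
      using sums_finite[of "{i}" "\<lambda>i. h i z"] sums_finite[of "{i}" "\<lambda>i. \<bar>h i z\<bar>"] i by auto
  qed
  have part: "(\<Sum>i<N. \<integral>z. \<bar>h i z\<bar> \<partial>M) \<le> t" for N
    unfolding norm by (rule sum_nth_piece_le[OF F(1) le])
  have sm: "summable (\<lambda>i. \<integral>z. \<bar>h i z\<bar> \<partial>M)"
    by (rule summableI_nonneg_bounded[of _ t]) (use part in auto)
  have fn: "(\<lambda>z. \<Sum>i. h i z) = piece_sum F f" "(\<lambda>z. \<Sum>i. \<bar>h i z\<bar>) = (\<lambda>z. \<bar>piece_sum F f z\<bar>)"
    using sums by (auto simp: sums_iff)
  have sn: "AE z in M. summable (\<lambda>i. norm (h i z))" using sums(2) by (auto simp: sums_iff)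
  show "integrable M (piece_sum F f)"
    unfolding fn(1)[symmetric] by (rule integrable_suminf) (use hint sn sm in auto)
  have "(\<integral>z. \<bar>piece_sum F f z\<bar> \<partial>M) = (\<Sum>i. \<integral>z. \<bar>h i z\<bar> \<partial>M)"
    unfolding fn(2)[symmetric] by (rule integral_suminf) (use hint sn sm in auto)
  also have "\<dots> \<le> t" by (rule suminf_le_const[OF sm part])
  finally show "(\<integral>z. \<bar>piece_sum F f z\<bar> \<partial>M) \<le> t" .
  assume z: "\<And>P. P \<in> F \<Longrightarrow> (\<integral>z. f P z \<partial>M) = 0"
  have "(\<integral>z. piece_sum F f z \<partial>M) = (\<Sum>i. \<integral>z. h i z \<partial>M)"
    unfolding fn(1)[symmetric] by (rule integral_suminf) (use hint sn sm in auto)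
  moreover have "(\<integral>z. h i z \<partial>M) = 0" for i
    unfolding h_def by (rule nth_piece_cases[OF F(1), of "\<lambda>_. 0" f i 0 ?N]) (use z in auto)
  ultimately show "(\<integral>z. piece_sum F f z \<partial>M) = 0" by simp
qed

lemma atomic_bound_bounded:
  fixes h :: "real ^ 'n::finite \<Rightarrow> real"
  assumes "1 < p" "0 < \<rho>" and h: "h \<in> borel_measurable lebesgue" "\<And>z. z \<notin> ball x \<rho> \<Longrightarrow> h z = 0"
    and bd: "AE z in lebesgue. \<bar>h z\<bar> \<le> \<kappa>" and W: "\<kappa> * vol (ball x \<rho>) \<le> W" "0 \<le> W"
    and can: "x $ k / 4 < \<rho> \<and> \<rho> < x $ k / 2 \<or> \<rho> \<le> x $ k / 4 \<and> (\<integral>y. h y \<partial>lebesgue) = 0"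
  shows "atomic_bound k p W h"
proof -
  let ?B = "vol (ball x \<rho>)"
  have B: "0 < ?B" by (rule measure_lebesgue_ball_pos) (rule assms)
  show ?thesis
  proof (cases "0 < \<kappa>")
    case True
    \<comment> \<open>The bound holds only almost everywhere while an atom is bounded everywhere,
      hence the cut-off; it changes h on a null set.\<close>
    define a where "a z = (if \<bar>h z\<bar> \<le> \<kappa> then h z else 0) / (\<kappa> * ?B)" for z
    have am: "a \<in> borel_measurable lebesgue" unfolding a_def using h(1) by measurable
    have ae: "AE z in lebesgue. h z = \<kappa> * ?B * a z"
      using bd by eventually_elim (use True B in \<open>simp add: a_def\<close>)
    have "H1r_atom k p a x \<rho>"
    proof (rule H1r_atomI_bounded[OF assms(1,2) am])
      show "\<bar>a z\<bar> \<le> 1 / ?B" for z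
        unfolding a_def abs_divide abs_of_pos[OF mult_pos_pos[OF True B]] using True B
        by (simp add: divide_simps)
      have "(\<integral>y. h y \<partial>lebesgue) = (\<integral>y. \<kappa> * ?B * a y \<partial>lebesgue)"
        by (rule integral_cong_AE) (use ae h(1) am in auto)
      then show "x $ k / 4 < \<rho> \<and> \<rho> < x $ k / 2 \<or> \<rho> \<le> x $ k / 4 \<and> (\<integral>y. a y \<partial>lebesgue) = 0"
        using can True B by auto
    qed (use h(2) in \<open>auto simp: a_def\<close>)
    then have "atomic_bound k p (\<kappa> * ?B) h"
      by (rule atomic_bound_atom[OF assms(1) _ _ ae]) (use True B in auto)
    then show ?thesis using W(1) by (rule atomic_bound_mono)
  next
    case False
    obtain x r where z: "H1r_atom k p (\<lambda>_. 0) x r" using H1r_atom_zero[OF assms(1)] by blast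
    have hz: "AE z in lebesgue. h z = 0 * 0" using bd by eventually_elim (use False in auto)
    have "atomic_bound k p 0 h" by (rule atomic_bound_atom[OF assms(1) z _ hz]) simp
    then show ?thesis using W(2) by (rule atomic_bound_mono)
  qed
qed

text \<open>One generation of stopping below \<open>Q\<close>. The ratio v Q / vol Q is the size
  allowed for g on \<open>Q\<close>: up to the factor C it bounds the allowed size on the stopped
  cubes and |g| off them, while the total of v over the stopped cubes is at most half of v
  Q.\<close>

definition stopping_family ::
    "'a::euclidean_space set set \<Rightarrow> ('a set \<Rightarrow> real) \<Rightarrow> ('a \<Rightarrow> real) \<Rightarrow> real \<Rightarrow> 'a set \<Rightarrow> 'a set set \<Rightarrow> bool" where
  "stopping_family D v g C Q B \<longleftrightarrow> B \<subseteq> D \<and> disjoint B \<and>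
     (\<forall>P\<in>B. P \<subseteq> Q \<and> v P / vol P \<le> C * (v Q / vol Q)) \<and>
     (\<forall>E. finite E \<longrightarrow> E \<subseteq> B \<longrightarrow> sum v E \<le> v Q / 2) \<and>
     (AE z in lebesgue. z \<in> Q - \<Union>B \<longrightarrow> \<bar>g z\<bar> \<le> C * (v Q / vol Q))"

lemma stopping_familyD:
  assumes "stopping_family D v g C Q B"
  shows "B \<subseteq> D" "disjoint B" "\<And>P. P \<in> B \<Longrightarrow> P \<subseteq> Q"
    "\<And>P. P \<in> B \<Longrightarrow> v P / vol P \<le> C * (v Q / vol Q)"
    "\<And>E. finite E \<Longrightarrow> E \<subseteq> B \<Longrightarrow> sum v E \<le> v Q / 2"
    "AE z in lebesgue. z \<in> Q - \<Union>B \<longrightarrow> \<bar>g z\<bar> \<le> C * (v Q / vol Q)"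
  using assms unfolding stopping_family_def by blast+

text \<open>The decomposition for an arbitrary gauge v. The constant A may depend on g and is
  replaced by 2 * C in \<open>integral_le\<close>. The balls in the assumption \<open>ball\<close>
  carry the atoms; they are small relative to their height, so these atoms have to cancel.\<close>

locale stopping_tree =
  fixes k :: "'n::finite" and p :: ennreal and l A C C0 :: real
    and D :: "(real ^ 'n) set set" and v :: "(real ^ 'n) set \<Rightarrow> real" and g :: "real ^ 'n \<Rightarrow> real"
  assumes p: "1 < p" and l: "0 < l" and D: "D \<subseteq> dyadic_cubes l"
    and nonneg: "0 \<le> A" "0 \<le> C" "0 \<le> C0"
    and g: "integrable lebesgue g"
    and v0: "Q \<in> D \<Longrightarrow> 0 \<le> v Q"
    and a_priori: "Q \<in> D \<Longrightarrow> (LINT z:Q|lebesgue. \<bar>g z\<bar>) \<le> A * v Q"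
    and stop: "Q \<in> D \<Longrightarrow> \<exists>B. stopping_family D v g C Q B"
    and ball: "Q \<in> D \<Longrightarrow> \<exists>z \<rho>. 0 < \<rho> \<and> \<rho> \<le> z $ k / 4 \<and> Q \<subseteq> ball z \<rho> \<and>
        vol (ball z \<rho>) \<le> C0 * vol Q"
begin

lemma D_meas:
  assumes "Q \<in> D"
  shows "Q \<in> lmeasurable" "Q \<in> sets lebesgue" "0 < vol Q"
  using dyadic_cubes_measure[OF l, of Q] D assms by (auto simp: fmeasurable_def)

lemma D_countable: "F \<subseteq> D \<Longrightarrow> countable F"
  using countable_dyadic_cubes[OF l] D by blast

lemma ind_int:
  assumes "Q \<in> D"
  shows "integrable lebesgue (\<lambda>z. indicator Q z * g z)" "integrable lebesgue (\<lambda>z. indicator Q z * \<bar>g z\<bar>)"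
    "integrable lebesgue (\<lambda>z. indicator Q z * (c::real))"
  using integrable_mult_indicator[OF D_meas(2)[OF assms] g]
    integrable_mult_indicator[OF D_meas(2)[OF assms] integrable_abs[OF g]] D_meas[OF assms]
  by (auto simp: fmeasurable_def intro!: integrable_mult_left integrable_real_indicator)

text \<open>Off the stopped cubes |g| contributes at most C * v Q; on them the induction hypothesis
  meets a total gauge of at most v Q / 2. The new constant is C + (2 * C + A / 2 ^ N) / 2.\<close>

lemma integral_le_iter: "Q \<in> D \<Longrightarrow> (LINT z:Q|lebesgue. \<bar>g z\<bar>) \<le> (2 * C + A / 2 ^ N) * v Q"
proof (induction N arbitrary: Q)
  case 0
  have "A * v Q \<le> (2 * C + A) * v Q" using nonneg v0[OF 0] by (intro mult_right_mono) auto
  then show ?case using a_priori[OF 0] by simp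
next
  case (Suc N)
  obtain B where "stopping_family D v g C Q B" using stop[OF Suc.prems] by blast
  note B = stopping_familyD[OF this]
  let ?f = "\<lambda>P z. indicator P z * \<bar>g z\<bar>" and ?M = "2 * C + A / 2 ^ N"
  have M0: "0 \<le> ?M" using nonneg by simp
  have le: "(\<Sum>P\<in>E. \<integral>z. \<bar>?f P z\<bar> \<partial>lebesgue) \<le> ?M * (v Q / 2)" if E: "finite E" "E \<subseteq> B" for E
  proof -
    have "(\<Sum>P\<in>E. \<integral>z. \<bar>?f P z\<bar> \<partial>lebesgue) \<le> (\<Sum>P\<in>E. ?M * v P)"
      using Suc.IH E B(1) by (intro sum_mono) (auto simp: set_lebesgue_integral_def abs_mult)
    also have "\<dots> = ?M * sum v E" by (simp add: sum_distrib_left)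
    also have "\<dots> \<le> ?M * (v Q / 2)" by (intro mult_left_mono B(5) E M0)
    finally show ?thesis .
  qed
  note ps = piece_sum_integral[of B lebesgue ?f "?M * (v Q / 2)", OF D_countable[OF B(1)] B(2) _ _ le]
  have int: "integrable lebesgue (piece_sum B ?f)"
    and ile: "(\<integral>z. \<bar>piece_sum B ?f z\<bar> \<partial>lebesgue) \<le> ?M * (v Q / 2)"
    using ps(1,2) ind_int(2) B(1) by auto
  let ?c = "C * (v Q / vol Q)"
  have c0: "0 \<le> ?c" using nonneg v0[OF Suc.prems] by simp
  have "(LINT z:Q|lebesgue. \<bar>g z\<bar>) \<le> (\<integral>z. indicator Q z * ?c + \<bar>piece_sum B ?f z\<bar> \<partial>lebesgue)"
    unfolding set_lebesgue_integral_def
  proof (rule integral_mono_AE)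
    show "AE z in lebesgue. indicator Q z *\<^sub>R \<bar>g z\<bar> \<le> indicator Q z * ?c + \<bar>piece_sum B ?f z\<bar>"
      using B(6)
    proof eventually_elim
      case (elim z)
      show ?case
      proof (cases "z \<in> \<Union>B")
        case True
        then obtain P where P: "P \<in> B" "z \<in> P" by blast
        then show ?thesis using piece_sum_in[OF B(2) P, of ?f] c0 by (auto simp: indicator_def)
      next
        case False
        then show ?thesis using elim c0 by (auto simp: indicator_def)
      qed
    qed
  qed (use ind_int[OF Suc.prems] int in auto)
  also have "\<dots> = vol Q * ?c + (\<integral>z. \<bar>piece_sum B ?f z\<bar> \<partial>lebesgue)"
    using int D_meas[OF Suc.prems]
    by (subst Bochner_Integration.integral_add[OF ind_int(3)[OF Suc.prems]]) auto
  also have "\<dots> \<le> C * v Q + ?M * (v Q / 2)"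
    using ile D_meas[OF Suc.prems] by simp
  also have "\<dots> = (2 * C + A / 2 ^ Suc N) * v Q" by (simp add: field_simps)
  finally show ?case .
qed

lemma integral_le:
  assumes "Q \<in> D"
  shows "(LINT z:Q|lebesgue. \<bar>g z\<bar>) \<le> 2 * C * v Q"
proof (rule LIMSEQ_le_const)
  have "(\<lambda>N. (2 * C + A * (1 / 2) ^ N) * v Q) \<longlonglongrightarrow> (2 * C + A * 0) * v Q"
    by (intro tendsto_intros LIMSEQ_power_zero) auto
  then show "(\<lambda>N. (2 * C + A / 2 ^ N) * v Q) \<longlonglongrightarrow> 2 * C * v Q"
    by (simp add: power_divide)
qed (use integral_le_iter[OF assms] in blast)

lemma avg_le:
  assumes "Q \<in> D"
  shows "\<bar>avg g Q\<bar> \<le> 2 * C * (v Q / vol Q)"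
proof -
  have "\<bar>LINT z:Q|lebesgue. g z\<bar> \<le> (LINT z:Q|lebesgue. \<bar>g z\<bar>)"
    by (rule abs_set_integral_le)
  also have "\<dots> \<le> 2 * C * v Q" by (rule integral_le[OF assms])
  finally show ?thesis using D_meas(3)[OF assms] by (simp add: avg_def divide_right_mono)
qed

definition osc :: "(real ^ 'n) set \<Rightarrow> real ^ 'n \<Rightarrow> real" where
  "osc Q z = indicator Q z * (g z - avg g Q)"

lemma osc_facts:
  assumes "Q \<in> D"
  shows "integrable lebesgue (osc Q)" "(\<integral>z. osc Q z \<partial>lebesgue) = 0"
    "(\<integral>z. \<bar>osc Q z\<bar> \<partial>lebesgue) \<le> 2 * (LINT z:Q|lebesgue. \<bar>g z\<bar>)" "\<And>z. z \<notin> Q \<Longrightarrow> osc Q z = 0"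
proof -
  have eq: "osc Q = (\<lambda>z. indicator Q z * g z - indicator Q z * avg g Q)"
    by (auto simp: osc_def algebra_simps)
  show int: "integrable lebesgue (osc Q)" unfolding eq using ind_int[OF assms] by auto
  have m: "vol Q * avg g Q = (LINT z:Q|lebesgue. g z)"
    using D_meas[OF assms] by (simp add: avg_def)
  show "(\<integral>z. osc Q z \<partial>lebesgue) = 0"
    unfolding eq Bochner_Integration.integral_diff[OF ind_int(1)[OF assms] ind_int(3)[OF assms]]
    using m D_meas[OF assms] by (simp add: set_lebesgue_integral_def)
  have "(\<integral>z. \<bar>osc Q z\<bar> \<partial>lebesgue) \<le> (\<integral>z. indicator Q z * \<bar>g z\<bar> + indicator Q z * \<bar>avg g Q\<bar> \<partial>lebesgue)"
  proof (rule integral_mono)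
    show "\<bar>osc Q z\<bar> \<le> indicator Q z * \<bar>g z\<bar> + indicator Q z * \<bar>avg g Q\<bar>" for z
      by (auto simp: osc_def indicator_def abs_triangle_ineq4)
  qed (use int ind_int[OF assms] in auto)
  also have "\<dots> = (LINT z:Q|lebesgue. \<bar>g z\<bar>) + vol Q * \<bar>avg g Q\<bar>"
    unfolding Bochner_Integration.integral_add[OF ind_int(2)[OF assms] ind_int(3)[OF assms]]
    using D_meas[OF assms] by (simp add: set_lebesgue_integral_def)
  also have "vol Q * \<bar>avg g Q\<bar> = \<bar>LINT z:Q|lebesgue. g z\<bar>"
    using m[symmetric] D_meas(3)[OF assms] by (simp add: abs_mult)
  also have "\<dots> \<le> (LINT z:Q|lebesgue. \<bar>g z\<bar>)"
    by (rule abs_set_integral_le)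
  finally show "(\<integral>z. \<bar>osc Q z\<bar> \<partial>lebesgue) \<le> 2 * (LINT z:Q|lebesgue. \<bar>g z\<bar>)" by simp
  show "\<And>z. z \<notin> Q \<Longrightarrow> osc Q z = 0" by (simp add: osc_def)
qed

lemma osc_sum_facts:
  assumes F: "F \<subseteq> D" "disjoint F" and t: "\<And>E. finite E \<Longrightarrow> E \<subseteq> F \<Longrightarrow> sum v E \<le> t"
  shows "integrable lebesgue (piece_sum F osc)" "(\<integral>z. \<bar>piece_sum F osc z\<bar> \<partial>lebesgue) \<le> 4 * C * t"
    "(\<integral>z. piece_sum F osc z \<partial>lebesgue) = 0"
proof -
  have le: "(\<Sum>P\<in>E. \<integral>z. \<bar>osc P z\<bar> \<partial>lebesgue) \<le> 4 * C * t" if E: "finite E" "E \<subseteq> F" for E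
  proof -
    have "(\<integral>z. \<bar>osc P z\<bar> \<partial>lebesgue) \<le> 4 * C * v P" if "P \<in> E" for P
      using osc_facts(3)[of P] integral_le[of P] that E F by auto
    then have "(\<Sum>P\<in>E. \<integral>z. \<bar>osc P z\<bar> \<partial>lebesgue) \<le> (\<Sum>P\<in>E. 4 * C * v P)"
      by (rule sum_mono)
    also have "\<dots> = 4 * C * sum v E" by (simp add: sum_distrib_left)
    also have "\<dots> \<le> 4 * C * t" using nonneg by (intro mult_left_mono t E) auto
    finally show ?thesis .
  qed
  note ps = piece_sum_integral[OF D_countable[OF F(1)] F(2) _ _ le]
  show "integrable lebesgue (piece_sum F osc)"
    by (rule ps(1)) (use osc_facts F(1) in auto)
  show "(\<integral>z. \<bar>piece_sum F osc z\<bar> \<partial>lebesgue) \<le> 4 * C * t"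
    by (rule ps(2)) (use osc_facts F(1) in auto)
  show "(\<integral>z. piece_sum F osc z \<partial>lebesgue) = 0"
    by (rule ps(3)) (use osc_facts F(1) in auto)
qed

text \<open>Dominates both pointwise bounds in \<open>step_atom\<close>: C + 2 * C off the stopped
  cubes and 2 * C * C + 2 * C on them.\<close>

definition C3 :: real where "C3 = 3 * C + 2 * C * C"

text \<open>After subtraction of the oscillations of the stopped cubes, what is left is a difference
  of two averages of g on each of them and g minus its average elsewhere. All of it has size about v
  Q / vol Q, and the total integral is 0, so one cancelling atom suffices.\<close>

lemma step_atom:
  assumes Q: "Q \<in> D" and fam: "stopping_family D v g C Q B"
  shows "atomic_bound k p (C0 * C3 * v Q) (\<lambda>z. osc Q z - piece_sum B osc z)"
proof -
  note B = stopping_familyD[OF fam]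
  define \<kappa> where "\<kappa> = v Q / vol Q"
  have \<kappa>0: "0 \<le> \<kappa>" using v0[OF Q] by (simp add: \<kappa>_def)
  obtain x \<rho> where x: "0 < \<rho>" "\<rho> \<le> x $ k / 4" "Q \<subseteq> ball x \<rho>"
    "vol (ball x \<rho>) \<le> C0 * vol Q" using ball[OF Q] by blast
  note os = osc_sum_facts[OF B(1,2,5)]
  have int: "integrable lebesgue (\<lambda>z. osc Q z - piece_sum B osc z)" using os(1) osc_facts(1)[OF Q] by auto
  have C3: "0 \<le> C3" "3 * C \<le> C3" "2 * C * C + 2 * C \<le> C3" using nonneg by (auto simp: C3_def)
  show ?thesis
  proof (rule atomic_bound_bounded[OF p x(1)])
    show "(\<lambda>z. osc Q z - piece_sum B osc z) \<in> borel_measurable lebesgue" using int by auto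
    show "osc Q z - piece_sum B osc z = 0" if "z \<notin> ball x \<rho>" for z
    proof -
      have "z \<notin> Q" using that x by blast
      moreover have "z \<notin> \<Union>B" using \<open>z \<notin> Q\<close> B(3) by blast
      ultimately show ?thesis using osc_facts(4)[OF Q] by (simp add: piece_sum_notin)
    qed
    show "AE z in lebesgue. \<bar>osc Q z - piece_sum B osc z\<bar> \<le> C3 * \<kappa>"
      using B(6)
    proof eventually_elim
      case (elim z)
      have mQ: "\<bar>avg g Q\<bar> \<le> 2 * C * \<kappa>" using avg_le[OF Q] by (simp add: \<kappa>_def)
      consider P where "P \<in> B" "z \<in> P" | "z \<in> Q - \<Union>B" | "z \<notin> Q" "z \<notin> \<Union>B" using B(3) by blast
      then show ?case
      proof cases
        case 1
        then have "osc Q z - piece_sum B osc z = avg g P - avg g Q"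
          using piece_sum_in[OF B(2) 1, of osc] B(3)[OF 1(1)] by (auto simp: osc_def indicator_def)
        also have "\<bar>\<dots>\<bar> \<le> \<bar>avg g P\<bar> + \<bar>avg g Q\<bar>" by linarith
        also have "\<bar>avg g P\<bar> \<le> 2 * C * (v P / vol P)" using avg_le[of P] 1 B(1) by blast
        also have "\<dots> \<le> 2 * C * (C * \<kappa>)"
          using B(4)[OF 1(1)] nonneg by (intro mult_left_mono) (auto simp: \<kappa>_def)
        finally have "\<bar>osc Q z - piece_sum B osc z\<bar> \<le> (2 * C * C + 2 * C) * \<kappa>"
          using mQ by (simp add: algebra_simps)
        also have "\<dots> \<le> C3 * \<kappa>" by (intro mult_right_mono C3 \<kappa>0)
        finally show ?thesis .
      next
        case 2
        then have "\<bar>osc Q z - piece_sum B osc z\<bar> = \<bar>g z - avg g Q\<bar>"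
          using piece_sum_notin[of z B osc] by (auto simp: osc_def)
        also have "\<dots> \<le> \<bar>g z\<bar> + \<bar>avg g Q\<bar>" by linarith
        also have "\<dots> \<le> 3 * C * \<kappa>" using elim 2 mQ by (auto simp: \<kappa>_def)
        also have "\<dots> \<le> C3 * \<kappa>" by (intro mult_right_mono C3 \<kappa>0)
        finally show ?thesis .
      next
        case 3
        then show ?thesis using piece_sum_notin[of z B osc] osc_facts(4)[OF Q] C3 \<kappa>0 by simp
      qed
    qed
    have "C3 * \<kappa> * vol (ball x \<rho>) \<le> C3 * \<kappa> * (C0 * vol Q)"
      by (intro mult_left_mono x mult_nonneg_nonneg C3 \<kappa>0)
    also have "\<dots> = C0 * C3 * v Q" using D_meas[OF Q] by (simp add: \<kappa>_def)
    finally show "C3 * \<kappa> * vol (ball x \<rho>) \<le> C0 * C3 * v Q" .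
    show "0 \<le> C0 * C3 * v Q" using nonneg C3 v0[OF Q] by simp
    have "(\<integral>y. osc Q y - piece_sum B osc y \<partial>lebesgue) = 0"
      using os osc_facts[OF Q] by simp
    then show "x $ k / 4 < \<rho> \<and> \<rho> < x $ k / 2 \<or> \<rho> \<le> x $ k / 4 \<and>
      (\<integral>y. osc Q y - piece_sum B osc y \<partial>lebesgue) = 0" using x by blast
  qed
qed

text \<open>The remainder of each step is again a sum of oscillations, over the cubes stopped below
  the members of the previous family, with half the gauge. The predicate \<open>X\<close> records
  this form, so that \<open>atomic_bound_iterate\<close> applies.\<close>

theorem osc_sum_atomic_bound:
  assumes "F \<subseteq> D" "disjoint F" and "\<And>E. finite E \<Longrightarrow> E \<subseteq> F \<Longrightarrow> sum v E \<le> t"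
  shows "atomic_bound k p (2 * (C0 * C3) * t) (piece_sum F osc)"
proof -
  define X where "X = (\<lambda>R t. \<exists>F\<subseteq>D. disjoint F \<and> (\<forall>E. finite E \<longrightarrow> E \<subseteq> F \<longrightarrow> sum v E \<le> t) \<and> R = piece_sum F osc)"
  have C3: "0 \<le> C3" using nonneg by (auto simp: C3_def)
  show ?thesis
  proof (rule atomic_bound_iterate[OF p, where X = X and A = "4 * C"])
    show "0 \<le> C0 * C3" using nonneg C3 by simp
    show "X (piece_sum F osc) t" unfolding X_def using assms by blast
    fix R t assume "X R t"
    then obtain F where F: "F \<subseteq> D" "disjoint F" and t: "\<And>E. finite E \<Longrightarrow> E \<subseteq> F \<Longrightarrow> sum v E \<le> t"
      and R: "R = piece_sum F osc" unfolding X_def by blast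
    show "0 \<le> t \<and> integrable lebesgue R \<and> (\<integral>z. \<bar>R z\<bar> \<partial>lebesgue) \<le> 4 * C * t"
      using osc_sum_facts[OF F t] t[of "{}"] R by auto
    have "\<forall>Q\<in>D. \<exists>B. stopping_family D v g C Q B" using stop by blast
    from bchoice[OF this] obtain B where B: "\<forall>Q\<in>D. stopping_family D v g C Q (B Q)" by (rule exE)
    have fam: "stopping_family D v g C Q (B Q)" if "Q \<in> F" for Q using B F(1) that by blast
    note B1 = stopping_familyD(1,2)[OF fam] and B2 = stopping_familyD(3)[OF fam] and B3 = stopping_familyD(5)[OF fam]
    define F' where "F' = (\<Union>Q\<in>F. B Q)"
    have F': "F' \<subseteq> D" using B1 by (auto simp: F'_def)
    have disj: "Q = Q'" if "Q \<in> F" "Q' \<in> F" "z \<in> Q" "z \<in> Q'" for Q Q' z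
      using F(2) that by (auto simp: disjoint_def)
    have F'2: "disjoint F'"
      unfolding disjoint_def
    proof (intro ballI impI, rule ccontr)
      fix P P' assume P: "P \<in> F'" "P' \<in> F'" "P \<noteq> P'" "P \<inter> P' \<noteq> {}"
      then obtain Q Q' z where Q: "Q \<in> F" "P \<in> B Q" "Q' \<in> F" "P' \<in> B Q'" "z \<in> P" "z \<in> P'"
        by (auto simp: F'_def)
      then have "Q = Q'" using disj[of Q Q' z] B2 by blast
      then show False using Q B1(2)[of Q] P(3) by (auto simp: disjoint_def)
    qed
    have t': "sum v E \<le> t / 2" if E: "finite E" "E \<subseteq> F'" for E
    proof -
      \<comment> \<open>Each stopped cube is assigned a member of \<open>F\<close> below which it
        was stopped; grouping the sum by that member uses the halving once per group.\<close>
      have "\<forall>P. \<exists>Q. P \<in> F' \<longrightarrow> Q \<in> F \<and> P \<in> B Q" by (auto simp: F'_def)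
      from choice[OF this] obtain \<pi> where \<pi>: "\<And>P. P \<in> F' \<Longrightarrow> \<pi> P \<in> F \<and> P \<in> B (\<pi> P)" by blast
      have "sum v E = (\<Sum>Q\<in>\<pi> ` E. sum v {P \<in> E. \<pi> P = Q})" by (rule sum.image_gen[OF E(1)])
      also have "\<dots> \<le> (\<Sum>Q\<in>\<pi> ` E. v Q / 2)"
      proof (rule sum_mono)
        fix Q assume "Q \<in> \<pi> ` E"
        then have "Q \<in> F" using E \<pi> by blast
        moreover have "{P \<in> E. \<pi> P = Q} \<subseteq> B Q" using E \<pi> by blast
        ultimately show "sum v {P \<in> E. \<pi> P = Q} \<le> v Q / 2" using E(1) by (intro B3) auto
      qed
      also have "\<dots> = sum v (\<pi> ` E) / 2" by (simp add: sum_divide_distrib)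
      also have "\<dots> \<le> t / 2" using t[of "\<pi> ` E"] E \<pi> by auto
      finally show ?thesis .
    qed
    have "atomic_bound k p (C0 * C3 * t) (\<lambda>z. R z - piece_sum F' osc z)"
    proof (rule atomic_bound_disjoint_family[OF p D_countable[OF F(1)] F(2),
          where W = "\<lambda>Q. C0 * C3 * v Q" and g = "\<lambda>Q z. osc Q z - piece_sum (B Q) osc z"])
      fix Q assume Q: "Q \<in> F"
      then have "Q \<in> D" using F by blast
      show "atomic_bound k p (C0 * C3 * v Q) (\<lambda>z. osc Q z - piece_sum (B Q) osc z)"
        using \<open>Q \<in> D\<close> fam[OF Q] by (rule step_atom)
      show "0 \<le> C0 * C3 * v Q" using nonneg C3 v0[OF \<open>Q \<in> D\<close>] by simp
      show "osc Q z - piece_sum (B Q) osc z = 0" if "z \<notin> Q" for z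
      proof -
        have "z \<notin> \<Union>(B Q)" using that B2[OF Q] by blast
        then show ?thesis using osc_facts(4)[OF \<open>Q \<in> D\<close> that] by (simp add: piece_sum_notin)
      qed
      show "R z - piece_sum F' osc z = osc Q z - piece_sum (B Q) osc z" if z: "z \<in> Q" for z
      proof -
        have "{P. P \<in> F' \<and> z \<in> P} = {P. P \<in> B Q \<and> z \<in> P}"
          using disj[OF _ Q _ z] B2 Q by (fastforce simp: F'_def)
        then show ?thesis using piece_sum_in[OF F(2) Q z, of osc] by (simp add: R piece_sum_def[of F'] piece_sum_def[of "B Q"])
      qed
    next
      fix E assume E: "finite E" "E \<subseteq> F"
      have "(\<Sum>Q\<in>E. C0 * C3 * v Q) = C0 * C3 * sum v E" by (simp add: sum_distrib_left)
      also have "\<dots> \<le> C0 * C3 * t" using nonneg C3 by (intro mult_left_mono t E) auto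
      finally show "(\<Sum>Q\<in>E. C0 * C3 * v Q) \<le> C0 * C3 * t" .
    next
      fix z assume z: "z \<notin> \<Union>F"
      then have "z \<notin> \<Union>F'" using B2 by (fastforce simp: F'_def)
      then show "R z - piece_sum F' osc z = 0" using z by (simp add: R piece_sum_notin)
    qed
    then show "\<exists>R' t'. X R' t' \<and> t' \<le> t / 2 \<and> atomic_bound k p (C0 * C3 * t) (\<lambda>z. R z - R' z)"
      using F' F'2 t' unfolding X_def by blast
  qed
qed

end

section \<open>Products of atoms with functions of logarithmic mean oscillation\<close>

text \<open>All three follow from vol E * |f_E - c| being at most the integral of |f - c| over E,
  which grows with the set; replacing c by the mean over E costs the factor 2.\<close>

lemma avg_diff_le:
  fixes f :: "real ^ 'n::finite \<Rightarrow> real"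
  assumes E: "E \<in> lmeasurable" "E \<subseteq> F" "0 < vol E"
    and F: "F \<in> lmeasurable" "set_integrable lebesgue F f"
  shows "\<bar>avg f E - c\<bar> \<le> (LINT z:F|lebesgue. \<bar>f z - c\<bar>) / vol E"
    and "(LINT z:E|lebesgue. \<bar>f z - avg f E\<bar>) \<le> 2 * (LINT z:F|lebesgue. \<bar>f z - c\<bar>)"
    and "(LINT z:E|lebesgue. \<bar>f z - c\<bar>) \<le> (LINT z:F|lebesgue. \<bar>f z - c\<bar>)"
proof -
  have Es: "E \<in> sets lebesgue" using E(1) by (auto simp: fmeasurable_def)
  have fE: "set_integrable lebesgue E f" by (rule set_integrable_subset[OF F(2) Es E(2)])
  have cE: "set_integrable lebesgue E (\<lambda>_. d)" for d :: real
    using E(1) by (auto simp: set_integrable_def fmeasurable_def)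
  have cF: "set_integrable lebesgue F (\<lambda>_. d)" for d :: real
    using F(1) by (auto simp: set_integrable_def fmeasurable_def)
  have aE: "set_integrable lebesgue E (\<lambda>z. \<bar>f z - d\<bar>)" for d
    by (intro set_integrable_abs set_integral_diff(1) fE cE)
  have aF: "set_integrable lebesgue F (\<lambda>z. \<bar>f z - d\<bar>)" for d
    by (intro set_integrable_abs set_integral_diff(1) F(2) cF)
  show EF: "(LINT z:E|lebesgue. \<bar>f z - c\<bar>) \<le> (LINT z:F|lebesgue. \<bar>f z - c\<bar>)"
    unfolding set_lebesgue_integral_def
  proof (rule integral_mono)
    show "indicator E z *\<^sub>R \<bar>f z - c\<bar> \<le> indicator F z *\<^sub>R \<bar>f z - c\<bar>" for z
      using E(2) by (auto simp: indicator_def)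
  qed (use aE aF in \<open>auto simp: set_integrable_def\<close>)
  have "(LINT z:E|lebesgue. f z - c) = (LINT z:E|lebesgue. f z) - (LINT z:E|lebesgue. c)"
    by (rule set_integral_diff(2)[OF fE cE])
  also have "\<dots> = vol E * (avg f E - c)"
    using E(3) Es by (simp add: avg_def set_lebesgue_integral_def algebra_simps)
  finally have "vol E * \<bar>avg f E - c\<bar> = \<bar>LINT z:E|lebesgue. f z - c\<bar>"
    using E(3) by (simp add: abs_mult)
  also have "\<dots> \<le> (LINT z:E|lebesgue. \<bar>f z - c\<bar>)"
    by (rule abs_set_integral_le)
  finally have 1: "vol E * \<bar>avg f E - c\<bar> \<le> (LINT z:E|lebesgue. \<bar>f z - c\<bar>)" .
  with EF show "\<bar>avg f E - c\<bar> \<le> (LINT z:F|lebesgue. \<bar>f z - c\<bar>) / vol E"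
    using E(3) by (simp add: pos_le_divide_eq mult.commute)
  have "(LINT z:E|lebesgue. \<bar>f z - avg f E\<bar>) \<le> (LINT z:E|lebesgue. \<bar>f z - c\<bar> + \<bar>avg f E - c\<bar>)"
    unfolding set_lebesgue_integral_def
  proof (rule integral_mono)
    show "integrable lebesgue (\<lambda>z. indicator E z *\<^sub>R \<bar>f z - avg f E\<bar>)"
      using aE by (simp add: set_integrable_def)
    show "integrable lebesgue (\<lambda>z. indicator E z *\<^sub>R (\<bar>f z - c\<bar> + \<bar>avg f E - c\<bar>))"
      using set_integral_add(1)[OF aE cE] by (simp add: set_integrable_def)
    show "indicator E z *\<^sub>R \<bar>f z - avg f E\<bar> \<le> indicator E z *\<^sub>R (\<bar>f z - c\<bar> + \<bar>avg f E - c\<bar>)" for z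
      by (auto simp: indicator_def)
  qed
  also have "\<dots> = (LINT z:E|lebesgue. \<bar>f z - c\<bar>) + vol E * \<bar>avg f E - c\<bar>"
    using Es by (subst set_integral_add(2)[OF aE cE]) (simp add: set_lebesgue_integral_def)
  finally show "(LINT z:E|lebesgue. \<bar>f z - avg f E\<bar>) \<le> 2 * (LINT z:F|lebesgue. \<bar>f z - c\<bar>)"
    using 1 EF by linarith
qed

lemma sum_set_integral_disjoint_le:
  fixes h :: "'a \<Rightarrow> real"
  assumes E: "finite E" "disjoint E" "\<And>P. P \<in> E \<Longrightarrow> P \<subseteq> F" "E \<subseteq> sets M"
    and h: "set_integrable M F h" "\<And>z. z \<in> F \<Longrightarrow> 0 \<le> h z"
  shows "(\<Sum>P\<in>E. LINT z:P|M. h z) \<le> (LINT z:F|M. h z)"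
proof -
  have iP: "integrable M (\<lambda>z. indicator P z *\<^sub>R h z)" if "P \<in> E" for P
    using set_integrable_subset[OF h(1), of P] E that by (auto simp: set_integrable_def)
  have "(\<Sum>P\<in>E. LINT z:P|M. h z) = (\<integral>z. (\<Sum>P\<in>E. indicator P z *\<^sub>R h z) \<partial>M)"
    unfolding set_lebesgue_integral_def by (rule Bochner_Integration.integral_sum[symmetric]) (rule iP)
  also have "\<dots> \<le> (\<integral>z. indicator F z *\<^sub>R h z \<partial>M)"
  proof (rule integral_mono)
    show "integrable M (\<lambda>z. \<Sum>P\<in>E. indicator P z *\<^sub>R h z)" using iP by auto
    show "integrable M (\<lambda>z. indicator F z *\<^sub>R h z)" using h(1) by (simp add: set_integrable_def)
    fix z
    show "(\<Sum>P\<in>E. indicator P z *\<^sub>R h z) \<le> indicator F z *\<^sub>R h z"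
    proof (cases "z \<in> \<Union>E")
      case True
      then obtain Q where Q: "Q \<in> E" "z \<in> Q" by blast
      have "(\<Sum>P\<in>E. indicator P z *\<^sub>R h z) = (\<Sum>P\<in>{Q}. indicator P z *\<^sub>R h z)"
        by (rule sum.mono_neutral_right) (use E(1,2) Q in \<open>auto simp: disjoint_def indicator_def\<close>)
      then show ?thesis using Q E(3)[OF Q(1)] by (auto simp: indicator_def)
    next
      case False
      then have "(\<Sum>P\<in>E. indicator P z *\<^sub>R h z) = 0" by (intro sum.neutral) (auto simp: indicator_def)
      then show ?thesis using h(2)[of z] by (auto simp: indicator_def)
    qed
  qed
  finally show ?thesis by (simp add: set_lebesgue_integral_def)
qed

text \<open>Below the threshold the constant term suffices; above it T powr (1 / s - 1) \<le>
  \<delta>. This linear substitute for Hoelder's inequality allows roots of averages to be summed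
  over cubes by adding integrals and volumes.\<close>

lemma root_le_linear:
  fixes s \<delta> T :: real
  assumes "1 < s" "0 < \<delta>" "0 \<le> T"
  shows "T powr (1 / s) \<le> \<delta> * T + \<delta> powr (- 1 / (s - 1))"
proof (cases "T powr (1 / s) \<le> \<delta> powr (- 1 / (s - 1))")
  case True
  then show ?thesis using assms by (simp add: add_increasing)
next
  case False
  then have T: "0 < T" using assms by (cases "T = 0") auto
  have "\<delta> powr (- 1 / (s - 1)) < T powr (1 / s)" using False by simp
  then have "(T powr (1 / s)) powr (1 - s) < (\<delta> powr (- 1 / (s - 1))) powr (1 - s)"
    using assms by (intro powr_less_mono2_neg) auto
  also have "(\<delta> powr (- 1 / (s - 1))) powr (1 - s) = \<delta> powr 1"
    unfolding powr_powr using assms by (intro arg_cong[where f = "\<lambda>e. \<delta> powr e"]) (simp add: field_simps)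
  finally have le: "(T powr (1 / s)) powr (1 - s) \<le> \<delta>" using assms by simp
  have "1 / s * (1 - s) + 1 = 1 / s" using assms by (simp add: field_simps)
  then have "T powr (1 / s) = (T powr (1 / s)) powr (1 - s) * T powr 1"
    unfolding powr_powr powr_add[symmetric] by simp
  also have "\<dots> \<le> \<delta> * T" using mult_right_mono[OF le, of T] T by simp
  finally show ?thesis by (simp add: add_increasing2)
qed

lemma measure_ball_scale:
  fixes x :: "real ^ 'n::finite"
  assumes "0 < \<rho>" "0 \<le> c"
  shows "vol (ball x (c * \<rho>)) = c ^ CARD('n) * vol (ball x \<rho>)"
proof -
  have "0 \<le> c * \<rho>" "0 \<le> \<rho>" using assms by auto
  then show ?thesis
    using measure_lebesgue_ball[of "c * \<rho>" x] measure_lebesgue_ball[of \<rho> x]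
    by (simp only: power_mult_distrib mult.assoc)
qed

text \<open>
  Doubling the ball until it reaches the scale where no cancellation is required writes a
  function without mean zero as a sum of atoms, one for each doubling.
\<close>

lemma atomic_bound_noncancelling:
  fixes u :: "real ^ 'n::finite \<Rightarrow> real"
  assumes "1 < p" "0 < \<rho>" "\<rho> \<le> z $ k / 4" "z $ k / 8 < 2 ^ J * \<rho>" "0 \<le> M"
    and "u \<in> borel_measurable lebesgue" "\<And>y. y \<notin> ball z \<rho> \<Longrightarrow> u y = 0"
    and "\<And>y. \<bar>u y\<bar> \<le> M / vol (ball z \<rho>)"
  shows "atomic_bound k p ((3 ^ CARD('n) + real J * (2 ^ CARD('n) + 1)) * M) u"
  using assms(2-)
proof (induction J arbitrary: \<rho> u)
  case (Suc J)
  let ?n = "CARD('n)"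
  have b: "0 < vol (ball z \<rho>)" by (rule measure_lebesgue_ball_pos) (rule Suc.prems)
  have cancel: "B * (X / B) = X" if "0 < B" for B X :: real using that by simp
  show ?case
  proof (cases "z $ k / 8 < 2 ^ J * \<rho>")
    case True
    have "atomic_bound k p ((3 ^ ?n + real J * (2 ^ ?n + 1)) * M) u"
      by (rule Suc.IH[of \<rho>]) (use Suc.prems True in auto)
    then show ?thesis by (rule atomic_bound_mono) (use \<open>0 \<le> M\<close> in \<open>auto intro!: mult_right_mono\<close>)
  next
    case False
    have "1 * \<rho> \<le> 2 ^ J * \<rho>" using Suc.prems by (intro mult_right_mono) auto
    then have \<rho>: "\<rho> \<le> z $ k / 8" using False by linarith
    have b2: "vol (ball z (2 * \<rho>)) = 2 ^ ?n * vol (ball z \<rho>)"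
      by (rule measure_ball_scale) (use Suc.prems in auto)
    let ?b = "vol (ball z \<rho>)" and ?b2 = "vol (ball z (2 * \<rho>))"
    have b2pos: "0 < ?b2" by (rule measure_lebesgue_ball_pos) (use Suc.prems in simp)
    have iu: "integrable lebesgue u"
      by (rule integrable_bounded_support[OF Suc.prems(5) lmeasurable_ball[of z \<rho>], of "M / ?b"])
        (use Suc.prems(6,7) in auto)
    define I where "I = (\<integral>y. u y \<partial>lebesgue)"
    have I: "\<bar>I\<bar> \<le> M"
    proof -
      have "\<bar>I\<bar> \<le> (\<integral>y. \<bar>u y\<bar> \<partial>lebesgue)" unfolding I_def by (rule integral_abs_bound)
      also have "\<dots> \<le> (\<integral>y. indicator (ball z \<rho>) y * (M / ?b) \<partial>lebesgue)"
      proof (rule integral_mono)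
        show "integrable lebesgue (\<lambda>y. indicator (ball z \<rho>) y * (M / ?b))"
          by (rule integrable_indicator_mult[OF lmeasurable_ball])
        show "\<bar>u y\<bar> \<le> indicator (ball z \<rho>) y * (M / ?b)" for y
          using Suc.prems(6)[of y] Suc.prems(7)[of y] by (cases "y \<in> ball z \<rho>") simp_all
      qed (use iu in simp)
      also have "\<dots> = ?b * (M / ?b)" by simp
      also have "\<dots> = M" by (rule cancel[OF b])
      finally show ?thesis .
    qed
    \<comment> \<open>The integral of u is spread over the doubled ball. The difference cancels and
      costs 2 ^ n + 1 times M, while u' satisfies the same hypotheses with radius 2 * \<rho> and one
      doubling less to go.\<close>
    define u' where "u' y = indicator (ball z (2 * \<rho>)) y * (I / ?b2)" for y
    have iu': "integrable lebesgue u'"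
      unfolding u'_def by (rule integrable_indicator_mult[OF lmeasurable_ball])
    then have u'm: "u' \<in> borel_measurable lebesgue" by (rule borel_measurable_integrable)
    have "(\<integral>y. u' y \<partial>lebesgue) = ?b2 * (I / ?b2)" unfolding u'_def by simp
    also have "\<dots> = I" by (rule cancel[OF b2pos])
    finally have I': "(\<integral>y. u' y \<partial>lebesgue) = I" .
    have u'_le: "\<bar>u' y\<bar> \<le> M / ?b2" for y
    proof -
      have "\<bar>u' y\<bar> \<le> \<bar>I\<bar> / ?b2"
        unfolding u'_def abs_mult abs_divide abs_of_pos[OF b2pos]
        using divide_nonneg_pos[OF abs_ge_zero[of I] b2pos] by (auto simp: indicator_def)
      also have "\<dots> \<le> M / ?b2" using I b2pos by (intro divide_right_mono) auto
      finally show ?thesis .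
    qed
    have 1: "atomic_bound k p ((2 ^ ?n + 1) * M) (\<lambda>y. u y - u' y)"
    proof (rule atomic_bound_bounded[OF assms(1), of "2 * \<rho>"])
      have "\<bar>u y - u' y\<bar> \<le> M / ?b + M / ?b2" for y using Suc.prems(7)[of y] u'_le[of y] by linarith
      then show "AE y in lebesgue. \<bar>u y - u' y\<bar> \<le> M / ?b + M / ?b2" by simp
      have "(M / ?b + M / ?b2) * ?b2 = 2 ^ ?n * M + M"
      proof -
        have "(M / B + M / (X * B)) * (X * B) = X * M + M" if "0 < B" "0 < X" for B X :: real
          using that by (simp add: distrib_right)
        from this[OF b] show ?thesis unfolding b2 by simp
      qed
      then show "(M / ?b + M / ?b2) * ?b2 \<le> (2 ^ ?n + 1) * M" by (simp add: algebra_simps)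
      show "(\<lambda>y. u y - u' y) \<in> borel_measurable lebesgue" using Suc.prems(5) u'm by measurable
      show "u y - u' y = 0" if "y \<notin> ball z (2 * \<rho>)" for y
      proof -
        have "y \<notin> ball z \<rho>" using that Suc.prems(1) by simp
        then show ?thesis using that Suc.prems(6) by (simp add: u'_def)
      qed
      have "(\<integral>y. u y - u' y \<partial>lebesgue) = 0"
        using Bochner_Integration.integral_diff[OF iu iu'] I' by (simp add: I_def)
      then show "z $ k / 4 < 2 * \<rho> \<and> 2 * \<rho> < z $ k / 2 \<or>
          2 * \<rho> \<le> z $ k / 4 \<and> (\<integral>y. u y - u' y \<partial>lebesgue) = 0" using \<rho> by simp
    qed (use Suc.prems(1) \<open>0 \<le> M\<close> in auto)
    have 2: "atomic_bound k p ((3 ^ ?n + real J * (2 ^ ?n + 1)) * M) u'"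
    proof (rule Suc.IH[of "2 * \<rho>"])
      show "u' y = 0" if "y \<notin> ball z (2 * \<rho>)" for y using that by (simp add: u'_def)
    qed (use Suc.prems(1,3,4) \<rho> u'm u'_le in \<open>simp_all add: mult_ac\<close>)
    have "atomic_bound k p ((2 ^ ?n + 1) * M + (3 ^ ?n + real J * (2 ^ ?n + 1)) * M) (\<lambda>y. (u y - u' y) + u' y)"
      by (rule atomic_bound_add[OF assms(1) 1 2]) (use \<open>0 \<le> M\<close> in auto)
    then show ?thesis by (simp add: algebra_simps)
  qed
next
  case 0
  let ?n = "CARD('n)"
  have b: "0 < vol (ball z \<rho>)" by (rule measure_lebesgue_ball_pos) (rule 0)
  \<comment> \<open>Now \<rho> lies between 1/8 and 1/4 of the height. Enlarging to 3/8 reaches the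
    range where no cancellation is asked, and multiplies the radius by at most 3.\<close>
  define c where "c = (3 / 8 * z $ k) / \<rho>"
  have c: "0 \<le> c" "c \<le> 3" "c * \<rho> = 3 / 8 * z $ k" using 0 by (auto simp: c_def field_simps)
  have "atomic_bound k p (3 ^ ?n * M) u"
  proof (rule atomic_bound_bounded[OF assms(1), of "c * \<rho>"])
    show "0 < c * \<rho>" "z $ k / 4 < c * \<rho> \<and> c * \<rho> < z $ k / 2 \<or> c * \<rho> \<le> z $ k / 4 \<and> (\<integral>y. u y \<partial>lebesgue) = 0"
      using 0 unfolding c(3) by auto
    show "u y = 0" if "y \<notin> ball z (c * \<rho>)" for y
      using that 0(1,2,6) unfolding c(3) by auto
    show "AE y in lebesgue. \<bar>u y\<bar> \<le> M / vol (ball z \<rho>)" using 0(7) by simp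
    have "M / vol (ball z \<rho>) * vol (ball z (c * \<rho>)) = M * c ^ ?n"
    proof -
      have "M / B * (X * B) = M * X" if "0 < B" for B X :: real using that by simp
      from this[OF b] show ?thesis unfolding measure_ball_scale[OF 0(1) c(1)] .
    qed
    also have "\<dots> \<le> M * 3 ^ ?n" using c \<open>0 \<le> M\<close> by (intro mult_left_mono power_mono) auto
    finally show "M / vol (ball z \<rho>) * vol (ball z (c * \<rho>)) \<le> 3 ^ ?n * M"
      by (simp add: mult.commute)
  qed (use 0 in auto)
  then show ?case by simp
qed

lemma ln_exp_1_plus_ge_1: "0 \<le> X \<Longrightarrow> 1 \<le> ln (exp 1 + X :: real)"
  using ln_mono[of "exp 1" "exp 1 + X"] by simp

text \<open>From exp 1 + X \<le> (exp 1 + X / 2) ^ 2. Doubling the radius of a ball thus loses at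
  most half of the logarithm.\<close>

lemma ln_exp_1_plus_half:
  fixes X :: real
  assumes "0 \<le> X"
  shows "ln (exp 1 + X) / 2 \<le> ln (exp 1 + X / 2)"
proof -
  have e: "1 \<le> exp (1::real)" by simp
  have "exp 1 + X \<le> exp 1 * exp 1 + exp 1 * X" using e assms by (intro add_mono) (auto simp: mult_le_cancel_right1)
  also have "\<dots> \<le> (exp 1 + X / 2) * (exp 1 + X / 2)" using assms by (simp add: algebra_simps)
  finally have "ln (exp 1 + X) \<le> ln ((exp 1 + X / 2) * (exp 1 + X / 2))"
    using assms by (intro ln_mono) (auto simp: add_pos_nonneg)
  also have "\<dots> = 2 * ln (exp 1 + X / 2)"
    using assms by (subst ln_mult_pos) (auto simp: add_pos_nonneg)
  finally show ?thesis by simp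
qed

text \<open>With L the logarithm, ln 2 \<ge> 1/2 makes 2 ^ J at least exp (2 * L) = (exp 1 + X) ^ 2.
  Rounding up adds at most 1 \<le> L, whence the 5.\<close>

lemma two_power_ln_gt:
  fixes X :: real
  assumes "0 \<le> X" "J = nat \<lceil>4 * ln (exp 1 + X)\<rceil>"
  shows "2 * X < 2 ^ J" "real J \<le> 5 * ln (exp 1 + X)"
proof -
  define L where "L = ln (exp 1 + X)"
  have L: "1 \<le> L" using ln_exp_1_plus_ge_1[OF assms(1)] by (simp add: L_def)
  have e: "2 \<le> exp (1::real)" using exp_ge_add_one_self[of 1] by simp
  have J: "4 * L \<le> real J" "real J \<le> 4 * L + 1" using L by (auto simp: assms(2) L_def[symmetric])
  then show "real J \<le> 5 * ln (exp 1 + X)" using L by (simp add: L_def)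
  have "exp (2 * L) = (exp 1 + X) ^ 2"
    using assms(1) by (simp add: L_def exp_double add_pos_nonneg)
  moreover have "2 * X < (exp 1 + X) ^ 2"
  proof -
    have "2 * X \<le> exp 1 * X" using e assms(1) by (intro mult_right_mono) auto
    moreover have "(exp 1 + X) ^ 2 = exp 1 * exp 1 + X * X + exp 1 * X + exp 1 * X"
      by (simp add: power2_eq_square algebra_simps)
    moreover have "0 < exp (1::real) * exp 1" "0 \<le> X * X" "0 \<le> exp 1 * X" using assms(1) by simp_all
    ultimately show ?thesis by linarith
  qed
  moreover have "exp (2 * L) \<le> 2 powr real J"
  proof -
    have "exp (1 / 2) ^ 2 = exp (1::real)" by (simp flip: exp_double)
    moreover have "exp (1::real) \<le> 2 ^ 2" using exp_le by simp
    ultimately have "exp (1 / 2) \<le> (2::real)" using power2_le_imp_le[of "exp (1/2)" "2::real"] by simp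
    then have "ln 2 \<ge> (1 / 2 :: real)" using ln_mono[of "exp (1/2)" "2::real"] by simp
    then have "2 * L \<le> real J * ln 2"
      using J(1) L mult_mono[of "4 * L" "real J" "1/2" "ln 2"] by simp
    then show ?thesis by (simp add: powr_def)
  qed
  ultimately show "2 * X < 2 ^ J" by (simp add: powr_realpow)
qed

section \<open>The product of one atom with one function\<close>

text \<open>Here t is any positive bound for the logarithmic norm. The constants \<Lambda>,
  \<open>K\<close>, \<open>C0\<close> and \<open>V\<close> depend on n and q only, which makes the
  final bound uniform; \<open>l\<close> is such that two points of a cube of generation 0 are less
  than r / 8 apart.\<close>

locale atom_times_bmo =
  fixes k :: "'n::finite" and p q :: ennreal and f a :: "real ^ 'n \<Rightarrow> real" and x :: "real ^ 'n"
    and r t \<Lambda> K C0 V l :: real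
  assumes p: "1 < p" and q: "1 < q" and f: "f \<in> L1_loc k" and a: "H1r_atom k q a x r" and t: "0 < t"
    and bmo: "\<And>y \<rho>. is_ball k y \<rho> \<Longrightarrow> ennreal (ln (exp 1 + y $ k / \<rho>)) * MO f (hball k y \<rho>) \<le> ennreal t"
    and \<Lambda>: "\<Lambda> = 16 * 8 powr (1 / (fin_exponent q - 1))" and K: "K = 2 ^ CARD('n) * \<Lambda>"
    and V: "V = vol (ball (0 :: real ^ 'n) 1)" and C0: "C0 = CARD('n) ^ CARD('n) * V"
    and l: "l = r / (8 * CARD('n))"
begin

lemma r: "0 < r" "r < x $ k / 2" "hball k x r = ball x r"
  by (rule H1r_atom_radius[OF a])+

definition s where "s = fin_exponent q"
definition \<mu> where "\<mu> = t / ln (exp 1 + x $ k / r)"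
definition \<omega> where "\<omega> = 2 * C0 * \<mu>"
definition b where "b = vol (ball x r)"
definition \<kappa> where "\<kappa> = avg f (ball x r)"
text \<open>The added 1 keeps the averages of w over cubes at least 1, so that a root never exceeds
  the average itself and the gauge does not degenerate.\<close>

definition w where "w z = (b * \<bar>a z\<bar>) powr s + 1"
text \<open>The root divided by b stands for the size of |a| on \<open>Q\<close>, the bracket for
  that of |f - f_B|. The factor \<open>K\<close> in front of \<omega> absorbs the change of the
  average of f from a cube to one stopped below it, so the bracket at most doubles.\<close>

definition v where "v Q = vol Q * avg w Q powr (1 / s) * (K * \<omega> + \<bar>avg f Q - \<kappa>\<bar>) / b"
text \<open>The radius 9/8 * r leaves room for every cube of generation 0 that meets the ball of the
  atom.\<close>

definition D where "D = {Q \<in> dyadic_cubes l. Q \<subseteq> ball x (9 / 8 * r)}"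
definition g where "g = atom_product k f a x r"

lemma basic_pos: "1 < s" "1 \<le> ln (exp 1 + x $ k / r)" "0 < \<mu>" "0 < V" "0 < C0" "0 < \<omega>" "0 < b" "0 < l"
  "16 \<le> \<Lambda>" "\<Lambda> \<le> K" "1 \<le> K" "0 < K"
proof -
  show s: "1 < s" using fin_exponent_gt_1[OF q] by (simp add: s_def)
  show ln: "1 \<le> ln (exp 1 + x $ k / r)" by (rule ln_exp_1_plus_ge_1) (use r in auto)
  show \<mu>: "0 < \<mu>" using ln t by (simp add: \<mu>_def)
  show V0: "0 < V" unfolding V by (rule measure_lebesgue_ball_pos) simp
  then show C: "0 < C0" by (simp add: C0)
  then show "0 < \<omega>" using \<mu> by (simp add: \<omega>_def)
  show "0 < b" unfolding b_def by (rule measure_lebesgue_ball_pos) (rule r)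
  show "0 < l" using r by (simp add: l)
  have "8 powr 0 \<le> (8::real) powr (1 / (fin_exponent q - 1))"
    using s by (intro powr_mono) (auto simp: s_def)
  then show L: "16 \<le> \<Lambda>" by (simp add: \<Lambda>)
  have "1 * \<Lambda> \<le> K" unfolding K using L by (intro mult_right_mono) auto
  then show "\<Lambda> \<le> K" "1 \<le> K" "0 < K" using L by auto
qed

lemma b_eq: "b = r ^ CARD('n) * V"
  unfolding b_def V using measure_lebesgue_ball[of r x] r by simp

lemma f_int: "set_integrable lebesgue (ball x (2 * r)) f"
  by (rule L1_loc_ball_integrable[OF f]) (use r in auto)

lemma MO_ball:
  assumes "0 < \<rho>" "\<rho> < y $ k"
  shows "(LINT z:ball y \<rho>|lebesgue. \<bar>f z - avg f (ball y \<rho>)\<bar>)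
    \<le> t / ln (exp 1 + y $ k / \<rho>) * vol (ball y \<rho>)"
proof -
  have hb: "hball k y \<rho> = ball y \<rho>" by (rule hball_eq_ball) (use assms in auto)
  have fi: "set_integrable lebesgue (ball y \<rho>) f" by (rule L1_loc_ball_integrable[OF f assms(2)])
  define m where "m = vol (ball y \<rho>)"
  have m: "0 < m" unfolding m_def by (rule measure_lebesgue_ball_pos) (rule assms)
  define I where "I = (LINT z:ball y \<rho>|lebesgue. \<bar>f z - avg f (ball y \<rho>)\<bar>)"
  have I0: "0 \<le> I" unfolding I_def set_lebesgue_integral_def by simp
  have L: "1 \<le> ln (exp 1 + y $ k / \<rho>)" by (rule ln_exp_1_plus_ge_1) (use assms in auto)
  have "MO f (ball y \<rho>) = ennreal (I / m)"
    unfolding I_def m_def by (rule MO_eq_ennreal(1)[OF fi lmeasurable_ball]) (use m in \<open>simp add: m_def\<close>)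
  moreover have "is_ball k y \<rho>" using assms by (simp add: is_ball_def halfspace_def)
  ultimately have "ennreal (ln (exp 1 + y $ k / \<rho>)) * ennreal (I / m) \<le> ennreal t"
    using bmo[of y \<rho>] hb by simp
  then have "ennreal (ln (exp 1 + y $ k / \<rho>) * (I / m)) \<le> ennreal t"
    using L by (subst ennreal_mult') auto
  then have "ln (exp 1 + y $ k / \<rho>) * (I / m) \<le> t" using t by (subst (asm) ennreal_le_iff) auto
  then have "I \<le> t / ln (exp 1 + y $ k / \<rho>) * m" using L m by (simp add: field_simps)
  then show ?thesis by (simp add: I_def m_def)
qed

lemma D_meas:
  assumes "Q \<in> D"
  shows "Q \<in> lmeasurable" "Q \<in> sets lebesgue" "0 < vol Q" "Q \<subseteq> ball x (2 * r)"
    "set_integrable lebesgue Q f"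
proof -
  show *: "Q \<in> lmeasurable" "0 < vol Q"
    using dyadic_cubes_measure[of l Q] basic_pos(8) assms by (auto simp: D_def)
  show s: "Q \<in> sets lebesgue" using * by (auto simp: fmeasurable_def)
  show sub: "Q \<subseteq> ball x (2 * r)" using assms r by (fastforce simp: D_def)
  show "set_integrable lebesgue Q f" by (rule set_integrable_subset[OF f_int s sub])
qed

text \<open>Since x $ k > 2 * r, points of such cubes have height above 7/8 * r, so a ball of radius
  n times the side is far from the boundary. By the last conjunct the logarithm for this ball is at
  least the one for the ball of the atom; hence one \<mu> serves all cubes.\<close>

lemma D_ball:
  assumes "Q \<in> D"
  shows "\<exists>z\<in>Q. \<exists>\<rho>>0. \<rho> \<le> r / 8 \<and> \<rho> \<le> z $ k / 4 \<and> Q \<subseteq> ball z \<rho> \<and>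
    vol (ball z \<rho>) = C0 * vol Q \<and> x $ k / r \<le> z $ k / \<rho>"
proof -
  obtain m z where Q: "Q = dyadic_cube l m z" using assms by (auto simp: D_def elim: dyadic_cubesE)
  define \<rho> where "\<rho> = CARD('n) * (l / 2 ^ m)"
  have l0: "0 < l" by (rule basic_pos)
  have \<rho>: "0 < \<rho>" using l0 by (simp add: \<rho>_def)
  have "\<rho> = (r / 8) / 2 ^ m" by (simp add: \<rho>_def l)
  also have "\<dots> \<le> r / 8" using r divide_left_mono[of 1 "2 ^ m" "r / 8"] by simp
  finally have \<rho>2: "\<rho> \<le> r / 8" .
  have z: "z \<in> Q" unfolding Q by (rule dyadic_cube_self)
  then have "z \<in> ball x (9 / 8 * r)" using assms by (auto simp: D_def)
  moreover have "\<bar>(x - z) $ k\<bar> \<le> dist x z" unfolding dist_norm by (rule component_le_norm_cart)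
  ultimately have zk: "x $ k - 9 / 8 * r < z $ k" by simp
  have "\<rho> \<le> z $ k / 4" using \<rho>2 zk r by linarith
  moreover have "Q \<subseteq> ball z \<rho>" using dyadic_cube_dist[OF l0, of _ m z] by (auto simp: Q \<rho>_def)
  moreover have "vol (ball z \<rho>) = C0 * vol Q"
    using measure_lebesgue_ball[of \<rho> z] \<rho>
    unfolding Q dyadic_cube_measure(2)[OF l0] C0 V by (simp add: \<rho>_def power_mult_distrib power_divide)
  moreover have "x $ k / r \<le> z $ k / \<rho>"
  proof -
    have "x $ k / r \<le> (4 * z $ k) / r" using zk r by (intro divide_right_mono) auto
    also have "\<dots> \<le> z $ k / \<rho>"
    proof -
      have "4 * \<rho> \<le> r" "0 < z $ k" using \<rho>2 zk r by linarith+
      then have "z $ k * (4 * \<rho>) \<le> z $ k * r" by (intro mult_left_mono) auto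
      then show ?thesis using \<rho> r by (simp add: field_simps)
    qed
    finally show ?thesis .
  qed
  ultimately show ?thesis using z \<rho> \<rho>2 by blast
qed

text \<open>The mean oscillation on the ball of \<open>D_ball\<close> is at most \<mu>; the volume
  ratio \<open>C0\<close> and the factor 2 for changing the mean turn this into \<omega>.\<close>

lemma osc_cube:
  assumes "Q \<in> D"
  shows "(LINT z:Q|lebesgue. \<bar>f z - avg f Q\<bar>) \<le> \<omega> * vol Q"
proof -
  obtain z \<rho> where z: "z \<in> Q" "0 < \<rho>" "\<rho> \<le> z $ k / 4" "Q \<subseteq> ball z \<rho>"
    "vol (ball z \<rho>) = C0 * vol Q" "x $ k / r \<le> z $ k / \<rho>"
    using D_ball[OF assms] by blast
  have "\<rho> < z $ k" using z by simp
  from MO_ball[OF z(2) this]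
  have "(LINT y:ball z \<rho>|lebesgue. \<bar>f y - avg f (ball z \<rho>)\<bar>)
    \<le> t / ln (exp 1 + z $ k / \<rho>) * vol (ball z \<rho>)" .
  also have "t / ln (exp 1 + z $ k / \<rho>) \<le> \<mu>"
    unfolding \<mu>_def
  proof (rule divide_left_mono)
    have "0 < exp 1 + x $ k / r" using r by (simp add: add_pos_pos)
    then show "ln (exp 1 + x $ k / r) \<le> ln (exp 1 + z $ k / \<rho>)"
      using z(6) by (intro ln_mono) auto
    then show "0 < ln (exp 1 + z $ k / \<rho>) * ln (exp 1 + x $ k / r)"
      using basic_pos(2) by (intro mult_pos_pos) linarith+
  qed (use t in simp)
  finally have 1: "(LINT y:ball z \<rho>|lebesgue. \<bar>f y - avg f (ball z \<rho>)\<bar>) \<le> \<mu> * (C0 * vol Q)"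
    unfolding z(5) using basic_pos(5) D_meas(3)[OF assms] by (simp add: mult_right_mono)
  have "set_integrable lebesgue (ball z \<rho>) f" by (rule L1_loc_ball_integrable[OF f \<open>\<rho> < z $ k\<close>])
  from avg_diff_le(2)[OF D_meas(1)[OF assms] z(4) D_meas(3)[OF assms] lmeasurable_ball this]
  have "(LINT y:Q|lebesgue. \<bar>f y - avg f Q\<bar>) \<le> 2 * (LINT y:ball z \<rho>|lebesgue. \<bar>f y - avg f (ball z \<rho>)\<bar>)" .
  with 1 show ?thesis by (simp add: \<omega>_def mult_ac)
qed

text \<open>By the normalisation of the atom, b powr s times the integral of |a| powr s is at most b
  powr s * b powr (1 - s) = b.\<close>

lemma w_int:
  assumes "E \<in> lmeasurable"
  shows "set_integrable lebesgue E w" "vol E \<le> (LINT z:E|lebesgue. w z)"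
    "(LINT z:E|lebesgue. w z) \<le> b + vol E"
proof -
  have pw: "integrable lebesgue (\<lambda>z. \<bar>a z\<bar> powr s)" "(\<integral>z. \<bar>a z\<bar> powr s \<partial>lebesgue) \<le> b powr (1 - s)"
    using H1r_atom_powr_integral[OF q a] by (auto simp: s_def b_def)
  have weq: "w z = b powr s * \<bar>a z\<bar> powr s + 1" for z
    using basic_pos(7) by (simp add: w_def powr_mult)
  have Es: "E \<in> sets lebesgue" using assms by (auto simp: fmeasurable_def)
  have i1: "set_integrable lebesgue E (\<lambda>z. b powr s * \<bar>a z\<bar> powr s)"
    unfolding set_integrable_def by (intro integrable_mult_indicator Es integrable_mult_right pw(1))
  have i2: "set_integrable lebesgue E (\<lambda>z. 1 :: real)"
    using assms by (auto simp: set_integrable_def fmeasurable_def)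
  show "set_integrable lebesgue E w" unfolding weq[abs_def] by (rule set_integral_add(1)[OF i1 i2])
  have eq: "(LINT z:E|lebesgue. w z) = (LINT z:E|lebesgue. b powr s * \<bar>a z\<bar> powr s) + vol E"
    unfolding weq set_integral_add(2)[OF i1 i2] using Es by (simp add: set_lebesgue_integral_def)
  have "0 \<le> (LINT z:E|lebesgue. b powr s * \<bar>a z\<bar> powr s)"
    unfolding set_lebesgue_integral_def by (intro integral_nonneg_AE) auto
  with eq show "vol E \<le> (LINT z:E|lebesgue. w z)" by simp
  have "(LINT z:E|lebesgue. b powr s * \<bar>a z\<bar> powr s) \<le> (\<integral>z. b powr s * \<bar>a z\<bar> powr s \<partial>lebesgue)"
    unfolding set_lebesgue_integral_def
  proof (rule integral_mono)
    show "integrable lebesgue (\<lambda>z. indicator E z *\<^sub>R (b powr s * \<bar>a z\<bar> powr s))"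
      using i1 by (simp add: set_integrable_def)
  qed (use pw(1) in \<open>auto simp: indicator_def\<close>)
  also have "\<dots> = b powr s * (\<integral>z. \<bar>a z\<bar> powr s \<partial>lebesgue)" by simp
  also have "\<dots> \<le> b powr s * b powr (1 - s)" by (intro mult_left_mono pw(2)) auto
  also have "\<dots> = b" unfolding powr_add[symmetric] using basic_pos(7) by simp
  finally show "(LINT z:E|lebesgue. w z) \<le> b + vol E" using eq by simp
qed

lemma w_ge_1: "1 \<le> w z" by (simp add: w_def)

lemma avg_w:
  assumes "Q \<in> D"
  shows "1 \<le> avg w Q" "vol Q * avg w Q = (LINT z:Q|lebesgue. w z)"
  using w_int(2)[OF D_meas(1)[OF assms]] D_meas(3)[OF assms] by (auto simp: avg_def field_simps)

lemma a_le: "b * \<bar>a z\<bar> \<le> w z powr (1 / s)"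
proof -
  have s: "0 < s" and b: "0 < b" using basic_pos by auto
  have "b * \<bar>a z\<bar> = ((b * \<bar>a z\<bar>) powr s) powr (1 / s)"
    using s b by (simp add: powr_powr)
  also have "\<dots> \<le> w z powr (1 / s)" using s by (intro powr_mono2) (auto simp: w_def)
  finally show ?thesis .
qed

lemma g_eq: "g z = a z * (f z - \<kappa>)"
  by (simp add: g_def atom_product_def r(3) \<kappa>_def)

lemma g_int: "integrable lebesgue g"
proof -
  obtain A where A: "A > 0" "\<And>z. \<bar>a z\<bar> \<le> A" using H1r_atom_basic(2)[OF a] by blast
  have fk: "set_integrable lebesgue (ball x (2 * r)) (\<lambda>z. f z - \<kappa>)"
    by (rule MO_eq_ennreal(2)[OF f_int lmeasurable_ball]) (use r in \<open>auto intro: measure_lebesgue_ball_pos\<close>)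
  have int: "integrable lebesgue (\<lambda>z. indicator (ball x (2 * r)) z * (f z - \<kappa>))"
    using fk by (simp add: set_integrable_def)
  have eq: "g z = a z * (indicator (ball x (2 * r)) z * (f z - \<kappa>))" for z
  proof (cases "z \<in> ball x r")
    case True
    then have "z \<in> ball x (2 * r)" using r by auto
    then show ?thesis by (simp add: g_eq)
  next
    case False
    then show ?thesis using H1r_atom_basic(3)[OF a, of z] by (simp add: g_eq)
  qed
  show ?thesis
  proof (rule Bochner_Integration.integrable_bound[OF integrable_mult_right[OF int, of A]])
    have "(\<lambda>z. a z * (indicator (ball x (2 * r)) z * (f z - \<kappa>))) \<in> borel_measurable lebesgue"
      by (rule borel_measurable_times[OF H1r_atom_basic(1)[OF a] borel_measurable_integrable[OF int]])
    then show "g \<in> borel_measurable lebesgue" by (simp add: eq[abs_def])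
    show "AE z in lebesgue. norm (g z) \<le> norm (A * (indicator (ball x (2 * r)) z * (f z - \<kappa>)))"
    proof (intro AE_I2)
      fix z
      show "norm (g z) \<le> norm (A * (indicator (ball x (2 * r)) z * (f z - \<kappa>)))"
        unfolding eq real_norm_def abs_mult using A by (intro mult_right_mono) (auto simp: abs_mult)
    qed
  qed
qed

lemma v_nonneg: "0 \<le> v Q"
  using basic_pos by (auto simp: v_def intro!: divide_nonneg_pos mult_nonneg_nonneg add_nonneg_nonneg)

text \<open>The constant is built from a bound of |a| and is not uniform in the atom; finiteness is
  all that the halving argument asks of it.\<close>

lemma a_priori: "\<exists>A\<ge>0. \<forall>Q\<in>D. (LINT z:Q|lebesgue. \<bar>g z\<bar>) \<le> A * v Q"
proof -
  obtain A where A: "A > 0" "\<And>z. \<bar>a z\<bar> \<le> A" using H1r_atom_basic(2)[OF a] by blast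
  have "(LINT z:Q|lebesgue. \<bar>g z\<bar>) \<le> (A * b) * v Q" if Q: "Q \<in> D" for Q
  proof -
    let ?m = "vol Q"
    have cQ: "set_integrable lebesgue Q (\<lambda>z. d)" for d :: real
      using D_meas[OF Q] by (auto simp: set_integrable_def fmeasurable_def)
    have fQ: "set_integrable lebesgue Q (\<lambda>z. \<bar>f z - avg f Q\<bar>)"
      by (intro set_integrable_abs set_integral_diff(1) D_meas(5)[OF Q] cQ)
    have iR: "set_integrable lebesgue Q (\<lambda>z. A * (\<bar>f z - avg f Q\<bar> + \<bar>avg f Q - \<kappa>\<bar>))"
      by (intro set_integrable_mult_right set_integral_add(1) fQ cQ)
    have "(LINT z:Q|lebesgue. \<bar>g z\<bar>) \<le> (LINT z:Q|lebesgue. A * (\<bar>f z - avg f Q\<bar> + \<bar>avg f Q - \<kappa>\<bar>))"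
      unfolding set_lebesgue_integral_def
    proof (rule integral_mono)
      show "integrable lebesgue (\<lambda>z. indicator Q z *\<^sub>R \<bar>g z\<bar>)"
        by (rule integrable_mult_indicator[OF D_meas(2)[OF Q] integrable_abs[OF g_int]])
      show "integrable lebesgue (\<lambda>z. indicator Q z *\<^sub>R (A * (\<bar>f z - avg f Q\<bar> + \<bar>avg f Q - \<kappa>\<bar>)))"
        using iR by (simp add: set_integrable_def)
      fix z
      have "\<bar>g z\<bar> \<le> A * (\<bar>f z - avg f Q\<bar> + \<bar>avg f Q - \<kappa>\<bar>)"
        unfolding g_eq abs_mult using A by (intro mult_mono) auto
      then show "indicator Q z *\<^sub>R \<bar>g z\<bar> \<le> indicator Q z *\<^sub>R (A * (\<bar>f z - avg f Q\<bar> + \<bar>avg f Q - \<kappa>\<bar>))"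
        by (auto simp: indicator_def)
    qed
    also have "\<dots> = A * ((LINT z:Q|lebesgue. \<bar>f z - avg f Q\<bar>) + ?m * \<bar>avg f Q - \<kappa>\<bar>)"
      unfolding set_integral_mult_right set_integral_add(2)[OF fQ cQ]
      using D_meas(2)[OF Q] by (simp add: set_lebesgue_integral_def)
    also have "\<dots> \<le> A * (\<omega> * ?m + ?m * \<bar>avg f Q - \<kappa>\<bar>)"
      using A osc_cube[OF Q] by (intro mult_left_mono add_right_mono) auto
    also have "\<dots> = A * (?m * 1 * (1 * \<omega> + \<bar>avg f Q - \<kappa>\<bar>))" by (simp add: algebra_simps)
    also have "\<dots> \<le> A * (?m * avg w Q powr (1 / s) * (K * \<omega> + \<bar>avg f Q - \<kappa>\<bar>))"
      using A basic_pos avg_w(1)[OF Q] D_meas(3)[OF Q]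
      by (intro mult_left_mono mult_mono add_mono mult_right_mono mult_nonneg_nonneg add_nonneg_nonneg)
        (auto intro!: ge_one_powr_ge_zero)
    also have "\<dots> = (A * b) * v Q" using basic_pos(7) by (simp add: v_def)
    finally show ?thesis .
  qed
  then show ?thesis using A basic_pos(7) by (intro exI[of _ "A * b"]) auto
qed

end

context atom_times_bmo
begin

text \<open>One function u measures both relative sizes and has average at most 2 on
  \<open>Q\<close>; selection at height \<Lambda> stops when their sum is large on average. On a
  stopped cube P the average of w is at most K * W and f_P differs from f_Q by at most K * \<omega>,
  which gives the growth factor 2 * K. The halving uses that the stopped cubes have total volume at
  most 2 * m / \<Lambda>.\<close>

lemma stopping_cubes:
  assumes Q: "Q \<in> D"
  shows "\<exists>B. stopping_family D v g (2 * K) Q B"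
proof -
  note pos = basic_pos
  define m where "m = vol Q"
  have m: "0 < m" using D_meas(3)[OF Q] by (simp add: m_def)
  define W where "W = avg w Q"
  have W: "1 \<le> W" "m * W = (LINT z:Q|lebesgue. w z)" using avg_w[OF Q] by (auto simp: W_def m_def)
  define F where "F = K * \<omega> + \<bar>avg f Q - \<kappa>\<bar>"
  have F: "0 < F" using pos by (simp add: F_def add_pos_nonneg)
  have vQ: "v Q / m = W powr (1 / s) * F / b" using m by (simp add: v_def W_def F_def m_def)
  define u where "u z = w z / W + \<bar>f z - avg f Q\<bar> / \<omega>" for z
  have Qm: "Q \<in> lmeasurable" "Q \<in> sets lebesgue" using D_meas[OF Q] by auto
  have wQ: "set_integrable lebesgue Q w" by (rule w_int[OF Qm(1)])
  have fQ: "set_integrable lebesgue Q (\<lambda>z. \<bar>f z - avg f Q\<bar>)"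
    using D_meas[OF Q] by (intro set_integrable_abs MO_eq_ennreal(2)) auto
  have pieces: "set_integrable lebesgue P u"
    "(LINT z:P|lebesgue. u z) = (LINT z:P|lebesgue. w z) / W + (LINT z:P|lebesgue. \<bar>f z - avg f Q\<bar>) / \<omega>"
    "(LINT z:P|lebesgue. w z) \<le> W * (LINT z:P|lebesgue. u z)"
    "(LINT z:P|lebesgue. \<bar>f z - avg f Q\<bar>) \<le> \<omega> * (LINT z:P|lebesgue. u z)"
    if P: "P \<in> sets lebesgue" "P \<subseteq> Q" for P
  proof -
    have wP: "set_integrable lebesgue P (\<lambda>z. w z / W)"
      by (intro set_integrable_divide set_integrable_subset[OF wQ P])
    have fP: "set_integrable lebesgue P (\<lambda>z. \<bar>f z - avg f Q\<bar> / \<omega>)"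
      by (intro set_integrable_divide set_integrable_subset[OF fQ P])
    show "set_integrable lebesgue P u" unfolding u_def by (rule set_integral_add(1)[OF wP fP])
    show eq: "(LINT z:P|lebesgue. u z) = (LINT z:P|lebesgue. w z) / W + (LINT z:P|lebesgue. \<bar>f z - avg f Q\<bar>) / \<omega>"
      unfolding u_def set_integral_add(2)[OF wP fP] by simp
    have 0: "0 \<le> (LINT z:P|lebesgue. w z)" "0 \<le> (LINT z:P|lebesgue. \<bar>f z - avg f Q\<bar>)"
      unfolding set_lebesgue_integral_def using order_trans[OF zero_le_one w_ge_1]
      by (intro integral_nonneg_AE AE_I2; simp)+
    show "(LINT z:P|lebesgue. w z) \<le> W * (LINT z:P|lebesgue. u z)"
      "(LINT z:P|lebesgue. \<bar>f z - avg f Q\<bar>) \<le> \<omega> * (LINT z:P|lebesgue. u z)"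
    proof -
      have "X \<le> W' * (X / W' + Y)" "X \<le> W' * (Y + X / W')" if "0 < W'" "0 \<le> Y" for X Y W' :: real
        using that by (auto simp: distrib_left)
      then show "(LINT z:P|lebesgue. w z) \<le> W * (LINT z:P|lebesgue. u z)"
        "(LINT z:P|lebesgue. \<bar>f z - avg f Q\<bar>) \<le> \<omega> * (LINT z:P|lebesgue. u z)"
        unfolding eq using 0 W(1) pos(6) by auto
    qed
  qed
  have u0: "0 \<le> u z" for z using w_ge_1[of z] W(1) pos(6) by (simp add: u_def)
  have uQ: "(LINT z:Q|lebesgue. u z) \<le> 2 * m"
  proof -
    have "(LINT z:Q|lebesgue. w z) / W = m" unfolding W(2)[symmetric] using W(1) by simp
    moreover have "(LINT z:Q|lebesgue. \<bar>f z - avg f Q\<bar>) / \<omega> \<le> m"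
      using osc_cube[OF Q] pos(6) by (simp add: m_def pos_divide_le_eq mult.commute)
    ultimately show ?thesis using pieces(2)[OF Qm(2)] by simp
  qed
  have "2 * m \<le> \<Lambda> * m" using pos m by (intro mult_right_mono) auto
  with uQ have uQ': "(LINT z:Q|lebesgue. u z) \<le> \<Lambda> * vol Q" by (simp add: m_def)
  have Qc: "Q \<in> dyadic_cubes l" using Q by (simp add: D_def)
  have \<Lambda>0: "0 \<le> \<Lambda>" using pos by simp
  obtain B where B: "B \<subseteq> dyadic_cubes l" "disjoint B"
    "\<And>P. P \<in> B \<Longrightarrow> P \<subseteq> Q \<and> \<Lambda> * vol P \<le> (LINT z:P|lebesgue. u z) \<and>
       (LINT z:P|lebesgue. u z) \<le> K * vol P"
    and ae: "AE z in lebesgue. z \<in> Q - \<Union>B \<longrightarrow> u z \<le> \<Lambda>"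
    using Calderon_Zygmund[OF pos(8) Qc pieces(1)[OF Qm(2) order_refl] u0 \<Lambda>0 uQ'] unfolding K[symmetric] by blast
  have BD: "B \<subseteq> D" using B Q by (auto simp: D_def)
  have Psets: "P \<in> sets lebesgue" "0 < vol P" "P \<in> lmeasurable" if "P \<in> B" for P
    using that BD D_meas by blast+
  have FP: "K * \<omega> + \<bar>avg f P - \<kappa>\<bar> \<le> 2 * F" if P: "P \<in> B" for P
  proof -
    have sub: "P \<subseteq> Q" using B(3)[OF P] by blast
    have "\<bar>avg f P - avg f Q\<bar> \<le> (LINT z:P|lebesgue. \<bar>f z - avg f Q\<bar>) / vol P"
      using set_integrable_subset[OF D_meas(5)[OF Q] Psets(1)[OF P] sub] Psets[OF P]
      by (intro avg_diff_le(1)) auto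
    also have "\<dots> \<le> K * \<omega>"
    proof -
      have "(LINT z:P|lebesgue. \<bar>f z - avg f Q\<bar>) \<le> \<omega> * (K * vol P)"
        using B(3)[OF P] pos(6)
        by (intro order_trans[OF pieces(4)[OF Psets(1)[OF P] sub]] mult_left_mono) auto
      then show ?thesis using Psets(2)[OF P] by (simp add: pos_divide_le_eq mult_ac)
    qed
    finally have "\<bar>avg f P - avg f Q\<bar> \<le> K * \<omega>" .
    moreover have "\<bar>avg f P - \<kappa>\<bar> \<le> \<bar>avg f P - avg f Q\<bar> + \<bar>avg f Q - \<kappa>\<bar>" by linarith
    moreover have "X + Y \<le> 2 * (X + Z)" if "U \<le> X" "Y \<le> U + Z" "0 \<le> Z" for X Y Z U :: real
    proof -
      have "X + Y \<le> 2 * X + 2 * Z" using that by linarith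
      then show ?thesis by simp
    qed
    ultimately show ?thesis unfolding F_def using abs_ge_zero by blast
  qed
  have WP: "avg w P \<le> K * W" if P: "P \<in> B" for P
  proof -
    have sub: "P \<subseteq> Q" using B(3)[OF P] by blast
    have "(LINT z:P|lebesgue. w z) \<le> W * (K * vol P)"
      using B(3)[OF P] W(1)
      by (intro order_trans[OF pieces(3)[OF Psets(1)[OF P] sub]] mult_left_mono) auto
    then show ?thesis using Psets(2)[OF P] by (simp add: avg_def pos_divide_le_eq mult_ac)
  qed
  have density: "v P / vol P \<le> 2 * K * (v Q / vol Q)" if P: "P \<in> B" for P
  proof -
    have w1: "1 \<le> avg w P" by (rule avg_w(1)[OF subsetD[OF BD P]])
    have "avg w P powr (1 / s) \<le> (K * W) powr (1 / s)"
      using pos(1) w1 WP[OF P] by (intro powr_mono2) auto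
    also have "\<dots> = K powr (1 / s) * W powr (1 / s)" using pos W by (simp add: powr_mult)
    also have "\<dots> \<le> K * W powr (1 / s)"
      using powr_mono[of "1 / s" 1 K] pos by (intro mult_right_mono) auto
    finally have 1: "avg w P powr (1 / s) \<le> K * W powr (1 / s)" .
    have "v P / vol P = avg w P powr (1 / s) * (K * \<omega> + \<bar>avg f P - \<kappa>\<bar>) / b"
      using Psets(2)[OF P] by (simp add: v_def)
    also have "\<dots> \<le> (K * W powr (1 / s)) * (2 * F) / b"
      using pos F by (intro divide_right_mono mult_mono 1 FP[OF P]) auto
    also have "\<dots> = 2 * K * (v Q / m)" unfolding vQ by simp
    finally show ?thesis by (simp add: m_def)
  qed
  have total: "sum v E \<le> v Q / 2" if E: "finite E" "E \<subseteq> B" for E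
  proof -
    have disE: "disjoint E" using B(2) E(2) by (rule pairwise_subset)
    have subE: "P \<subseteq> Q" if "P \<in> E" for P using B(3) E that by blast
    have setE: "E \<subseteq> sets lebesgue" using Psets(1) E by blast
    have "(\<Sum>P\<in>E. LINT z:P|lebesgue. w z) \<le> (LINT z:Q|lebesgue. w z)"
      by (rule sum_set_integral_disjoint_le[OF E(1) disE subE setE wQ])
        (use w_ge_1 in \<open>auto intro: order_trans[OF zero_le_one]\<close>)
    then have sw: "(\<Sum>P\<in>E. LINT z:P|lebesgue. w z) \<le> m * W" by (simp add: W(2))
    have "\<Lambda> * (\<Sum>P\<in>E. vol P) \<le> (\<Sum>P\<in>E. LINT z:P|lebesgue. u z)"
      unfolding sum_distrib_left using B(3) E by (intro sum_mono) blast
    also have "\<dots> \<le> (LINT z:Q|lebesgue. u z)"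
      by (rule sum_set_integral_disjoint_le[OF E(1) disE subE setE pieces(1)[OF Qm(2) order_refl] u0])
    finally have sm: "\<Lambda> * (\<Sum>P\<in>E. vol P) \<le> 2 * m" using uQ by simp
    \<comment> \<open>With \<delta> = 1/8 the linear bound for the root has the constant c =
      \<Lambda> / 16. The integrals of w contribute m / 8 and the volumes c * 2 * m / \<Lambda> = m
      / 8; the factor 2 from the bracket then turns m / 4 into half of v Q.\<close>
    define \<delta> :: real where "\<delta> = 1 / 8"
    define c where "c = \<delta> powr (- 1 / (s - 1))"
    have c: "16 * c = \<Lambda>"
    proof -
      have "c = inverse \<delta> powr (1 / (s - 1))"
        unfolding c_def inverse_powr minus_divide_left[symmetric] powr_minus ..
      then show ?thesis by (simp add: \<Lambda> \<delta>_def s_def)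
    qed
    have root: "avg w P powr (1 / s) \<le> W powr (1 / s) * (avg w P / W / 8 + c)" if P: "P \<in> E" for P
    proof -
      have w1: "1 \<le> avg w P" by (rule avg_w(1)[OF subsetD[OF BD subsetD[OF E(2) P]]])
      have "avg w P powr (1 / s) = W powr (1 / s) * (avg w P / W) powr (1 / s)"
        using W(1) w1 by (simp add: powr_divide)
      also have "\<dots> \<le> W powr (1 / s) * (\<delta> * (avg w P / W) + c)"
        unfolding c_def using pos(1) W(1) w1 by (intro mult_left_mono root_le_linear) (auto simp: \<delta>_def)
      finally show ?thesis by (simp add: \<delta>_def mult.commute)
    qed
    have "sum v E \<le> (\<Sum>P\<in>E. (W powr (1 / s) * 2 * F / b) * ((LINT z:P|lebesgue. w z) / W / 8 + c * vol P))"
    proof (rule sum_mono)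
      fix P assume P: "P \<in> E"
      then have PB: "P \<in> B" using E by blast
      have aw: "vol P * avg w P = (LINT z:P|lebesgue. w z)" by (rule avg_w(2)[OF subsetD[OF BD PB]])
      have "v P \<le> vol P * (W powr (1 / s) * (avg w P / W / 8 + c)) * (2 * F) / b"
      proof -
        have "M * X * Y / b \<le> M * X' * Y' / b" if "0 \<le> M" "0 \<le> X" "X \<le> X'" "0 \<le> Y" "Y \<le> Y'" for M X X' Y Y'
          using that pos(7) by (intro divide_right_mono mult_mono) (auto intro: order_trans)
        from this[OF _ powr_ge_zero root[OF P] _ FP[OF PB], of "vol P"] show ?thesis
          unfolding v_def using pos by simp
      qed
      also have "\<dots> = (W powr (1 / s) * 2 * F / b) * (vol P * avg w P / W / 8 + c * vol P)"
        by (simp add: algebra_simps add_divide_distrib)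
      finally show "v P \<le> (W powr (1 / s) * 2 * F / b) * ((LINT z:P|lebesgue. w z) / W / 8 + c * vol P)"
        by (simp add: aw)
    qed
    also have "\<dots> = (W powr (1 / s) * 2 * F / b) *
        ((\<Sum>P\<in>E. LINT z:P|lebesgue. w z) / W / 8 + c * (\<Sum>P\<in>E. vol P))"
      by (simp only: sum_distrib_left sum.distrib[symmetric] sum_divide_distrib)
    also have "\<dots> \<le> (W powr (1 / s) * 2 * F / b) * (m / 4)"
    proof (rule mult_left_mono)
      have "(\<Sum>P\<in>E. LINT z:P|lebesgue. w z) / W / 8 \<le> m / 8" using sw W(1) by (simp add: field_simps)
      moreover have "c * (\<Sum>P\<in>E. vol P) \<le> m / 8" using sm unfolding c[symmetric] by simp
      ultimately show "(\<Sum>P\<in>E. LINT z:P|lebesgue. w z) / W / 8 + c * (\<Sum>P\<in>E. vol P) \<le> m / 4"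
        by simp
      show "0 \<le> W powr (1 / s) * 2 * F / b" using pos F by simp
    qed
    also have "\<dots> = v Q / 2" using vQ m by (simp add: field_simps)
    finally show ?thesis .
  qed
  \<comment> \<open>Off the stopped cubes both summands of u are at most \<Lambda>: the first bounds
    |a| through the root of \<Lambda> * W, the second bounds |f - f_B| by the bracket.\<close>
  have "AE z in lebesgue. z \<in> Q - \<Union>B \<longrightarrow> \<bar>g z\<bar> \<le> 2 * K * (v Q / vol Q)"
    using ae
  proof eventually_elim
    case (elim z)
    show ?case
    proof
      assume "z \<in> Q - \<Union>B"
      with elim have uz: "u z \<le> \<Lambda>" by blast
      have "0 \<le> w z / W" "0 \<le> \<bar>f z - avg f Q\<bar> / \<omega>" using w_ge_1[of z] W(1) pos(6) by auto
      then have "w z / W \<le> \<Lambda>" "\<bar>f z - avg f Q\<bar> / \<omega> \<le> \<Lambda>" using uz unfolding u_def by linarith+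
      then have wz: "w z \<le> \<Lambda> * W" and fz: "\<bar>f z - avg f Q\<bar> \<le> \<Lambda> * \<omega>"
        using W(1) pos(6) by (auto simp: pos_divide_le_eq)
      have "\<Lambda> * \<omega> \<le> K * \<omega>" using pos by (intro mult_right_mono) auto
      then have fk: "\<bar>f z - \<kappa>\<bar> \<le> F" using fz unfolding F_def by linarith
      have "b * \<bar>a z\<bar> \<le> w z powr (1 / s)" by (rule a_le)
      also have "\<dots> \<le> (\<Lambda> * W) powr (1 / s)" using wz w_ge_1[of z] pos(1) by (intro powr_mono2) auto
      also have "\<dots> = \<Lambda> powr (1 / s) * W powr (1 / s)" using pos W by (simp add: powr_mult)
      also have "\<dots> \<le> \<Lambda> * W powr (1 / s)"
        using powr_mono[of "1 / s" 1 \<Lambda>] pos by (intro mult_right_mono) auto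
      also have "\<dots> \<le> 2 * K * W powr (1 / s)" using pos by (intro mult_right_mono) auto
      finally have az: "\<bar>a z\<bar> \<le> 2 * K * W powr (1 / s) / b" using pos(7) by (simp add: field_simps)
      have "\<bar>g z\<bar> \<le> (2 * K * W powr (1 / s) / b) * F"
        unfolding g_eq abs_mult using pos F by (intro mult_mono az fk) auto
      also have "\<dots> = 2 * K * (v Q / m)" unfolding vQ by simp
      finally show "\<bar>g z\<bar> \<le> 2 * K * (v Q / vol Q)" by (simp add: m_def)
    qed
  qed
  then show ?thesis unfolding stopping_family_def using BD B(2,3) density total by blast
qed

section \<open>Starting cubes and the estimate of the whole product\<close>

definition F0 where "F0 = {Q \<in> range (dyadic_cube l 0). Q \<inter> ball x r \<noteq> {}}"

lemma F0_D: "F0 \<subseteq> D"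
proof
  fix Q assume "Q \<in> F0"
  then obtain z0 where "Q = dyadic_cube l 0 z0" "Q \<inter> ball x r \<noteq> {}" unfolding F0_def by blast
  moreover from this obtain y where "y \<in> Q" "y \<in> ball x r" by blast
  ultimately have Q: "Q = dyadic_cube l 0 y" using dyadic_cube_eq by blast
  have "Q \<subseteq> ball x (9 / 8 * r)"
  proof
    fix z assume "z \<in> Q"
    then have "dist y z < r / 8"
      using dyadic_cube_dist[OF basic_pos(8), of z 0 y] by (simp add: Q l)
    then show "z \<in> ball x (9 / 8 * r)" using \<open>y \<in> ball x r\<close> dist_triangle[of x z y] by simp
  qed
  then show "Q \<in> D" using dyadic_cube_in_cubes by (auto simp: D_def Q)
qed

lemma F0_disjoint: "disjoint F0"
  unfolding disjoint_def
proof (intro ballI impI, rule ccontr)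
  fix P Q assume PQ: "P \<in> F0" "Q \<in> F0" "P \<noteq> Q" "P \<inter> Q \<noteq> {}"
  then obtain z where "z \<in> P" "z \<in> Q" by blast
  moreover obtain y y' where "P = dyadic_cube l 0 y" "Q = dyadic_cube l 0 y'"
    using PQ(1,2) unfolding F0_def by blast
  ultimately have "P = dyadic_cube l 0 z" "Q = dyadic_cube l 0 z" by (auto dest: dyadic_cube_eq)
  with PQ show False by simp
qed

lemma F0_cover: "ball x r \<subseteq> \<Union>F0"
proof
  fix z assume "z \<in> ball x r"
  then have "dyadic_cube l 0 z \<in> F0" using dyadic_cube_self[of z l 0] by (auto simp: F0_def)
  then show "z \<in> \<Union>F0" using dyadic_cube_self[of z l 0] by blast
qed

text \<open>Collects K * \<omega> and the two steps from f_Q to f_B through the average over the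
  doubled ball; V * (8 * n) ^ n is the volume ratio of the ball of the atom to a starting
  cube.\<close>

definition C4 where "C4 = 2 * K * C0 + 2 * (2 ^ CARD('n) * V * (8 * CARD('n)) ^ CARD('n) + 2 ^ CARD('n))"

text \<open>Both f_Q and f_B are compared with the average over the doubled ball, which contains
  both sets and still lies in the half-space. Its logarithm is at least half as large, so its mean
  oscillation is at most 2 * \<mu>.\<close>

lemma F0_offset:
  assumes Q: "Q \<in> F0"
  shows "K * \<omega> + \<bar>avg f Q - \<kappa>\<bar> \<le> C4 * \<mu>"
proof -
  note pos = basic_pos
  let ?n = "CARD('n)" and ?B = "ball x (2 * r)"
  have QD: "Q \<in> D" using Q F0_D by blast
  obtain y where Qy: "Q = dyadic_cube l 0 y" using Q by (auto simp: F0_def)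
  have Qm: "vol Q = l ^ ?n" unfolding Qy dyadic_cube_measure(2)[OF pos(8)] by simp
  have Bm: "vol ?B = 2 ^ ?n * b"
    unfolding b_def by (rule measure_ball_scale) (use r in auto)
  have half: "ln (exp 1 + x $ k / r) / 2 \<le> ln (exp 1 + x $ k / (2 * r))"
    using ln_exp_1_plus_half[of "x $ k / r"] r by (simp add: field_simps)
  have "(LINT z:?B|lebesgue. \<bar>f z - avg f ?B\<bar>) \<le> t / ln (exp 1 + x $ k / (2 * r)) * vol ?B"
    by (rule MO_ball) (use r in auto)
  also have "t / ln (exp 1 + x $ k / (2 * r)) \<le> t / (ln (exp 1 + x $ k / r) / 2)"
    using half pos(2) t by (intro divide_left_mono mult_pos_pos) auto
  also have "\<dots> = 2 * \<mu>" by (simp add: \<mu>_def)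
  finally have I: "(LINT z:?B|lebesgue. \<bar>f z - avg f ?B\<bar>) \<le> 2 * \<mu> * (2 ^ ?n * b)"
    unfolding Bm using pos(7) by (simp add: mult_right_mono)
  have 1: "\<bar>avg f Q - avg f ?B\<bar> \<le> 2 * \<mu> * (2 ^ ?n * b) / l ^ ?n"
  proof -
    have "\<bar>avg f Q - avg f ?B\<bar> \<le> (LINT z:?B|lebesgue. \<bar>f z - avg f ?B\<bar>) / vol Q"
      by (rule avg_diff_le(1)[OF D_meas(1)[OF QD] D_meas(4)[OF QD] D_meas(3)[OF QD] lmeasurable_ball f_int])
    also have "\<dots> \<le> 2 * \<mu> * (2 ^ ?n * b) / l ^ ?n"
      unfolding Qm using pos(8) by (intro divide_right_mono I) auto
    finally show ?thesis .
  qed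
  have 2: "\<bar>\<kappa> - avg f ?B\<bar> \<le> 2 * \<mu> * (2 ^ ?n * b) / b"
  proof -
    have "\<bar>\<kappa> - avg f ?B\<bar> \<le> (LINT z:?B|lebesgue. \<bar>f z - avg f ?B\<bar>) / vol (ball x r)"
      unfolding \<kappa>_def
      by (rule avg_diff_le(1)[OF lmeasurable_ball _ _ lmeasurable_ball f_int])
        (use r pos(7) in \<open>auto simp: b_def\<close>)
    also have "\<dots> \<le> 2 * \<mu> * (2 ^ ?n * b) / b"
      unfolding b_def[symmetric] using pos(7) by (intro divide_right_mono I) auto
    finally show ?thesis .
  qed
  have "l * (8 * ?n) = r" by (simp add: l)
  then have "(l * (8 * ?n)) ^ ?n = r ^ ?n" by simp
  then have "b = l ^ ?n * (8 * ?n) ^ ?n * V" unfolding b_eq power_mult_distrib by simp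
  then have b: "b / l ^ ?n = V * (8 * ?n) ^ ?n" using pos(8) by simp
  have "2 * \<mu> * (2 ^ ?n * b) / l ^ ?n = 2 * \<mu> * 2 ^ ?n * (b / l ^ ?n)" by simp
  also have "\<dots> = 2 * \<mu> * (2 ^ ?n * V * (8 * ?n) ^ ?n)" unfolding b by simp
  finally have fQ: "\<bar>avg f Q - avg f ?B\<bar> \<le> 2 * \<mu> * (2 ^ ?n * V * (8 * ?n) ^ ?n)" using 1 by simp
  have f\<kappa>: "\<bar>\<kappa> - avg f ?B\<bar> \<le> 2 * \<mu> * 2 ^ ?n" using 2 pos(7) by simp
  have "\<bar>avg f Q - \<kappa>\<bar> \<le> 2 * \<mu> * (2 ^ ?n * V * (8 * ?n) ^ ?n) + 2 * \<mu> * 2 ^ ?n"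
    using fQ f\<kappa> by linarith
  then show ?thesis by (simp add: C4_def \<omega>_def algebra_simps)
qed

lemma F0_total:
  assumes E: "finite E" "E \<subseteq> F0"
  shows "sum v E \<le> C4 * (1 + 2 ^ CARD('n)) * \<mu>"
proof -
  note pos = basic_pos
  let ?n = "CARD('n)" and ?B = "ball x (2 * r)"
  have ED: "E \<subseteq> D" using E F0_D by blast
  have Bm: "vol ?B = 2 ^ ?n * b"
    unfolding b_def by (rule measure_ball_scale) (use r in auto)
  have C4: "0 \<le> C4" unfolding C4_def using pos by (intro add_nonneg_nonneg mult_nonneg_nonneg) auto
  have "sum v E \<le> (\<Sum>Q\<in>E. (C4 * \<mu> / b) * (LINT z:Q|lebesgue. w z))"
  proof (rule sum_mono)
    fix Q assume Q: "Q \<in> E"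
    then have QD: "Q \<in> D" using ED by blast
    have "avg w Q powr (1 / s) \<le> avg w Q powr 1" using avg_w(1)[OF QD] pos(1) by (intro powr_mono) auto
    then have "avg w Q powr (1 / s) \<le> avg w Q" using avg_w(1)[OF QD] by simp
    then have "v Q \<le> vol Q * avg w Q * (C4 * \<mu>) / b"
      unfolding v_def using pos avg_w(1)[OF QD] F0_offset[of Q] Q E
      by (intro divide_right_mono mult_mono) auto
    also have "\<dots> = (C4 * \<mu> / b) * (LINT z:Q|lebesgue. w z)" by (simp add: avg_w(2)[OF QD] mult.commute)
    finally show "v Q \<le> (C4 * \<mu> / b) * (LINT z:Q|lebesgue. w z)" .
  qed
  also have "\<dots> = (C4 * \<mu> / b) * (\<Sum>Q\<in>E. LINT z:Q|lebesgue. w z)" by (simp add: sum_distrib_left)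
  also have "\<dots> \<le> (C4 * \<mu> / b) * (b + 2 ^ ?n * b)"
  proof (rule mult_left_mono)
    have "(\<Sum>Q\<in>E. LINT z:Q|lebesgue. w z) \<le> (LINT z:?B|lebesgue. w z)"
    proof (rule sum_set_integral_disjoint_le[OF E(1)])
      show "disjoint E" using F0_disjoint E(2) by (rule pairwise_subset)
      show "E \<subseteq> sets lebesgue" "\<And>P. P \<in> E \<Longrightarrow> P \<subseteq> ?B" using ED D_meas by blast+
      show "set_integrable lebesgue ?B w" by (rule w_int(1)) simp
      show "0 \<le> w z" for z using w_ge_1[of z] by simp
    qed
    also have "\<dots> \<le> b + vol ?B" by (rule w_int(3)) simp
    finally show "(\<Sum>Q\<in>E. LINT z:Q|lebesgue. w z) \<le> b + 2 ^ ?n * b" unfolding Bm .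
    show "0 \<le> C4 * \<mu> / b" using C4 pos by simp
  qed
  also have "\<dots> = C4 * (1 + 2 ^ ?n) * \<mu>" using pos(7) by (simp add: field_simps)
  finally show ?thesis .
qed

text \<open>The two parts have different costs. The oscillations need a total of order \<mu>, while
  the averages need about Lg atoms each, in total of order Lg * \<mu> = t.\<close>

theorem product_atomic_bound:
  defines "n \<equiv> CARD('n)"
  defines "T \<equiv> C4 * (1 + 2 ^ n)"
  shows "atomic_bound k p
    ((2 * (C0 * (3 * (2 * K) + 2 * (2 * K) * (2 * K))) + 4 * K * C0 * (3 ^ n + 5 * (2 ^ n + 1))) * T * t) g"
proof -
  note pos = basic_pos
  define Lg where "Lg = ln (exp 1 + x $ k / r)"
  have Lg: "1 \<le> Lg" "Lg * \<mu> = t" using pos(2) by (auto simp: Lg_def \<mu>_def)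
  obtain A where A: "0 \<le> A" "\<And>Q. Q \<in> D \<Longrightarrow> (LINT z:Q|lebesgue. \<bar>g z\<bar>) \<le> A * v Q" using a_priori by blast
  interpret tree: stopping_tree k p l A "2 * K" C0 D v g
  proof
    show "D \<subseteq> dyadic_cubes l" by (auto simp: D_def)
    show "\<exists>z \<rho>. 0 < \<rho> \<and> \<rho> \<le> z $ k / 4 \<and> Q \<subseteq> ball z \<rho> \<and> vol (ball z \<rho>) \<le> C0 * vol Q"
      if "Q \<in> D" for Q using D_ball[OF that] by (metis order_refl)
  qed (use p pos A g_int v_nonneg stopping_cubes in auto)
  have T0: "0 \<le> T" unfolding T_def C4_def using pos by (intro add_nonneg_nonneg mult_nonneg_nonneg) auto
  have tot: "sum v E \<le> T * \<mu>" if "finite E" "E \<subseteq> F0" for E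
    using F0_total[OF that] by (simp add: T_def n_def)
  have R: "atomic_bound k p (2 * (C0 * tree.C3) * (T * \<mu>)) (piece_sum F0 tree.osc)"
    by (rule tree.osc_sum_atomic_bound[OF F0_D F0_disjoint tot])
  \<comment> \<open>Enough doublings to bring the radius r / 8 up to the boundary scale for all
    starting cubes at once.\<close>
  define J where "J = nat \<lceil>4 * Lg\<rceil>"
  have J: "2 * (x $ k / r) < 2 ^ J" "real J \<le> 5 * Lg"
    using two_power_ln_gt[of "x $ k / r" J] r by (auto simp: J_def Lg_def)
  define H where "H = (3 ^ n + 5 * (2 ^ n + 1)) * Lg"
  have H: "3 ^ n + real J * (2 ^ n + 1) \<le> H"
  proof -
    have "3 ^ n * 1 \<le> 3 ^ n * Lg" using Lg by (intro mult_left_mono) auto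
    moreover have "real J * (2 ^ n + 1) \<le> 5 * Lg * (2 ^ n + 1)" using J by (intro mult_right_mono) auto
    moreover have "H = 3 ^ n * Lg + 5 * Lg * (2 ^ n + 1)" by (simp add: H_def algebra_simps)
    ultimately show ?thesis by linarith
  qed
  have H0: "0 \<le> H" using Lg by (simp add: H_def)
  define h where "h Q z = indicator Q z * avg g Q" for Q z
  have M: "atomic_bound k p (H * (4 * K * C0 * (T * \<mu>))) (piece_sum F0 h)"
  proof (rule atomic_bound_disjoint_family[OF p tree.D_countable[OF F0_D] F0_disjoint,
        where W = "\<lambda>Q. H * (4 * K * C0 * v Q)" and g = h])
    fix Q assume Q: "Q \<in> F0"
    then have QD: "Q \<in> D" using F0_D by blast
    obtain y where Qy: "Q = dyadic_cube l 0 y" "y \<in> ball x r"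
      using Q dyadic_cube_eq by (fastforce simp: F0_def)
    \<comment> \<open>The same radius for all starting cubes, centred at a point y of the ball of
      the atom. Then y $ k \<le> 2 * x $ k, so one number \<open>J\<close> of doublings works for
      every cube.\<close>
    define \<rho> where "\<rho> = r / 8"
    have \<rho>: "0 < \<rho>" using r by (simp add: \<rho>_def)
    have yk: "\<bar>(x - y) $ k\<bar> \<le> dist x y" unfolding dist_norm by (rule component_le_norm_cart)
    have sub: "Q \<subseteq> ball y \<rho>"
      using dyadic_cube_dist[OF pos(8), of _ 0 y] by (auto simp: Qy(1) l \<rho>_def)
    have Bm: "vol (ball y \<rho>) = C0 * vol Q"
      using measure_lebesgue_ball[of \<rho> y] \<rho>
      unfolding Qy(1) dyadic_cube_measure(2)[OF pos(8)] C0 V by (simp add: \<rho>_def l power_mult_distrib power_divide)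
    let ?M = "4 * K * C0 * v Q"
    have "atomic_bound k p ((3 ^ CARD('n) + real J * (2 ^ CARD('n) + 1)) * ?M) (h Q)"
    proof (rule atomic_bound_noncancelling[OF p \<rho>])
      show "\<rho> \<le> y $ k / 4" using yk Qy(2) r by (simp add: \<rho>_def)
      have "y $ k \<le> 2 * x $ k" using yk Qy(2) r by simp
      also have "\<dots> < 2 ^ J * r" using J(1) r by (simp add: field_simps)
      finally show "y $ k / 8 < 2 ^ J * \<rho>" by (simp add: \<rho>_def)
      show "0 \<le> ?M" using pos v_nonneg by simp
      show "h Q \<in> borel_measurable lebesgue"
        using tree.ind_int(3)[OF QD, of "avg g Q"] by (simp add: h_def[abs_def] borel_measurable_integrable)
      show "h Q z = 0" if "z \<notin> ball y \<rho>" for z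
      proof -
        have "z \<notin> Q" using that sub by blast
        then show ?thesis by (simp add: h_def)
      qed
      show "\<bar>h Q z\<bar> \<le> ?M / vol (ball y \<rho>)" for z
      proof -
        have "\<bar>h Q z\<bar> \<le> \<bar>avg g Q\<bar>" by (auto simp: h_def indicator_def)
        also have "\<dots> \<le> 2 * (2 * K) * (v Q / vol Q)" by (rule tree.avg_le[OF QD])
        also have "\<dots> = ?M / vol (ball y \<rho>)" unfolding Bm using pos(5) by simp
        finally show ?thesis .
      qed
    qed
    moreover have "(3 ^ CARD('n) + real J * (2 ^ CARD('n) + 1)) * ?M \<le> H * ?M"
      using H pos v_nonneg[of Q] unfolding n_def by (intro mult_right_mono) auto
    ultimately show "atomic_bound k p (H * ?M) (h Q)" by (rule atomic_bound_mono)
    show "0 \<le> H * ?M" using H0 pos v_nonneg by simp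
    show "h Q z = 0" if "z \<notin> Q" for z using that by (simp add: h_def)
    show "piece_sum F0 h z = h Q z" if "z \<in> Q" for z using piece_sum_in[OF F0_disjoint Q that] .
  next
    fix E assume E: "finite E" "E \<subseteq> F0"
    have "(\<Sum>Q\<in>E. H * (4 * K * C0 * v Q)) = H * (4 * K * C0 * sum v E)" by (simp add: sum_distrib_left)
    also have "\<dots> \<le> H * (4 * K * C0 * (T * \<mu>))"
      using H0 pos by (intro mult_left_mono tot[OF E]) auto
    finally show "(\<Sum>Q\<in>E. H * (4 * K * C0 * v Q)) \<le> H * (4 * K * C0 * (T * \<mu>))" .
  qed (simp add: piece_sum_notin)
  have C3: "tree.C3 = 3 * (2 * K) + 2 * (2 * K) * (2 * K)" by (simp add: tree.C3_def)
  define c1 where "c1 = 2 * (C0 * tree.C3)"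
  define c2 where "c2 = 4 * K * C0 * (3 ^ n + 5 * (2 ^ n + 1))"
  have c1: "0 \<le> c1" unfolding c1_def C3 using pos by simp
  have eq: "piece_sum F0 tree.osc z + piece_sum F0 h z = g z" for z
  proof (cases "z \<in> \<Union>F0")
    case True
    then obtain Q where Q: "Q \<in> F0" "z \<in> Q" by blast
    show ?thesis unfolding piece_sum_in[OF F0_disjoint Q] using Q by (simp add: tree.osc_def h_def)
  next
    case False
    then have "z \<notin> ball x r" using F0_cover by blast
    then show ?thesis using H1r_atom_basic(3)[OF a, of z] by (simp add: piece_sum_notin[OF False] g_eq)
  qed
  have "atomic_bound k p (c1 * (T * \<mu>) + H * (4 * K * C0 * (T * \<mu>)))
      (\<lambda>z. piece_sum F0 tree.osc z + piece_sum F0 h z)"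
    unfolding c1_def
    by (rule atomic_bound_add[OF p R M]) (use c1 T0 H0 pos in \<open>auto simp: c1_def\<close>)
  then have "atomic_bound k p (c1 * (T * \<mu>) + H * (4 * K * C0 * (T * \<mu>))) g" by (simp add: eq[abs_def])
  moreover have "c1 * (T * \<mu>) + H * (4 * K * C0 * (T * \<mu>)) \<le> (c1 + c2) * T * t"
  proof -
    have "1 * \<mu> \<le> Lg * \<mu>" using Lg pos by (intro mult_right_mono) auto
    then have "\<mu> \<le> t" using Lg by simp
    then have "c1 * (T * \<mu>) \<le> c1 * (T * t)" using c1 T0 by (intro mult_left_mono) auto
    moreover have "H * (4 * K * C0 * (T * \<mu>)) = c2 * T * (Lg * \<mu>)" by (simp add: H_def c2_def)
    ultimately have "c1 * (T * \<mu>) + H * (4 * K * C0 * (T * \<mu>)) \<le> c1 * (T * t) + c2 * T * t"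
      unfolding Lg(2) by linarith
    then show ?thesis by (simp add: algebra_simps)
  qed
  ultimately have "atomic_bound k p ((c1 + c2) * T * t) g" by (rule atomic_bound_mono)
  then show ?thesis by (simp add: c1_def c2_def C3)
qed

end

section \<open>Comparison of the norms\<close>

text \<open>The constant of \<open>product_atomic_bound\<close> is built from n and q alone; it is
  spelled out here before f and the atom are fixed, with \<open>D4\<close> in the place of
  \<open>C4\<close>.\<close>

lemma atom_product_sup_le_BMO_log_norm:
  fixes k :: "'n::finite"
  assumes p: "1 < p" and q: "1 < q"
  shows "\<exists>C>0. \<forall>f\<in>BMO k. atom_product_sup k p q f \<le> ennreal C * BMO_log_norm k f"
proof -
  define \<Lambda> :: real where "\<Lambda> = 16 * 8 powr (1 / (fin_exponent q - 1))"
  define K where "K = 2 ^ CARD('n) * \<Lambda>"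
  define V where "V = vol (ball (0 :: real ^ 'n) 1)"
  define C0 where "C0 = CARD('n) ^ CARD('n) * V"
  define D4 where "D4 = 2 * K * C0 + 2 * (2 ^ CARD('n) * V * (8 * CARD('n)) ^ CARD('n) + 2 ^ CARD('n))"
  define C where "C = (2 * (C0 * (3 * (2 * K) + 2 * (2 * K) * (2 * K))) +
    4 * K * C0 * (3 ^ CARD('n) + 5 * (2 ^ CARD('n) + 1))) * (D4 * (1 + 2 ^ CARD('n)))"
  have V: "0 < V" unfolding V_def by (rule measure_lebesgue_ball_pos) simp
  have "0 < K" "0 < C0" using V by (simp_all add: K_def \<Lambda>_def C0_def)
  then have C: "0 < C" unfolding C_def D4_def using V by (intro mult_pos_pos add_pos_pos) auto
  have bound: "H1r_norm k p (atom_product k f a x r) \<le> ennreal (C * t)"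
    if f: "f \<in> BMO k" and a: "H1r_atom k q a x r" and t: "0 < t" "BMO_log_norm k f \<le> ennreal t" for f a x r t
  proof -
    interpret atom_times_bmo k p q f a x r t \<Lambda> K C0 V "r / (8 * CARD('n))"
    proof
      show "f \<in> L1_loc k" using f by (simp add: BMO_def)
      show "ennreal (ln (exp 1 + y $ k / \<rho>)) * MO f (hball k y \<rho>) \<le> ennreal t"
        if "is_ball k y \<rho>" for y \<rho>
      proof -
        have "ennreal (ln (exp 1 + y $ k / \<rho>)) * MO f (hball k y \<rho>) \<le> BMO_log_norm k f"
          unfolding BMO_log_norm_def using that by (intro SUP_upper2[of "(y, \<rho>)"]) auto
        with t(2) show ?thesis by (rule order_trans[rotated])
      qed
    qed (use p q a t in \<open>simp_all add: \<Lambda>_def K_def V_def C0_def\<close>)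
    have "atomic_bound k p (C * t) (atom_product k f a x r)"
      using product_atomic_bound by (simp only: g_def C4_def C_def D4_def)
    then show ?thesis by (rule H1r_norm_le_atomic_bound[OF p])
  qed
  have "atom_product_sup k p q f \<le> ennreal C * BMO_log_norm k f" if f: "f \<in> BMO k" for f
  proof (cases "BMO_log_norm k f = top")
    case True
    then show ?thesis using C by (simp add: ennreal_mult_top)
  next
    case False
    then obtain L where L: "0 \<le> L" "BMO_log_norm k f = ennreal L" by (cases "BMO_log_norm k f") auto
    show ?thesis
      unfolding atom_product_sup_def
    proof (rule SUP_least)
      fix axr assume "axr \<in> {(a, x, r). H1r_atom k q a x r}"
      then obtain a x r where axr: "axr = (a, x, r)" "H1r_atom k q a x r" by auto
      have "H1r_norm k p (atom_product k f a x r) \<le> ennreal C * BMO_log_norm k f"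
      \<comment> \<open>The logarithmic norm L may be 0 while t has to be positive, so the bound is
        applied with t = L + e / C.\<close>
      proof (rule ennreal_le_epsilon)
        fix e :: real assume e: "0 < e"
        have "H1r_norm k p (atom_product k f a x r) \<le> ennreal (C * (L + e / C))"
          using e C L by (intro bound[OF f axr(2)]) (auto intro!: add_nonneg_pos ennreal_leI)
        also have "C * (L + e / C) = C * L + e" using C by (simp add: distrib_left)
        also have "ennreal (C * L + e) = ennreal C * BMO_log_norm k f + ennreal e"
          using C L e by (simp add: ennreal_mult)
        finally show "H1r_norm k p (atom_product k f a x r) \<le> ennreal C * BMO_log_norm k f + ennreal e" .
      qed
      then show "(case axr of (a, x, r) \<Rightarrow> H1r_norm k p (atom_product k f a x r)) \<le> ennreal C * BMO_log_norm k f"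
        by (simp add: axr)
    qed
  qed
  with C show ?thesis by blast
qed

lemma BMO_norm_le_BMO_log_norm: "BMO_norm k f \<le> BMO_log_norm k f"
  unfolding BMO_norm_def BMO_log_norm_def
proof (rule SUP_mono)
  fix xr assume "xr \<in> {(x, r). is_ball k x r}"
  then obtain x r where xr: "xr = (x, r)" "is_ball k x r" by auto
  then have "1 \<le> ln (exp 1 + x $ k / r)"
    by (intro ln_exp_1_plus_ge_1) (auto simp: is_ball_def halfspace_def)
  then have "1 * MO f (hball k x r) \<le> ennreal (ln (exp 1 + x $ k / r)) * MO f (hball k x r)"
    by (intro mult_right_mono) auto
  with xr show "\<exists>yr\<in>{(x, r). is_ball k x r}. (case xr of (x, r) \<Rightarrow> MO f (hball k x r)) \<le>
      (case yr of (x, r) \<Rightarrow> ennreal (ln (exp 1 + x $ k / r)) * MO f (hball k x r))"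
    by (intro bexI[of _ xr]) auto
qed

text \<open>Without a representation the norm is an infimum over the empty set, hence
  infinite.\<close>

lemma H1r_norm_finiteD:
  assumes "H1r_norm k p g < \<infinity>"
  shows "g \<in> H1r k p"
proof (rule ccontr)
  assume "g \<notin> H1r k p"
  then have "{(c, a). H1r_representation k p g c a} = {}" by (auto simp: H1r_def)
  then have "H1r_norm k p g = \<infinity>" unfolding H1r_norm_def by simp
  with assms show False by simp
qed

theorem lemma2p4:
  fixes k :: "'n::finite" and p q :: ennreal
  assumes "1 < p" and "1 < q"
  shows "(\<forall>f \<in> BMO k.
            f \<in> BMO_log k \<longleftrightarrow>
              (\<forall>a x r. H1r_atom k q a x r \<longrightarrow> atom_product k f a x r \<in> H1r k p) \<and>
              atom_product_sup k p q f < \<infinity>) \<and>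
         (\<exists>C::real. C \<ge> 1 \<and> (\<forall>f \<in> BMO k.
            BMO_log_norm k f \<le> ennreal C * (BMO_norm k f + atom_product_sup k p q f) \<and>
            BMO_norm k f + atom_product_sup k p q f \<le> ennreal C * BMO_log_norm k f))"
proof -
  obtain C1 where C1: "1 \<le> C1"
    "\<And>f. f \<in> BMO k \<Longrightarrow> BMO_log_norm k f \<le> ennreal C1 * (BMO_norm k f + atom_product_sup k p q f)"
    using BMO_log_norm_le_atom_product_sup[OF assms] by blast
  obtain C2 where C2: "0 < C2"
    "\<And>f. f \<in> BMO k \<Longrightarrow> atom_product_sup k p q f \<le> ennreal C2 * BMO_log_norm k f"
    using atom_product_sup_le_BMO_log_norm[OF assms, of k] by blast
  have iff: "f \<in> BMO_log k \<longleftrightarrow>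
      (\<forall>a x r. H1r_atom k q a x r \<longrightarrow> atom_product k f a x r \<in> H1r k p) \<and> atom_product_sup k p q f < \<infinity>"
    if f: "f \<in> BMO k" for f
  proof
    assume "f \<in> BMO_log k"
    then have "ennreal C2 * BMO_log_norm k f < \<infinity>" by (simp add: BMO_log_def ennreal_mult_less_top)
    with C2(2)[OF f] have fin: "atom_product_sup k p q f < \<infinity>" by (rule order.strict_trans1)
    have "atom_product k f a x r \<in> H1r k p" if "H1r_atom k q a x r" for a x r
    proof -
      have "H1r_norm k p (atom_product k f a x r) \<le> atom_product_sup k p q f"
        unfolding atom_product_sup_def using that by (intro SUP_upper2[of "(a, x, r)"]) auto
      then have "H1r_norm k p (atom_product k f a x r) < \<infinity>" using fin by (rule order.strict_trans1)
      then show ?thesis by (rule H1r_norm_finiteD)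
    qed
    with fin show "(\<forall>a x r. H1r_atom k q a x r \<longrightarrow> atom_product k f a x r \<in> H1r k p) \<and>
      atom_product_sup k p q f < \<infinity>" by blast
  next
    assume "(\<forall>a x r. H1r_atom k q a x r \<longrightarrow> atom_product k f a x r \<in> H1r k p) \<and>
      atom_product_sup k p q f < \<infinity>"
    then have "ennreal C1 * (BMO_norm k f + atom_product_sup k p q f) < \<infinity>"
      using f by (simp add: BMO_def ennreal_mult_less_top)
    with C1(2)[OF f] have "BMO_log_norm k f < \<infinity>" by (rule order.strict_trans1)
    with f show "f \<in> BMO_log k" by (simp add: BMO_def BMO_log_def)
  qed
  \<comment> \<open>Since C1 \<ge> 1, the sum dominates both C1 and 1 + C2, the constants of the two
    inequalities.\<close>
  define C where "C = C1 + C2"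
  have C: "1 \<le> C" "C1 \<le> C" "1 + C2 \<le> C" using C1 C2 by (auto simp: C_def)
  have "BMO_log_norm k f \<le> ennreal C * (BMO_norm k f + atom_product_sup k p q f) \<and>
      BMO_norm k f + atom_product_sup k p q f \<le> ennreal C * BMO_log_norm k f" if f: "f \<in> BMO k" for f
  proof
    have "ennreal C1 * (BMO_norm k f + atom_product_sup k p q f)
        \<le> ennreal C * (BMO_norm k f + atom_product_sup k p q f)"
      using C by (intro mult_right_mono ennreal_leI) auto
    with C1(2)[OF f] show "BMO_log_norm k f \<le> ennreal C * (BMO_norm k f + atom_product_sup k p q f)"
      by (rule order_trans)
    have "BMO_norm k f + atom_product_sup k p q f \<le> BMO_log_norm k f + ennreal C2 * BMO_log_norm k f"
      by (intro add_mono BMO_norm_le_BMO_log_norm C2(2) f)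
    also have "\<dots> = ennreal (1 + C2) * BMO_log_norm k f"
      using C2(1) by (simp add: distrib_right)
    also have "\<dots> \<le> ennreal C * BMO_log_norm k f" using C by (intro mult_right_mono ennreal_leI) auto
    finally show "BMO_norm k f + atom_product_sup k p q f \<le> ennreal C * BMO_log_norm k f" .
  qed
  with iff C(1) show ?thesis by blast
qed

end
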